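(* Let $\alpha\in\mathbb{R}\setminus\{0\}$ and let $u_0(z)=b_0+\dfrac{c_0z}{1-p_0z}$ with $b_0,c_0,p_0\in\mathbb{C}$, $c_0\neq 0$, $|p_0|<1$. Let $u$ be the solution of the $\alpha$-Szegő equation $i\partial_tu=\Pi(|u|^2u)+\alpha(u|1)$ with $u(0)=u_0$. (i) If $\alpha<0$, then for every $s\ge 0$ there is a constant $C$ independent of $t$ such that $\|u(t)\|_{H^s}\le C$ for all $t\in\mathbb{R}$. (ii) If $\alpha>0$, then $u$ has Sobolev norms growing exponentially in time, in the sense that for every $s>\frac12$ there is a constant $C_{\alpha,s}>0$ with $$\|u(t)\|_{H^s}\simeq e^{C_{\alpha,s}|t|}\quad\text{as } |t|\to\infty,$$ if and only if $$E_\alpha=\tfrac14Q^2+\tfrac{\alpha}{2}Q,$$ where $Q=Q(u)$ and $E_\alpha=E_\alpha(u)$ are the (conserved) mass and energy of the solution.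
   Context: $\mathbb{S}^1=\{z\in\mathbb{C}:|z|=1\}$, $z=e^{i\theta}$. $L^2(\mathbb{S}^1)$ carries the inner product $(u|v)=\frac1{2\pi}\int_{-\pi}^{\pi}u(e^{ix})\overline{v(e^{ix})}\,dx$, so $(u|1)$ is the mean of $u$. The Szegő projector is $\Pi\big(\sum_{k\in\mathbb{Z}}\hat u(k)e^{ik\theta}\big)=\sum_{k\ge0}\hat u(k)e^{ik\theta}$. $L^2_+$ is the subspace of $L^2(\mathbb{S}^1)$ of functions with $\hat u(k)=0$ for $k<0$, and $H^s_+=H^s(\mathbb{S}^1)\cap L^2_+$, where $\|u\|_{H^s}^2=\sum_k(1+k^2)^s|\hat u(k)|^2$. The $\alpha$-Szegő equation is globally well-posed in $H^s_+$ for $s\ge\frac12$ (unique global solution for each initial datum), so the solution is defined for all $t\in\mathbb{R}$. It conserves the mass $Q(u)=\int_{\mathbb{S}^1}|u|^2\frac{d\theta}{2\pi}$ and the energy $E_\alpha(u)=\frac14\int_{\mathbb{S}^1}|u|^4\frac{d\theta}{2\pi}+\frac12\alpha|(u|1)|^2$. The notation $f(t)\simeq g(t)$ as $|t|\to\infty$ means that there are constants $0<m\le M'$, independent of $t$, with $m\,g(t)\le f(t)\le M'g(t)$ for all sufficiently large $|t|$. Constants may depend on the fixed datum $u_0$. *)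

theory Defs
  imports "HOL-Analysis.Analysis" "HOL-Library.Landau_Symbols"
begin

text \<open>A function on the unit circle is represented by some function on the complex plane, of which
  only the values at the points \<open>cis x\<close>, up to null sets of \<open>x \<in> [-\<pi>, \<pi>]\<close>, are used.\<close>

definition circle_mean :: "(complex \<Rightarrow> 'a::{banach, second_countable_topology}) \<Rightarrow> 'a" where
  "circle_mean f = (1 / (2 * pi)) *\<^sub>R (LINT x:{-pi..pi}|lborel. f (cis x))"

definition circle_inner :: "(complex \<Rightarrow> complex) \<Rightarrow> (complex \<Rightarrow> complex) \<Rightarrow> complex" where
  "circle_inner u v = circle_mean (\<lambda>z. u z * cnj (v z))"

definition circle_ae_eq :: "(complex \<Rightarrow> complex) \<Rightarrow> (complex \<Rightarrow> complex) \<Rightarrow> bool" where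
  "circle_ae_eq u v \<longleftrightarrow> (AE x in lborel. x \<in> {-pi..pi} \<longrightarrow> u (cis x) = v (cis x))"

definition fourier_coeff :: "(complex \<Rightarrow> complex) \<Rightarrow> int \<Rightarrow> complex" where
  "fourier_coeff u k = circle_inner u (\<lambda>z. z powi k)"

definition L2_circle :: "(complex \<Rightarrow> complex) set" where
  "L2_circle = {u. set_borel_measurable lborel {-pi..pi} (\<lambda>x. u (cis x)) \<and>
                   set_integrable lborel {-pi..pi} (\<lambda>x. (cmod (u (cis x)))\<^sup>2)}"

definition L2_plus :: "(complex \<Rightarrow> complex) set" where
  "L2_plus = {u \<in> L2_circle. \<forall>k<0. fourier_coeff u k = 0}"

definition L2_circle_norm :: "(complex \<Rightarrow> complex) \<Rightarrow> real" where
  "L2_circle_norm u = sqrt (circle_mean (\<lambda>z. (cmod (u z))\<^sup>2))"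

text \<open>For \<open>s \<ge> 0\<close>. The value of \<open>Hs_norm s u\<close> is only meaningful for \<open>u \<in> Hs_circle s\<close>: if the
  sum diverges, \<open>infsum\<close>, and with it \<open>Hs_norm\<close>, is \<open>0\<close>.\<close>

definition Hs_circle :: "real \<Rightarrow> (complex \<Rightarrow> complex) set" where
  "Hs_circle s = {u \<in> L2_circle.
     (\<lambda>k::int. (1 + (real_of_int k)\<^sup>2) powr s * (cmod (fourier_coeff u k))\<^sup>2) summable_on UNIV}"

definition Hs_plus :: "real \<Rightarrow> (complex \<Rightarrow> complex) set" where
  "Hs_plus s = Hs_circle s \<inter> L2_plus"

definition Hs_norm :: "real \<Rightarrow> (complex \<Rightarrow> complex) \<Rightarrow> real" where
  "Hs_norm s u =
     sqrt (\<Sum>\<^sub>\<infinity>k::int. (1 + (real_of_int k)\<^sup>2) powr s * (cmod (fourier_coeff u k))\<^sup>2)"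

text \<open>\<open>g\<close> is a representative of the Szego projection of \<open>f\<close>. This is a relation since elements
  of \<open>L\<^sup>2\<close> are determined, by their Fourier coefficients, only almost everywhere.\<close>

definition is_szego_proj :: "(complex \<Rightarrow> complex) \<Rightarrow> (complex \<Rightarrow> complex) \<Rightarrow> bool" where
  "is_szego_proj f g \<longleftrightarrow> f \<in> L2_circle \<and> g \<in> L2_circle \<and>
     (\<forall>k. fourier_coeff g k = (if k \<ge> 0 then fourier_coeff f k else 0))"

text \<open>Global solutions in \<open>C(\<real>, H\<^sup>1\<^sup>/\<^sup>2\<^sub>+)\<close>, the largest of the spaces \<open>C(\<real>, H\<^sup>s\<^sub>+)\<close>, \<open>s \<ge> 1/2\<close>, in which
  the equation is well-posed; a solution in any of them is thus a solution in this sense. The time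
  derivative is the limit of the difference quotients in \<open>L\<^sup>2\<close>. This is no restriction: by the
  embedding of \<open>H\<^sup>1\<^sup>/\<^sup>2\<close> in \<open>L\<^sup>6\<close>, the right-hand side is a continuous function of time with values
  in \<open>L\<^sup>2\<close>, so distributional solutions in \<open>C(\<real>, H\<^sup>1\<^sup>/\<^sup>2\<^sub>+)\<close> are of class \<open>C\<^sup>1\<close> into \<open>L\<^sup>2\<close>.\<close>

definition alpha_szego_solution :: "real \<Rightarrow> (real \<Rightarrow> complex \<Rightarrow> complex) \<Rightarrow> bool" where
  "alpha_szego_solution \<alpha> u \<longleftrightarrow>
     (\<forall>t. u t \<in> Hs_plus (1/2)) \<and>
     (\<forall>t. ((\<lambda>r. Hs_norm (1/2) (\<lambda>z. u r z - u t z)) \<longlongrightarrow> 0) (at t)) \<and>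
     (\<forall>t. \<exists>g. is_szego_proj (\<lambda>z. of_real ((cmod (u t z))\<^sup>2) * u t z) g \<and>
        ((\<lambda>h. L2_circle_norm (\<lambda>z. \<i> * ((u (t + h) z - u t z) / of_real h)
                - (g z + of_real \<alpha> * circle_inner (u t) (\<lambda>_. 1)))) \<longlongrightarrow> 0) (at 0))"

definition szego_mass :: "(complex \<Rightarrow> complex) \<Rightarrow> real" where
  "szego_mass u = circle_mean (\<lambda>z. (cmod (u z))\<^sup>2)"

definition szego_energy :: "real \<Rightarrow> (complex \<Rightarrow> complex) \<Rightarrow> real" where
  "szego_energy \<alpha> u = 1/4 * circle_mean (\<lambda>z. (cmod (u z))^4)
     + 1/2 * \<alpha> * (cmod (circle_inner u (\<lambda>_. 1)))\<^sup>2"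

text \<open>The filter \<open>at_infinity\<close> on the reals expresses \<open>|t| \<rightarrow> \<infinity>\<close>. The lower bound in \<open>\<Theta>\<close> makes the
  norm positive, so \<open>u t\<close> cannot have a divergent \<open>Hs_norm\<close> sum for large \<open>|t|\<close>.\<close>

definition exponential_sobolev_growth :: "(real \<Rightarrow> complex \<Rightarrow> complex) \<Rightarrow> bool" where
  "exponential_sobolev_growth u \<longleftrightarrow>
     (\<forall>s>1/2. \<exists>C>0. (\<lambda>t. Hs_norm s (u t)) \<in> \<Theta>[at_infinity](\<lambda>t. exp (C * \<bar>t\<bar>)))"

end

theory Submission
  imports Defs "HOL-Probability.Probability_Measure" "HOL-Analysis.Harmonic_Numbers"
      "HOL-Real_Asymp.Real_Asymp"
begin

text \<open>The functions \<open>v = b + c q\<close> with \<open>q = z / (1 - p z)\<close>, \<open>|p| < 1\<close>, form an invariant manifold of the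
  equation. Indeed, on the circle \<open>|q|\<^sup>2\<close> is a linear combination of \<open>1\<close>, \<open>q\<close> and \<open>q\<^sup>*\<close>, so the
  projection of \<open>|v|\<^sup>2 v\<close> is a combination of \<open>1\<close>, \<open>q\<close> and \<open>q\<^sup>2\<close> (\<open>rational_profile_cubic\<close>), just as the
  derivative of \<open>v\<close> in its parameters. This gives a system of ordinary differential equations for \<open>b\<close>, \<open>c\<close> and
  \<open>p\<close>. It has the invariants \<open>K = |c|\<^sup>2 / (1 - |p|\<^sup>2)\<^sup>2\<close> and \<open>Q = |b|\<^sup>2 + K (1 - |p|\<^sup>2)\<close>, the mass.
  With \<open>K\<close> inserted as a constant the system is polynomial, and the invariants keep its solutions in a bounded set
  with \<open>|p| < 1\<close>, so they are global (\<open>profile_flow\<close>).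

  The given solution \<open>u\<close> is only known to be of class \<open>H\<^sup>1\<^sup>/\<^sup>2\<close>, so it has to be identified with the profile
  (\<open>szego_rational_uniqueness\<close>). In the derivative of \<open>\<parallel>u - v\<parallel>\<^sup>2\<close> there remains a term of size
  \<open>|u| |u - v|\<^sup>2\<close>, and \<open>u\<close> need not be bounded. But its part of frequencies up to \<open>N\<close> is bounded by a multiple of
  the square root of \<open>ln N\<close>, and the rest has norm at most a multiple of \<open>1 / sqrt N\<close> in \<open>L\<^sup>2\<close>. Gronwall's
  inequality yields a bound that tends to \<open>0\<close> as \<open>N\<close> grows. This part rests on Parseval's identity, which follows
  from the density of the trigonometric polynomials.

  The coefficients of \<open>v\<close> are \<open>b\<close> and \<open>c p\<^sup>n\<close>. Hence, with \<open>y = 1 - |p|\<^sup>2\<close>, the squared norm in \<open>H\<^sup>s\<close> has the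
  size of \<open>y\<^sup>1\<^sup>-\<^sup>2\<^sup>s\<close> when \<open>y\<close> is small (\<open>rational_profile_Hs_bounds\<close>), and everything depends on how close
  the pole comes to the circle. The real part of \<open>W = c p\<^sup>* b\<^sup>*\<close> equals \<open>\<delta> - \<beta> y + K y\<^sup>2\<close> with
  \<open>\<beta> = (Q + K - \<alpha>) / 2\<close> and a constant \<open>\<delta>\<close>, and \<open>K \<delta>\<close> is the difference of the energy \<open>E\<^sub>\<alpha>\<close> and
  \<open>Q\<^sup>2 / 4 + \<alpha> Q / 2\<close> (\<open>energy_mass_condition\<close>). On the other hand \<open>|W| \<le> sqrt (K Q) y\<close>. Therefore \<open>y\<close> stays
  away from \<open>0\<close> if \<open>\<delta> \<noteq> 0\<close>.

  If \<open>\<delta> = 0\<close>, the modulus and the real part of \<open>W\<close> combine to \<open>y'\<^sup>2 = 4 y\<^sup>2 (D - \<alpha> K y)\<close> with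
  \<open>D = K Q - \<beta>\<^sup>2\<close>, and \<open>g = 1 / y\<close> satisfies \<open>g'' = 4 D g - 2 \<alpha> K\<close>. For \<open>\<alpha> > 0\<close> the first
  formula forces \<open>D > 0\<close>, and \<open>g\<close> is the sum of a constant and positive multiples of \<open>exp (\<plusminus>2 sqrt D t)\<close>: exponential growth
  (\<open>critical_growth\<close>). For \<open>\<alpha> < 0\<close> and \<open>D \<ge> 0\<close> the function \<open>g\<close> would be strictly convex with \<open>g''\<close> bounded
  below by a positive constant, so \<open>g'\<close> would vanish somewhere, which contradicts the formula for \<open>y'\<^sup>2\<close>. So \<open>D < 0\<close>, and
  \<open>D - \<alpha> K y \<ge> 0\<close> keeps \<open>y\<close> away from \<open>0\<close> (\<open>critical_bounded_below\<close>).\<close>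

section \<open>Normalized arc length on the circle\<close>

text \<open>Only the values on the circle matter for functions on the plane that represent functions on the circle, and
  such functions need not be Borel measurable off the circle. Sets are therefore measurable as soon as their pullback
  to the angles in \<open>[-\<pi>, \<pi>]\<close> is.\<close>

definition circle_sigma :: "complex measure" where
  "circle_sigma = sigma UNIV {A. cis -` A \<inter> {-pi..pi} \<in> sets borel}"

definition circle_measure :: "complex measure" where
  "circle_measure =
     distr (density (restrict_space lborel {-pi..pi}) (\<lambda>_. ennreal (1 / (2 * pi)))) circle_sigma
         cis"

lemma sets_circle_sigma: "sets circle_sigma = {A. cis -` A \<inter> {-pi..pi} \<in> sets borel}"
proof -
  have "sigma_algebra UNIV {A. cis -` A \<inter> {-pi..pi} \<in> sets borel}"
    unfolding sigma_algebra_iff2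
  proof (intro conjI ballI allI impI)
    fix S assume "S \<in> {A. cis -` A \<inter> {-pi..pi} \<in> sets borel}"
    moreover have "cis -` (UNIV - S) \<inter> {-pi..pi} = {-pi..pi} - (cis -` S \<inter> {-pi..pi})" by auto
    ultimately show "UNIV - S \<in> {A. cis -` A \<inter> {-pi..pi} \<in> sets borel}" by auto
  next
    fix A :: "nat \<Rightarrow> complex set" assume "range A \<subseteq> {A. cis -` A \<inter> {-pi..pi} \<in> sets borel}"
    then have "\<And>i. cis -` (A i) \<inter> {-pi..pi} \<in> sets borel" by auto
    then have "(\<Union>i. cis -` (A i) \<inter> {-pi..pi}) \<in> sets borel" by blast
    moreover have "cis -` (\<Union>(range A)) \<inter> {-pi..pi} = (\<Union>i. cis -` (A i) \<inter> {-pi..pi})" by auto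
    ultimately show "\<Union>(range A) \<in> {A. cis -` A \<inter> {-pi..pi} \<in> sets borel}" by simp
  qed auto
  then show ?thesis unfolding circle_sigma_def
    by (intro sigma_algebra.sets_measure_of_eq)
qed

lemma space_circle_sigma [simp]: "space circle_sigma = UNIV"
  by (simp add: circle_sigma_def space_measure_of_conv)

lemma cis_measurable_circle: "cis \<in> measurable (restrict_space lborel {-pi..pi}) circle_sigma"
  by (rule measurableI) (auto simp: sets_circle_sigma sets_restrict_space_iff space_restrict_space)

lemma cis_measurable_density:
  "cis \<in> measurable (density (restrict_space lborel {-pi..pi}) (\<lambda>_. ennreal (1
      / (2 * pi)))) circle_sigma"
  using cis_measurable_circle by simp

lemma space_circle_measure [simp]: "space circle_measure = UNIV"
  and sets_circle_measure: "sets circle_measure = {A. cis -` A \<inter> {-pi..pi} \<in> sets borel}"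
  by (simp_all add: circle_measure_def sets_circle_sigma)

lemma borel_measurable_circle_iff:
  fixes f :: "complex \<Rightarrow> 'a::{banach, second_countable_topology}"
  shows "f \<in> borel_measurable circle_measure \<longleftrightarrow>
    set_borel_measurable lborel {-pi..pi} (\<lambda>x. f (cis x))"
proof -
  have "f \<in> borel_measurable circle_measure \<longleftrightarrow>
      (\<lambda>x. f (cis x)) \<in> borel_measurable (restrict_space lborel {-pi..pi})"
    unfolding measurable_def sets_circle_measure space_circle_measure
    by (auto simp: sets_restrict_space_iff space_restrict_space vimage_def
        Collect_conj_eq[symmetric]
        Int_def)
  also have "\<dots> \<longleftrightarrow> set_borel_measurable lborel {-pi..pi} (\<lambda>x. f (cis x))"
    unfolding set_borel_measurable_def by (subst borel_measurable_restrict_space_iff) auto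
  finally show ?thesis .
qed

lemma borel_measurable_circle_iff':
  fixes f :: "complex \<Rightarrow> 'a::{banach, second_countable_topology}"
  shows "f \<in> borel_measurable circle_measure \<longleftrightarrow> f \<in> borel_measurable circle_sigma"
  by (simp add: circle_measure_def)

lemma integrable_circle_iff:
  fixes f :: "complex \<Rightarrow> 'a::{banach, second_countable_topology}"
  assumes "f \<in> borel_measurable circle_measure"
  shows "integrable circle_measure f \<longleftrightarrow> set_integrable lborel {-pi..pi} (\<lambda>x. f (cis x))"
proof -
  have m: "(\<lambda>x. f (cis x)) \<in> borel_measurable (restrict_space lborel {-pi..pi})"
    using assms cis_measurable_circle by (simp add: borel_measurable_circle_iff')
  have "integrable circle_measure f \<longleftrightarrow>
    integrable (density (restrict_space lborel {-pi..pi}) (\<lambda>_. ennreal (1 / (2 * pi))))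
        (\<lambda>x. f (cis x))"
    unfolding circle_measure_def
    by (rule integrable_distr_eq[OF cis_measurable_density])
       (use assms in \<open>simp add: borel_measurable_circle_iff'\<close>)
  also have "\<dots> \<longleftrightarrow> integrable (restrict_space lborel {-pi..pi}) (\<lambda>x. f (cis x))"
    using m integrable_scaleR_right[of "2 * pi" "restrict_space lborel {-pi..pi}"
        "\<lambda>x. (1 / (2 * pi)) *\<^sub>R f (cis x)"]
    by (subst integrable_density) auto
  also have "\<dots> \<longleftrightarrow> set_integrable lborel {-pi..pi} (\<lambda>x. f (cis x))"
    by (simp add: set_integrable_eq)
  finally show ?thesis .
qed

lemma circle_mean_integral:
  fixes f :: "complex \<Rightarrow> 'a::{banach, second_countable_topology}"
  shows "circle_mean f = integral\<^sup>L circle_measure f"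
proof (cases "f \<in> borel_measurable circle_measure")
  case True
  have m: "(\<lambda>x. f (cis x)) \<in> borel_measurable (restrict_space lborel {-pi..pi})"
    using True cis_measurable_circle by (simp add: borel_measurable_circle_iff')
  have "integral\<^sup>L circle_measure f
      = integral\<^sup>L (density (restrict_space lborel {-pi..pi}) (\<lambda>_. ennreal (1 / (2 * pi))))
      (\<lambda>x. f (cis x))"
    unfolding circle_measure_def
    by (rule integral_distr[OF cis_measurable_density])
       (use True in \<open>simp add: borel_measurable_circle_iff'\<close>)
  also have "\<dots> = (1 / (2 * pi)) *\<^sub>R integral\<^sup>L (restrict_space lborel {-pi..pi}) (\<lambda>x. f (cis x))"
    using m by (subst integral_density) auto
  also have "\<dots> = circle_mean f"
    by (simp add: circle_mean_def set_lebesgue_integral_def integral_restrict_space)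
  finally show ?thesis ..
next
  case False
  then have "\<not> set_integrable lborel {-pi..pi} (\<lambda>x. f (cis x))"
    unfolding borel_measurable_circle_iff set_borel_measurable_def set_integrable_def
    using borel_measurable_integrable by blast
  moreover have "\<not> integrable circle_measure f"
    using False borel_measurable_integrable by blast
  ultimately show ?thesis
    by (auto simp: circle_mean_def not_integrable_integral_eq set_lebesgue_integral_def
        set_integrable_def)
qed

lemma AE_circle_norm: "AE z in circle_measure. cmod z = 1"
  unfolding circle_measure_def
  by (subst AE_distr_iff[OF cis_measurable_density]) (auto simp: sets_circle_sigma)

interpretation circle: prob_space circle_measure
proof
  have "emeasure circle_measure (space circle_measure) =
      emeasure (density (restrict_space lborel {-pi..pi}) (\<lambda>_. ennreal (1 / (2 * pi)))) {-pi..pi}"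
    unfolding circle_measure_def
    by (subst emeasure_distr[OF cis_measurable_density])
       (auto simp: sets_circle_sigma space_restrict_space)
  also have "\<dots> = ennreal (1 / (2 * pi)) * ennreal (2 * pi)"
    by (subst emeasure_density_const) 
      (auto simp: emeasure_restrict_space sets_restrict_space_iff emeasure_lborel_Icc)
  also have "\<dots> = 1" by (simp add: ennreal_mult[symmetric])
  finally show "emeasure circle_measure (space circle_measure) = 1" .
qed

lemma circle_measure_UNIV [simp]: "measure circle_measure UNIV = 1"
  using circle.prob_space by simp

text \<open>As \<open>cis\<close> is injective on the open interval, the image of a null set of angles in it is a measurable null
  set; the two end points contribute the single point \<open>-1\<close>.\<close>

lemma AE_circle_transfer:
  assumes "AE x in lborel. x \<in> {-pi..pi} \<longrightarrow> P (cis x)"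
  shows "AE z in circle_measure. P z"
proof -
  obtain N where N: "{x \<in> space lborel. \<not> (x \<in> {-pi..pi} \<longrightarrow> P (cis x))} \<subseteq> N" "emeasure lborel N = 0"
      "N \<in> sets lborel"
    using AE_E[OF assms] by metis
  let ?A = "insert (-1) (cis ` (N \<inter> {-pi<..<pi}))"
  have endpoints: "x = -pi \<or> x = pi" if "x \<in> {-pi..pi}" "cis x = -1" for x
  proof -
    have "cos x = -1" using that(2) by (metis cis.sel(1) one_complex.sel(1) uminus_complex.sel(1))
    then have "cos \<bar>x\<bar> = cos pi" by simp
    moreover have "0 \<le> \<bar>x\<bar>" "\<bar>x\<bar> \<le> pi" using that(1) by (auto simp: abs_le_iff)
    ultimately have "\<bar>x\<bar> = pi" using cos_inj_pi[of "\<bar>x\<bar>" pi] by simp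
    then show ?thesis by auto
  qed
  have Arg: "Arg (cis x) = x" if "x \<in> {-pi<..<pi}" for x
    using that by (intro cis_Arg_unique) (auto simp: sgn_eq)
  have vim: "cis -` ?A \<inter> {-pi..pi} = {-pi, pi} \<union> (N \<inter> {-pi<..<pi})"
  proof (intro set_eqI)
    fix x
    show "x \<in> cis -` ?A \<inter> {-pi..pi} \<longleftrightarrow> x \<in> {-pi, pi} \<union> (N \<inter> {-pi<..<pi})"
    proof (cases "x = -pi \<or> x = pi")
      case True
      then have "cis x = -1" by (auto simp: complex_eq_iff)
      then show ?thesis using True by auto
    next
      case False
      show ?thesis
      proof (cases "x \<in> {-pi..pi}")
        case True
        then have x: "x \<in> {-pi<..<pi}" using False by auto
        have "cis x \<noteq> -1" using endpoints[OF True] False by blast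
        moreover have "cis x \<in> cis ` (N \<inter> {-pi<..<pi}) \<longleftrightarrow> x \<in> N \<inter> {-pi<..<pi}"
        proof
          assume "cis x \<in> cis ` (N \<inter> {-pi<..<pi})"
          then obtain y where y: "cis x = cis y" "y \<in> N \<inter> {-pi<..<pi}" by (rule imageE)
          then have "x = y" using Arg[OF x] Arg[of y] by (metis IntD2)
          then show "x \<in> N \<inter> {-pi<..<pi}" using y by simp
        qed (rule imageI)
        ultimately show ?thesis using True False x by simp
      qed (use False in auto)
    qed
  qed
  have "?A \<in> sets circle_measure"
    using N(3) by (auto simp: sets_circle_measure vim)
  moreover have "emeasure circle_measure ?A = 0"
  proof -
    have "emeasure circle_measure ?A =
        emeasure (density (restrict_space lborel {-pi..pi}) (\<lambda>_. ennreal (1 / (2 * pi))))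
            ({-pi, pi} \<union> (N \<inter> {-pi<..<pi}))"
      using \<open>?A \<in> sets circle_measure\<close> unfolding circle_measure_def
      by (subst emeasure_distr[OF cis_measurable_density]) (simp_all add: space_restrict_space vim)
    also have "\<dots> = ennreal (1 / (2 * pi)) * emeasure lborel ({-pi, pi} \<union> (N \<inter> {-pi<..<pi}))"
    proof -
      have "{-pi, pi} \<union> (N \<inter> {-pi<..<pi}) \<in> sets (restrict_space lborel {-pi..pi})"
        using N(3) by (auto simp: sets_restrict_space_iff)
      then show ?thesis
        by (subst emeasure_density_const) (simp_all, subst emeasure_restrict_space, auto)
    qed
    also have "emeasure lborel ({-pi, pi} \<union> (N \<inter> {-pi<..<pi})) = 0"
    proof -
      have "{-pi, pi} \<union> (N \<inter> {-pi<..<pi}) \<in> null_sets lborel"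
        using N(2,3) by (intro null_sets.Un null_set_Int2
            finite_imp_null_set_lborel[of "{-pi, pi}"]) (auto simp: null_sets_def)
      then show ?thesis by auto
    qed
    finally show ?thesis by simp
  qed
  moreover have "{z \<in> space circle_measure. \<not> (cmod z = 1 \<longrightarrow> P z)} \<subseteq> ?A"
  proof
    fix z assume "z \<in> {z \<in> space circle_measure. \<not> (cmod z = 1 \<longrightarrow> P z)}"
    then have z: "cmod z = 1" "\<not> P z" by auto
    then have zc: "z = cis (Arg z)" by (subst cis_Arg) (auto simp: sgn_eq)
    have "Arg z \<in> {-pi..pi}" using Arg_bounded[of z] by auto
    moreover have "\<not> P (cis (Arg z))" using z(2) zc by simp
    ultimately have "Arg z \<in> N" using N(1) by auto
    moreover have "z = -1" if "Arg z = pi" using zc that by simp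
    ultimately show "z \<in> ?A" using zc Arg_bounded[of z] by (cases "Arg z = pi") auto
  qed
  ultimately have "AE z in circle_measure. cmod z = 1 \<longrightarrow> P z" by (intro AE_I)
  with AE_circle_norm show ?thesis by eventually_elim simp
qed

lemma circle_ae_eq_iff: "circle_ae_eq u v \<Longrightarrow> AE z in circle_measure. u z = v z"
  unfolding circle_ae_eq_def by (rule AE_circle_transfer)

section \<open>Square-integrable functions on the circle\<close>

lemma L2_circle_iff:
  "u \<in> L2_circle \<longleftrightarrow> u \<in> borel_measurable circle_measure
      \<and> integrable circle_measure (\<lambda>z. (cmod (u z))\<^sup>2)"
  unfolding L2_circle_def borel_measurable_circle_iff[symmetric]
  by (auto simp: integrable_circle_iff)

lemma L2_measurable [measurable_dest]: "u \<in> L2_circle \<Longrightarrow> u \<in> borel_measurable circle_measure"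
  and L2_square_integrable: "u \<in> L2_circle \<Longrightarrow> integrable circle_measure (\<lambda>z. (cmod (u z))\<^sup>2)"
  by (auto simp: L2_circle_iff)

lemma L2_I:
  assumes "u \<in> borel_measurable circle_measure" "integrable circle_measure g"
    and "AE z in circle_measure. (cmod (u z))\<^sup>2 \<le> g z"
  shows "u \<in> L2_circle"
  unfolding L2_circle_iff
proof (intro conjI)
  show "integrable circle_measure (\<lambda>z. (cmod (u z))\<^sup>2)"
    by (rule Bochner_Integration.integrable_bound[OF assms(2)])
        (use assms(1,3) in \<open>auto elim!: eventually_mono\<close>)
qed fact

lemma L2_add: assumes "u \<in> L2_circle" "v \<in> L2_circle" shows "(\<lambda>z. u z + v z) \<in> L2_circle"
proof (rule L2_I)
  show "(\<lambda>z. u z + v z) \<in> borel_measurable circle_measure" using assms by measurable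
  show "integrable circle_measure (\<lambda>z. 2 * (cmod (u z))\<^sup>2 + 2 * (cmod (v z))\<^sup>2)"
    using assms by (auto simp: L2_square_integrable)
  have "(cmod (u z + v z))\<^sup>2 \<le> 2 * (cmod (u z))\<^sup>2 + 2 * (cmod (v z))\<^sup>2" for z
  proof -
    have "(cmod (u z + v z))\<^sup>2 \<le> (cmod (u z) + cmod (v z))\<^sup>2"
      by (intro power_mono norm_triangle_ineq) auto
    also have "\<dots> \<le> 2 * (cmod (u z))\<^sup>2 + 2 * (cmod (v z))\<^sup>2"
      using sum_squares_bound[of "cmod (u z)" "cmod (v z)"] by (simp add: power2_sum)
    finally show ?thesis .
  qed
  then show "AE z in circle_measure. (cmod (u z + v z))\<^sup>2 \<le> 2 * (cmod (u z))\<^sup>2 + 2 * (cmod (v z))\<^sup>2"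
      by simp
qed

lemma L2_cmult: assumes "u \<in> L2_circle" shows "(\<lambda>z. c * u z) \<in> L2_circle"
  using assms by (auto simp: L2_circle_iff norm_mult power_mult_distrib)

lemma L2_uminus: assumes "u \<in> L2_circle" shows "(\<lambda>z. - u z) \<in> L2_circle"
  using L2_cmult[OF assms, of "-1"] by simp

lemma L2_diff: assumes "u \<in> L2_circle" "v \<in> L2_circle" shows "(\<lambda>z. u z - v z) \<in> L2_circle"
  using L2_add[OF assms(1) L2_uminus[OF assms(2)]] by simp

lemma L2_cnj: assumes "u \<in> L2_circle" shows "(\<lambda>z. cnj (u z)) \<in> L2_circle"
proof -
  have "(\<lambda>z. cnj (u z)) \<in> borel_measurable circle_measure"
    by (rule borel_measurable_continuous_on[where f=cnj])
       (use assms in \<open>auto intro: continuous_intros simp: L2_measurable\<close>)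
  then show ?thesis using assms by (simp add: L2_circle_iff)
qed

lemma L2_sum: assumes "\<And>i. i \<in> I \<Longrightarrow> f i \<in> L2_circle" shows "(\<lambda>z. \<Sum>i\<in>I. f i z) \<in> L2_circle"
  using assms
proof (induction I rule: infinite_finite_induct)
  case (insert i I) then show ?case using L2_add[of "f i" "\<lambda>z. \<Sum>i\<in>I. f i z"] by auto
qed (auto simp: L2_circle_iff)

lemma continuous_measurable_circle:
  fixes f :: "complex \<Rightarrow> 'a::{banach, second_countable_topology}"
  assumes "continuous_on (sphere 0 1) f"
  shows "f \<in> borel_measurable circle_measure"
proof -
  have "continuous_on {-pi..pi} (\<lambda>x. f (cis x))"
    by (rule continuous_on_compose2[OF assms]) (auto intro!: continuous_intros)
  then show ?thesis
    unfolding borel_measurable_circle_iff set_borel_measurable_def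
    using borel_measurable_continuous_on_indicator[of "{-pi..pi}" "\<lambda>x. f (cis x)"] by simp
qed

lemma AE_circleI: assumes "\<And>z. cmod z = 1 \<Longrightarrow> P z" shows "AE z in circle_measure. P z"
  using AE_circle_norm by (rule eventually_mono) (use assms in auto)

lemma circle_integrable_bounded:
  fixes f :: "complex \<Rightarrow> 'a::{banach, second_countable_topology}"
  assumes "f \<in> borel_measurable circle_measure" "\<And>z. cmod z = 1 \<Longrightarrow> norm (f z) \<le> B"
  shows "integrable circle_measure f"
  by (rule circle.integrable_const_bound[where B=B]) (use assms in \<open>auto intro: AE_circleI\<close>)

lemma circle_integrable_continuous:
  fixes f :: "complex \<Rightarrow> 'a::{banach, second_countable_topology}"
  assumes "continuous_on (sphere 0 1) f"
  shows "integrable circle_measure f"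
proof -
  have "bounded (f ` sphere 0 1)"
    by (intro compact_imp_bounded compact_continuous_image assms) auto
  then obtain B where "\<And>z. z \<in> sphere 0 1 \<Longrightarrow> norm (f z) \<le> B" unfolding bounded_iff by blast
  then show ?thesis
    by (intro circle_integrable_bounded[where B=B] continuous_measurable_circle assms) auto
qed

lemma L2_mult_bounded:
  assumes "u \<in> L2_circle" "v \<in> borel_measurable circle_measure" "\<And>z. cmod z = 1 \<Longrightarrow> cmod (v z) \<le> B"
  shows "(\<lambda>z. v z * u z) \<in> L2_circle"
proof (rule L2_I)
  show "(\<lambda>z. v z * u z) \<in> borel_measurable circle_measure" using assms by measurable
  show "integrable circle_measure (\<lambda>z. B\<^sup>2 * (cmod (u z))\<^sup>2)" using assms
      by (auto simp: L2_square_integrable)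
  show "AE z in circle_measure. (cmod (v z * u z))\<^sup>2 \<le> B\<^sup>2 * (cmod (u z))\<^sup>2"
    by (rule AE_circleI) (auto simp: norm_mult power_mult_distrib intro!: mult_right_mono power_mono
        assms)
qed

lemma L2_continuous: assumes "continuous_on (sphere 0 1) u" shows "u \<in> L2_circle"
  unfolding L2_circle_iff
  by (intro conjI continuous_measurable_circle circle_integrable_continuous assms continuous_intros)

lemma L2_mult_integrable: assumes "u \<in> L2_circle" "v \<in> L2_circle"
  shows "integrable circle_measure (\<lambda>z. u z * v z)"
proof (rule Bochner_Integration.integrable_bound)
  show "integrable circle_measure (\<lambda>z. (cmod (u z))\<^sup>2 + (cmod (v z))\<^sup>2)"
    using assms by (simp add: L2_square_integrable)
  show "(\<lambda>z. u z * v z) \<in> borel_measurable circle_measure" using assms by measurable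
  have "cmod (u z * v z) \<le> (cmod (u z))\<^sup>2 + (cmod (v z))\<^sup>2" for z
  proof -
    have "0 \<le> cmod (u z) * cmod (v z)" by simp
    then show ?thesis using sum_squares_bound[of "cmod (u z)" "cmod (v z)"]
      unfolding norm_mult by linarith
  qed
  then show "AE z in circle_measure. norm (u z * v z) \<le> norm ((cmod (u z))\<^sup>2 + (cmod (v z))\<^sup>2)"
      by simp
qed

lemma L2_inner_integrable: assumes "u \<in> L2_circle" "v \<in> L2_circle"
  shows "integrable circle_measure (\<lambda>z. u z * cnj (v z))"
  using L2_mult_integrable[OF assms(1) L2_cnj[OF assms(2)]] .

lemma L2_integrable: assumes "u \<in> L2_circle" shows "integrable circle_measure u"
  using L2_mult_integrable[OF assms, of "\<lambda>_. 1"] by (simp add: L2_circle_iff)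

lemma circle_inner_integral: "circle_inner u v = (\<integral>z. u z * cnj (v z) \<partial>circle_measure)"
  by (simp add: circle_inner_def circle_mean_integral)

lemma circle_inner_add_left:
  "u \<in> L2_circle \<Longrightarrow> v \<in> L2_circle \<Longrightarrow> w \<in> L2_circle \<Longrightarrow>
    circle_inner (\<lambda>z. u z + v z) w = circle_inner u w + circle_inner v w"
  unfolding circle_inner_integral distrib_right
  by (intro Bochner_Integration.integral_add L2_inner_integrable)

lemma circle_inner_diff_left:
  "u \<in> L2_circle \<Longrightarrow> v \<in> L2_circle \<Longrightarrow> w \<in> L2_circle \<Longrightarrow>
    circle_inner (\<lambda>z. u z - v z) w = circle_inner u w - circle_inner v w"
  unfolding circle_inner_integral left_diff_distrib
  by (intro Bochner_Integration.integral_diff L2_inner_integrable)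

lemma circle_inner_cmult_left: "circle_inner (\<lambda>z. c * u z) w = c * circle_inner u w"
  by (simp add: circle_inner_integral mult.assoc)

lemma circle_inner_cnj: "cnj (circle_inner u v) = circle_inner v u"
  unfolding circle_inner_integral by (subst Bochner_Integration.integral_cnj[symmetric])
      (simp add: mult.commute)

lemma circle_inner_add_right:
  "u \<in> L2_circle \<Longrightarrow> v \<in> L2_circle \<Longrightarrow> w \<in> L2_circle \<Longrightarrow>
    circle_inner w (\<lambda>z. u z + v z) = circle_inner w u + circle_inner w v"
  using circle_inner_add_left[of u v w]
  unfolding circle_inner_cnj[of _ w, symmetric] by simp

lemma circle_inner_diff_right:
  "u \<in> L2_circle \<Longrightarrow> v \<in> L2_circle \<Longrightarrow> w \<in> L2_circle \<Longrightarrow>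
    circle_inner w (\<lambda>z. u z - v z) = circle_inner w u - circle_inner w v"
  using circle_inner_diff_left[of u v w]
  unfolding circle_inner_cnj[of _ w, symmetric] by simp

lemma circle_inner_cmult_right: "circle_inner w (\<lambda>z. c * u z) = cnj c * circle_inner w u"
  unfolding circle_inner_cnj[of _ w, symmetric] circle_inner_cmult_left by simp

lemma circle_inner_sum_left:
  assumes "\<And>i. i \<in> I \<Longrightarrow> f i \<in> L2_circle" "w \<in> L2_circle"
  shows "circle_inner (\<lambda>z. \<Sum>i\<in>I. f i z) w = (\<Sum>i\<in>I. circle_inner (f i) w)"
  unfolding circle_inner_integral sum_distrib_right
  by (intro Bochner_Integration.integral_sum L2_inner_integrable assms)

lemma L2_circle_norm_sq: "(L2_circle_norm u)\<^sup>2 = (\<integral>z. (cmod (u z))\<^sup>2 \<partial>circle_measure)"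
  by (simp add: L2_circle_norm_def circle_mean_integral)

lemma L2_circle_norm_nonneg [simp]: "0 \<le> L2_circle_norm u"
  by (simp add: L2_circle_norm_def circle_mean_integral)

lemma circle_inner_self: "circle_inner u u = of_real ((L2_circle_norm u)\<^sup>2)"
  by (simp add: circle_inner_integral L2_circle_norm_sq complex_norm_square[symmetric] del:
      of_real_power)

lemma AE_circle_cong_inner:
  assumes "\<And>z. cmod z = 1 \<Longrightarrow> u z = u' z" "\<And>z. cmod z = 1 \<Longrightarrow> v z = v' z"
    "u \<in> L2_circle" "v \<in> L2_circle" "u' \<in> L2_circle" "v' \<in> L2_circle"
  shows "circle_inner u v = circle_inner u' v'"
  unfolding circle_inner_integral
  by (intro integral_cong_AE AE_circleI borel_measurable_integrable[OF L2_inner_integrable])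
      (use assms in auto)

text \<open>Cauchy--Schwarz, from \<open>\<parallel>u - a v\<parallel>\<^sup>2 \<ge> 0\<close>. Taking \<open>a = r (u|v)\<close> with \<open>r\<close> real turns this into an
  inequality for a real quadratic polynomial in \<open>r\<close>.\<close>

lemma circle_cauchy_schwarz:
  assumes u: "u \<in> L2_circle" and v: "v \<in> L2_circle"
  shows "cmod (circle_inner u v) \<le> L2_circle_norm u * L2_circle_norm v"
proof -
  define A B C where "A = (L2_circle_norm u)\<^sup>2" and "B = circle_inner u v" and
      "C = (L2_circle_norm v)\<^sup>2"
  have expand: "(cmod B)\<^sup>2 * (2 * r - r\<^sup>2 * C) \<le> A" for r :: real
  proof -
    let ?a = "of_real r * B"
    have av: "(\<lambda>z. ?a * v z) \<in> L2_circle" using v by (rule L2_cmult)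
    have d: "(\<lambda>z. u z - ?a * v z) \<in> L2_circle" using L2_diff[OF u av] .
    have BB: "B * cnj B = of_real ((cmod B)\<^sup>2)" by (rule complex_norm_square[symmetric])
    have "of_real ((L2_circle_norm (\<lambda>z. u z - ?a * v z))\<^sup>2) =
        circle_inner (\<lambda>z. u z - ?a * v z) (\<lambda>z. u z - ?a * v z)"
      by (rule circle_inner_self[symmetric])
    also have "\<dots> = circle_inner u u - cnj ?a * B - (?a * cnj B - ?a * (cnj ?a * circle_inner v v))"
      unfolding circle_inner_diff_left[OF u av d] circle_inner_cmult_left
        circle_inner_diff_right[OF u av u] circle_inner_diff_right[OF u av v]
            circle_inner_cmult_right
      using circle_inner_cnj[of u v] by (simp add: B_def right_diff_distrib)
    also have "\<dots> = of_real A - (B * cnj B) * (2 * of_real r - of_real (r\<^sup>2 * C))"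
      unfolding circle_inner_self A_def[symmetric] C_def[symmetric]
      by (simp add: algebra_simps power2_eq_square)
    also have "\<dots> = of_real (A - (cmod B)\<^sup>2 * (2 * r - r\<^sup>2 * C))"
      unfolding BB by simp
    finally have "(L2_circle_norm (\<lambda>z. u z - ?a * v z))\<^sup>2 = A - (cmod B)\<^sup>2 * (2 * r - r\<^sup>2 * C)"
      using of_real_eq_iff by blast
    then show ?thesis using zero_le_power2[of "L2_circle_norm (\<lambda>z. u z - ?a * v z)"] by linarith
  qed
  have "(cmod B)\<^sup>2 \<le> A * C"
  proof (cases "C = 0")
    case False
    then have "C > 0" by (simp add: C_def)
    then show ?thesis using expand[of "1 / C"]
      by (simp add: field_simps power2_eq_square)
  next
    case True
    have "(cmod B)\<^sup>2 \<le> 0"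
    proof (rule ccontr)
      assume "\<not> ?thesis"
      then have "(cmod B)\<^sup>2 * (2 * ((A + 1) / (cmod B)\<^sup>2)) = 2 * (A + 1)" by simp
      moreover have "A \<ge> 0" by (simp add: A_def)
      ultimately show False using expand[of "(A + 1) / (cmod B)\<^sup>2"] True by simp
    qed
    then show ?thesis using True by simp
  qed
  then have "(cmod B)\<^sup>2 \<le> (L2_circle_norm u * L2_circle_norm v)\<^sup>2"
    by (simp add: A_def C_def power_mult_distrib)
  then show ?thesis unfolding B_def by (rule power2_le_imp_le) simp
qed

lemma L2_circle_norm_sq_add:
  assumes u: "u \<in> L2_circle" and v: "v \<in> L2_circle"
  shows "(L2_circle_norm (\<lambda>z. u z + v z))\<^sup>2 =
      (L2_circle_norm u)\<^sup>2 + (L2_circle_norm v)\<^sup>2 + 2 * Re (circle_inner u v)"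
proof -
  have uv: "(\<lambda>z. u z + v z) \<in> L2_circle" by (rule L2_add[OF u v])
  have "complex_of_real ((L2_circle_norm (\<lambda>z. u z + v z))\<^sup>2) =
      circle_inner u u + circle_inner v v + (circle_inner u v + cnj (circle_inner u v))"
    unfolding circle_inner_self[symmetric] circle_inner_add_left[OF u v uv]
      circle_inner_add_right[OF u v u] circle_inner_add_right[OF u v v] circle_inner_cnj by simp
  also have "\<dots> = of_real ((L2_circle_norm u)\<^sup>2 + (L2_circle_norm v)\<^sup>2 + 2 * Re (circle_inner u v))"
    by (simp only: circle_inner_self complex_add_cnj of_real_add)
  finally show ?thesis using of_real_eq_iff by blast
qed

lemma L2_circle_norm_triangle:
  assumes u: "u \<in> L2_circle" and v: "v \<in> L2_circle"
  shows "L2_circle_norm (\<lambda>z. u z + v z) \<le> L2_circle_norm u + L2_circle_norm v"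
proof (rule power2_le_imp_le)
  have "Re (circle_inner u v) \<le> L2_circle_norm u * L2_circle_norm v"
    using circle_cauchy_schwarz[OF u v] complex_Re_le_cmod[of "circle_inner u v"] by linarith
  then show "(L2_circle_norm (\<lambda>z. u z + v z))\<^sup>2 \<le> (L2_circle_norm u + L2_circle_norm v)\<^sup>2"
    unfolding L2_circle_norm_sq_add[OF u v] by (simp add: power2_sum)
qed simp

lemma L2_circle_norm_cmult: "L2_circle_norm (\<lambda>z. c * u z) = cmod c * L2_circle_norm u"
  by (simp add: L2_circle_norm_def circle_mean_integral norm_mult power_mult_distrib real_sqrt_mult)

lemma L2_circle_norm_uminus: "L2_circle_norm (\<lambda>z. - u z) = L2_circle_norm u"
  by (simp add: L2_circle_norm_def)

lemma L2_circle_norm_triangle_diff: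
  assumes "u \<in> L2_circle" "v \<in> L2_circle"
  shows "L2_circle_norm (\<lambda>z. u z - v z) \<le> L2_circle_norm u + L2_circle_norm v"
  using L2_circle_norm_triangle[OF assms(1) L2_uminus[OF assms(2)]]
      by (simp add: L2_circle_norm_uminus)

lemma L2_circle_norm_bounded:
  assumes "u \<in> borel_measurable circle_measure" "\<And>z. cmod z = 1 \<Longrightarrow> cmod (u z) \<le> B"
  shows "L2_circle_norm u \<le> B"
proof (rule power2_le_imp_le)
  show "0 \<le> B" using assms(2)[of 1] order_trans[OF norm_ge_zero] by simp
  have m: "(\<lambda>z. (cmod (u z))\<^sup>2) \<in> borel_measurable circle_measure" using assms(1) by measurable
  have "(\<integral>z. (cmod (u z))\<^sup>2 \<partial>circle_measure) \<le> (\<integral>z. B\<^sup>2 \<partial>circle_measure)"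
    by (intro integral_mono_AE circle_integrable_bounded[where B="B\<^sup>2"] AE_circleI m)
       (auto simp: intro!: power_mono assms(2))
  then show "(L2_circle_norm u)\<^sup>2 \<le> B\<^sup>2" by (simp add: L2_circle_norm_sq)
qed

lemma L2_circle_norm_eq_0:
  assumes "u \<in> L2_circle" "L2_circle_norm u = 0"
  shows "AE z in circle_measure. u z = 0"
proof -
  have "(\<integral>z. (cmod (u z))\<^sup>2 \<partial>circle_measure) = 0" using assms(2)
      by (metis L2_circle_norm_sq power_zero_numeral)
  then have "AE z in circle_measure. (cmod (u z))\<^sup>2 = 0"
    using integral_nonneg_eq_0_iff_AE[OF L2_square_integrable[OF assms(1)]] by simp
  then show ?thesis by simp
qed

section \<open>Fourier series\<close>

lemma continuous_on_char: "continuous_on (sphere 0 1) (\<lambda>z::complex. z powi k)"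
  by (intro continuous_intros) auto

lemma L2_char: "(\<lambda>z. z powi k) \<in> L2_circle"
  by (intro L2_continuous continuous_on_char)

lemma cnj_powi_unit: assumes "cmod z = 1" shows "cnj (z powi k) = z powi (-k)"
proof -
  have "cnj z = inverse z" using assms
    by (metis complex_norm_square divide_eq_eq_1 inverse_eq_divide mult.commute
        nonzero_mult_div_cancel_left norm_eq_zero of_real_1 power_one zero_neq_one)
  then show ?thesis by (simp add: power_int_minus power_int_inverse)
qed

text \<open>For \<open>k \<noteq> 0\<close> the primitive \<open>cis (k x) / (\<i> k)\<close> takes the same value at \<open>\<plusminus>\<pi>\<close>.\<close>

lemma circle_mean_char: "(\<integral>z. z powi k \<partial>circle_measure) = (if k = 0 then 1 else 0)"
proof (cases "k = 0")
  case False
  have "((\<lambda>x. cis x powi k) has_integral (cis (of_int k * pi) / (\<i> * of_int k)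
      - cis (of_int k * (-pi)) / (\<i> * of_int k))) {-pi..pi}"
  proof (rule fundamental_theorem_of_calculus)
    fix x :: real assume "x \<in> {-pi..pi}"
    show "((\<lambda>x. cis (of_int k * x) / (\<i> * of_int k)) has_vector_derivative cis x powi k)
        (at x within {-pi..pi})"
      using False
      by (auto intro!: derivative_eq_intros has_vector_derivative_real_field
            simp: has_vector_derivative_def cis_power_int scaleR_conv_of_real field_simps
                has_field_derivative_def)
  qed auto
  moreover have "cis (of_int k * pi) = cis (of_int k * (-pi))"
    by (simp add: complex_eq_iff sin_zero_iff_int2)
  ultimately have "((\<lambda>x. cis x powi k) has_integral 0) {-pi..pi}" by simp
  moreover have si: "set_integrable lborel {-pi..pi} (\<lambda>x. cis x powi k)"
    using circle_integrable_continuous[OF continuous_on_char[of k]]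
    by (simp add: integrable_circle_iff continuous_measurable_circle continuous_on_char)
  ultimately have "(LINT x:{-pi..pi}|lborel. cis x powi k) = 0"
    using set_borel_integral_eq_integral(2)[OF si] by (simp add: integral_unique)
  then show ?thesis using False by (simp add: circle_mean_integral[symmetric] circle_mean_def)
qed simp

lemma circle_inner_char: "circle_inner (\<lambda>z. z powi j) (\<lambda>z. z powi k) = (if j = k then 1 else 0)"
proof -
  have "circle_inner (\<lambda>z. z powi j) (\<lambda>z. z powi k) = (\<integral>z. z powi (j - k) \<partial>circle_measure)"
    unfolding circle_inner_integral
  proof (rule integral_cong_AE)
    show "(\<lambda>z. z powi j * cnj (z powi k)) \<in> borel_measurable circle_measure"
      by (intro borel_measurable_integrable L2_inner_integrable L2_char)
    show "(\<lambda>z. z powi (j - k)) \<in> borel_measurable circle_measure" by (intro L2_measurable L2_char)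
    show "AE z in circle_measure. z powi j * cnj (z powi k) = z powi (j - k)"
    proof (rule AE_circleI)
      fix z :: complex assume z: "cmod z = 1"
      then have "z \<noteq> 0" by auto
      then show "z powi j * cnj (z powi k) = z powi (j - k)"
        unfolding cnj_powi_unit[OF z] by (simp add: power_int_diff power_int_minus divide_inverse)
    qed
  qed
  then show ?thesis by (simp add: circle_mean_char)
qed

text \<open>The rule \<open>cong\<close> makes membership depend only on the values on the circle.\<close>

inductive trig_poly :: "(complex \<Rightarrow> complex) \<Rightarrow> bool" where
  char: "trig_poly (\<lambda>z. z powi k)"
| cmult: "trig_poly f \<Longrightarrow> trig_poly (\<lambda>z. c * f z)"
| add: "trig_poly f \<Longrightarrow> trig_poly g \<Longrightarrow> trig_poly (\<lambda>z. f z + g z)"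
| cong: "trig_poly f \<Longrightarrow> (\<And>z. cmod z = 1 \<Longrightarrow> f z = g z) \<Longrightarrow> trig_poly g"

lemma trig_poly_L2: "trig_poly f \<Longrightarrow> continuous_on (sphere 0 1) f"
proof (induction rule: trig_poly.induct)
  case (cong f g)
  then show ?case by (subst continuous_on_cong[OF refl, of _ g f]) auto
qed (auto intro!: continuous_intros continuous_on_char)

lemma trig_poly_const: "trig_poly (\<lambda>_. c)"
  using trig_poly.cmult[OF trig_poly.char[of 0], of c] by simp

lemma trig_poly_char_mult: "trig_poly g \<Longrightarrow> trig_poly (\<lambda>z. z powi k * g z)"
proof (induction rule: trig_poly.induct)
  case (char j)
  show ?case
    by (rule trig_poly.cong[OF trig_poly.char[of "k + j"]]) (subst power_int_add, auto)
next
  case (cmult f c)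
  show ?case using trig_poly.cmult[OF cmult.IH, of c] by (simp add: mult.left_commute)
next
  case (add f g)
  show ?case using trig_poly.add[OF add.IH] by (simp add: distrib_left)
next
  case (cong f g)
  show ?case by (rule trig_poly.cong[OF cong.IH]) (simp add: cong.hyps)
qed

lemma trig_poly_mult: "trig_poly f \<Longrightarrow> trig_poly g \<Longrightarrow> trig_poly (\<lambda>z. f z * g z)"
proof (induction rule: trig_poly.induct)
  case (char k) then show ?case by (rule trig_poly_char_mult)
next
  case (cmult f c)
  show ?case using trig_poly.cmult[OF cmult.IH[OF cmult.prems], of c] by (simp add: mult.assoc)
next
  case (add f1 f2)
  show ?case using trig_poly.add[OF add.IH(1)[OF add.prems] add.IH(2)[OF add.prems]]
      by (simp add: distrib_right)
next
  case (cong f h)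
  show ?case by (rule trig_poly.cong[OF cong.IH[OF cong.prems]]) (simp add: cong.hyps)
qed

text \<open>On the circle \<open>z\<^sup>* = z\<^sup>-\<^sup>1\<close>, so both coordinates of \<open>z\<close> are trigonometric polynomials, and with them
  every polynomial in the coordinates.\<close>

lemma trig_poly_real_polynomial:
  fixes p :: "complex \<Rightarrow> real"
  assumes "real_polynomial_function p"
  shows "trig_poly (\<lambda>z. of_real (p z))"
  using assms
proof (induction rule: real_polynomial_function.induct)
  case (linear f)
  have f_eq: "f z = Re z * f 1 + Im z * f \<i>" for z
  proof -
    have "z = Re z *\<^sub>R 1 + Im z *\<^sub>R \<i>" by (simp add: complex_eq_iff)
    then have "f z = f (Re z *\<^sub>R 1 + Im z *\<^sub>R \<i>)" by simp
    also have "\<dots> = Re z * f 1 + Im z * f \<i>"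
      using linear by (simp only: linear_add[OF bounded_linear.linear]
          linear_cmul[OF bounded_linear.linear] real_scaleR_def)
    finally show ?thesis .
  qed
  have ReIm: "of_real (Re z) = (z powi 1 + z powi (-1)) / 2"
      "of_real (Im z) = (z powi 1 - z powi (-1)) / (2 * \<i>)"
    if "cmod z = 1" for z :: complex
  proof -
    have "z powi (-1) = cnj z" using cnj_powi_unit[OF that, of 1] by simp
    then show "of_real (Re z) = (z powi 1 + z powi (-1)) / 2"
        "of_real (Im z) = (z powi 1 - z powi (-1)) / (2 * \<i>)"
      by (simp_all add: complex_eq_iff)
  qed
  have alg: "(a + b) / 2 * F + (a - b) / (2 * \<i>) * G = (F / 2 + G / (2 * \<i>)) * a
      + (F / 2 - G / (2 * \<i>)) * b"
    for a b F G :: complex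
    by (simp add: add_divide_distrib diff_divide_distrib ring_distribs mult_ac)
  have eq: "of_real (f z) = (of_real (f 1) / 2 + of_real (f \<i>) / (2 * \<i>)) * z powi 1
      + (of_real (f 1) / 2 - of_real (f \<i>) / (2 * \<i>)) * z powi (-1)"
    if "cmod z = 1" for z
    unfolding f_eq[of z] of_real_add of_real_mult ReIm[OF that] by (rule alg)
  show ?case
    by (rule trig_poly.cong[OF
        trig_poly.add[OF trig_poly.cmult[OF trig_poly.char] trig_poly.cmult[OF trig_poly.char]]])
       (rule eq[symmetric])
next
  case (const c) show ?case by (rule trig_poly_const)
next
  case (add f g) then show ?case using trig_poly.add by (simp add: of_real_add)
next
  case (mult f g) then show ?case using trig_poly_mult by (simp add: of_real_mult)
qed

lemma trig_poly_uniform_approx: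
  assumes "continuous_on (sphere 0 1) f" "e > 0"
  shows "\<exists>p. trig_poly p \<and> (\<forall>z. cmod z = 1 \<longrightarrow> cmod (f z - p z) < e)"
proof -
  have "compact (sphere (0::complex) 1)" by simp
  from Stone_Weierstrass_polynomial_function[OF this assms]
  obtain g where g: "polynomial_function g" "\<And>z. z \<in> sphere 0 1 \<Longrightarrow> cmod (f z - g z) < e" by auto
  have "real_polynomial_function (\<lambda>z. Re (g z))" "real_polynomial_function (\<lambda>z. Im (g z))"
    using g(1) bounded_linear_Re bounded_linear_Im unfolding polynomial_function_def o_def by auto
  from this[THEN trig_poly_real_polynomial] 
  have "trig_poly (\<lambda>z. of_real (Re (g z)) + \<i> * of_real (Im (g z)))"
    by (intro trig_poly.add trig_poly.cmult)
  then have "trig_poly g" by (simp add: complex_eq[symmetric])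
  then show ?thesis using g(2) by (intro exI[of _ g]) auto
qed

text \<open>On the circle cut at \<open>-1\<close> a function is a function of the angle. The factor that vanishes at
  \<open>-1\<close> makes a continuous function of the angle continuous on the whole circle.\<close>

lemma continuous_on_circle_cut:
  fixes k :: "real \<Rightarrow> complex"
  assumes k: "continuous_on UNIV k" and B: "\<And>x. cmod (k x) \<le> B"
  shows "continuous_on (sphere 0 1) (\<lambda>z. of_real (min 1 (n * cmod (z + 1))) * k (Arg z))"
  unfolding continuous_on_eq_continuous_within
proof
  fix z :: complex assume z: "z \<in> sphere 0 1"
  show "continuous (at z within sphere 0 1) (\<lambda>z. of_real (min 1 (n * cmod (z + 1))) * k (Arg z))"
  proof (cases "z \<in> \<real>\<^sub>\<le>\<^sub>0")
    case False
    have "isCont k (Arg z)" using k by (simp add: continuous_on_eq_continuous_at)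
    then have "isCont (\<lambda>z. k (Arg z)) z" by (rule isCont_o2[OF continuous_at_Arg[OF False]])
    moreover have "isCont (\<lambda>z. complex_of_real (min 1 (n * cmod (z + 1)))) z"
        by (intro continuous_intros)
    ultimately have "isCont (\<lambda>z. of_real (min 1 (n * cmod (z + 1))) * k (Arg z)) z"
        by (rule isCont_mult[rotated])
    then show ?thesis by (rule continuous_at_imp_continuous_at_within)
  next
    case True
    then have "z = -1" using z by (auto elim!: nonpos_Reals_cases)
    have "((\<lambda>z. of_real (min 1 (n * cmod (z + 1))) * k (Arg z)) \<longlongrightarrow> 0) (at z within sphere 0 1)"
    proof (rule tendsto_0_le[where K=1])
      have "((\<lambda>z. min 1 (n * cmod (z + 1)) * B) \<longlongrightarrow> min 1 (n * cmod (z + 1)) * B)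
          (at z within sphere 0 1)"
        by (intro tendsto_intros)
      then show "((\<lambda>z. min 1 (n * cmod (z + 1)) * B) \<longlongrightarrow> 0) (at z within sphere 0 1)"
        using \<open>z = -1\<close> by simp
      show "\<forall>\<^sub>F x in at z within sphere 0 1. cmod (of_real (min 1 (n * cmod (x + 1))) * k (Arg x))
          \<le> norm (min 1 (n * cmod (x + 1)) * B) * 1"
      proof (rule always_eventually, rule allI)
        fix x
        have "cmod (k (Arg x)) \<le> \<bar>B\<bar>" using B[of "Arg x"] by linarith
        then show "cmod (of_real (min 1 (n * cmod (x + 1))) * k (Arg x))
            \<le> norm (min 1 (n * cmod (x + 1)) * B) * 1"
          unfolding norm_mult norm_of_real real_norm_def mult_1_right abs_mult
              by (intro mult_left_mono) auto
      qed
    qed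
    then show ?thesis using \<open>z = -1\<close> by (simp add: continuous_within)
  qed
qed

text \<open>A measurable function of the angle is the limit almost everywhere of continuous functions. Projected to the
  disc of radius \<open>B\<close> and cut off at \<open>-1\<close>, these converge in \<open>L\<^sup>2\<close> by dominated convergence.\<close>

lemma L2_bounded_approx_continuous:
  assumes f: "f \<in> borel_measurable circle_measure" and B: "\<And>z. cmod (f z) \<le> B" and "e > 0"
  shows "\<exists>g. continuous_on (sphere 0 1) g \<and> L2_circle_norm (\<lambda>z. f z - g z) < e"
proof -
  have B0: "B \<ge> 0" using B[of 0] norm_ge_zero order_trans by blast
  define h where "h x = indicator {-pi..pi} x *\<^sub>R f (cis x)" for x
  have "h \<in> borel_measurable lborel"
    using f unfolding borel_measurable_circle_iff set_borel_measurable_def h_def .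
  then have "h \<in> borel_measurable lebesgue" by (simp add: measurable_completion)
  then have "h measurable_on UNIV" by (intro lebesgue_measurable_imp_measurable_on) auto
  then obtain N g where N: "negligible N" and g: "\<And>n. continuous_on UNIV (g n)"
    and lim: "\<And>x. x \<notin> N \<Longrightarrow> (\<lambda>n. g n x) \<longlonglongrightarrow> h x"
    unfolding measurable_on_def by auto
  let ?P = "closest_point (cball (0::complex) B)"
  have cl: "closed (cball (0::complex) B)" "cball (0::complex) B \<noteq> {}"
      "convex (cball (0::complex) B)" using B0 by auto
  have P: "cmod (?P w) \<le> B" for w using closest_point_in_set[OF cl(1,2), of w] by simp
  define G where "G n z = of_real (min 1 (real n * cmod (z + 1))) * ?P (g n (Arg z))" for n z
  have contG: "continuous_on (sphere 0 1) (G n)" for n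
    unfolding G_def
    by (rule continuous_on_circle_cut[where B=B])
       (auto intro: P continuous_on_compose2[OF continuous_on_closest_point[OF cl(3,1,2), of UNIV]
           g])
  have AElim: "AE z in circle_measure. (\<lambda>n. G n z) \<longlonglongrightarrow> f z"
  proof (rule AE_circle_transfer)
    have "AE x in lebesgue. x \<notin> N" using N by (intro AE_not_in) (simp add: negligible_iff_null_sets)
    then have "AE x in lborel. x \<notin> N" by (simp add: AE_completion_iff)
    moreover have "AE x in lborel. x \<notin> {-pi, pi}" by (intro AE_not_in finite_imp_null_set_lborel)
        auto
    ultimately show "AE x in lborel. x \<in> {-pi..pi} \<longrightarrow> (\<lambda>n. G n (cis x)) \<longlonglongrightarrow> f (cis x)"
    proof (eventually_elim, intro impI)
      fix x assume x: "x \<notin> N" "x \<notin> {-pi, pi}" "x \<in> {-pi..pi}"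
      then have "Arg (cis x) = x" by (intro cis_Arg_unique) (auto simp: sgn_eq)
      have "cis x \<noteq> -1"
      proof
        assume "cis x = -1"
        then have "Arg (cis x) = pi" by (intro cis_Arg_unique) auto
        then show False using \<open>Arg (cis x) = x\<close> x by auto
      qed
      then have pos: "cmod (cis x + 1) > 0" by (simp add: add_eq_0_iff2)
      have "(\<lambda>n. ?P (g n x)) \<longlonglongrightarrow> ?P (h x)"
        using continuous_at_closest_point[OF cl(3,1,2)] lim[OF x(1)]
            by (rule isCont_tendsto_compose)
      moreover have "?P (h x) = f (cis x)" using x B[of "cis x"]
          by (simp add: h_def closest_point_self)
      moreover have "(\<lambda>n. complex_of_real (min 1 (real n * cmod (cis x + 1)))) \<longlonglongrightarrow> of_real 1"
      proof (rule tendsto_of_real, rule tendsto_eventually)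
        obtain m :: nat where m: "1 < real m * cmod (cis x + 1)" using reals_Archimedean3[OF pos]
            by blast
        show "\<forall>\<^sub>F n in sequentially. min 1 (real n * cmod (cis x + 1)) = 1"
          unfolding eventually_sequentially
        proof (intro exI[of _ m] allI impI)
          fix n assume "m \<le> n"
          then have "real m * cmod (cis x + 1) \<le> real n * cmod (cis x + 1)"
              by (intro mult_right_mono) auto
          then show "min 1 (real n * cmod (cis x + 1)) = 1" using m by simp
        qed
      qed
      ultimately have "(\<lambda>n. of_real (min 1 (real n * cmod (cis x + 1))) * ?P (g n x)) \<longlonglongrightarrow> of_real 1
          * f (cis x)"
        by (intro tendsto_mult) simp_all
      then show "(\<lambda>n. G n (cis x)) \<longlonglongrightarrow> f (cis x)"
        unfolding G_def \<open>Arg (cis x) = x\<close> by simp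
    qed
  qed
  have GB: "cmod (G n z) \<le> B" for n z
  proof -
    have "cmod (G n z) = \<bar>min 1 (real n * cmod (z + 1))\<bar> * cmod (?P (g n (Arg z)))"
      by (simp only: G_def norm_mult norm_of_real)
    also have "\<dots> \<le> 1 * B" by (intro mult_mono P) auto
    finally show ?thesis by simp
  qed
  have mG: "G n \<in> borel_measurable circle_measure" for n
    by (rule continuous_measurable_circle[OF contG])
  have "(\<lambda>n. \<integral>z. (cmod (f z - G n z))\<^sup>2 \<partial>circle_measure) \<longlonglongrightarrow> (\<integral>z. 0 \<partial>circle_measure)"
  proof (rule integral_dominated_convergence[where w="\<lambda>_. (2 * B)\<^sup>2"])
    show "(\<lambda>z. (cmod (f z - G n z))\<^sup>2) \<in> borel_measurable circle_measure" for n
      using f mG[of n] by measurable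
    show "AE z in circle_measure. (\<lambda>n. (cmod (f z - G n z))\<^sup>2) \<longlonglongrightarrow> 0"
      using AElim
    proof eventually_elim
      case (elim z)
      then have "(\<lambda>n. (cmod (f z - G n z))\<^sup>2) \<longlonglongrightarrow> (cmod (f z - f z))\<^sup>2" by (intro tendsto_intros)
      then show ?case by simp
    qed
    show "AE z in circle_measure. norm ((cmod (f z - G n z))\<^sup>2) \<le> (2 * B)\<^sup>2" for n
    proof (rule AE_I2)
      fix z
      have "cmod (f z - G n z) \<le> 2 * B" using norm_triangle_ineq4[of "f z" "G n z"] B[of z]
          GB[of n z] by linarith
      then show "norm ((cmod (f z - G n z))\<^sup>2) \<le> (2 * B)\<^sup>2"
          using power_mono[of "cmod (f z - G n z)" "2 * B" 2] by simp
    qed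
  qed auto
  then have "(\<lambda>n. sqrt (\<integral>z. (cmod (f z - G n z))\<^sup>2 \<partial>circle_measure)) \<longlonglongrightarrow> sqrt 0"
    by (intro tendsto_real_sqrt) simp
  then have "(\<lambda>n. L2_circle_norm (\<lambda>z. f z - G n z)) \<longlonglongrightarrow> 0"
    by (simp add: L2_circle_norm_def circle_mean_integral)
  then have "\<forall>\<^sub>F n in sequentially. L2_circle_norm (\<lambda>z. f z - G n z) < e"
    using \<open>e > 0\<close> by (rule order_tendstoD)
  then obtain n where "L2_circle_norm (\<lambda>z. f z - G n z) < e" unfolding eventually_sequentially
      by auto
  with contG[of n] show ?thesis by blast
qed

lemma L2_approx_bounded:
  assumes f: "f \<in> L2_circle" and "e > 0"
  shows "\<exists>g B. g \<in> borel_measurable circle_measure \<and> (\<forall>z. cmod (g z) \<le> B)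
      \<and> L2_circle_norm (\<lambda>z. f z - g z) < e"
proof -
  define F where "F n z = (if cmod (f z) \<le> real n then f z else 0)" for n z
  have [measurable]: "f \<in> borel_measurable circle_measure" by (rule L2_measurable[OF f])
  have mF: "F n \<in> borel_measurable circle_measure" for n unfolding F_def by measurable
  have FB: "cmod (F n z) \<le> real n" for n z by (simp add: F_def)
  have "(\<lambda>n. \<integral>z. (cmod (f z - F n z))\<^sup>2 \<partial>circle_measure) \<longlonglongrightarrow> (\<integral>z. 0 \<partial>circle_measure)"
  proof (rule integral_dominated_convergence[where w="\<lambda>z. (cmod (f z))\<^sup>2"])
    show "(\<lambda>z. (cmod (f z - F n z))\<^sup>2) \<in> borel_measurable circle_measure" for n
      using mF[of n] by measurable
    show "integrable circle_measure (\<lambda>z. (cmod (f z))\<^sup>2)" by (rule L2_square_integrable[OF f])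
    show "AE z in circle_measure. (\<lambda>n. (cmod (f z - F n z))\<^sup>2) \<longlonglongrightarrow> 0"
    proof (rule AE_I2, rule tendsto_eventually)
      fix z
      obtain m :: nat where "cmod (f z) \<le> real m" using real_arch_simple by blast
      then show "\<forall>\<^sub>F n in sequentially. (cmod (f z - F n z))\<^sup>2 = 0"
        unfolding eventually_sequentially F_def by (intro exI[of _ m]) auto
    qed
    show "AE z in circle_measure. norm ((cmod (f z - F n z))\<^sup>2) \<le> (cmod (f z))\<^sup>2" for n
      by (rule AE_I2) (auto simp: F_def)
  qed auto
  then have "(\<lambda>n. sqrt (\<integral>z. (cmod (f z - F n z))\<^sup>2 \<partial>circle_measure)) \<longlonglongrightarrow> sqrt 0"
    by (intro tendsto_real_sqrt) simp
  then have "(\<lambda>n. L2_circle_norm (\<lambda>z. f z - F n z)) \<longlonglongrightarrow> 0"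
    by (simp add: L2_circle_norm_def circle_mean_integral)
  then have "\<forall>\<^sub>F n in sequentially. L2_circle_norm (\<lambda>z. f z - F n z) < e"
    using \<open>e > 0\<close> by (rule order_tendstoD)
  then obtain n where "L2_circle_norm (\<lambda>z. f z - F n z) < e" unfolding eventually_sequentially
      by auto
  with mF[of n] FB[of n] show ?thesis by blast
qed

lemma trig_poly_dense:
  assumes f: "f \<in> L2_circle" and e: "e > 0"
  shows "\<exists>p. trig_poly p \<and> L2_circle_norm (\<lambda>z. f z - p z) < e"
proof -
  have e3: "e / 3 > 0" using e by simp
  obtain g B where g: "g \<in> borel_measurable circle_measure" "\<And>z. cmod (g z) \<le> B"
      "L2_circle_norm (\<lambda>z. f z - g z) < e / 3"
    using L2_approx_bounded[OF f e3] by blast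
  have g2: "g \<in> L2_circle"
  proof (rule L2_I)
    show "AE z in circle_measure. (cmod (g z))\<^sup>2 \<le> B\<^sup>2" by (intro AE_I2 power_mono g(2)) simp
  qed (use g(1) in simp_all)
  obtain h where h: "continuous_on (sphere 0 1) h" "L2_circle_norm (\<lambda>z. g z - h z) < e / 3"
    using L2_bounded_approx_continuous[OF g(1,2) e3] by blast
  have h2: "h \<in> L2_circle" by (rule L2_continuous[OF h(1)])
  obtain p where p: "trig_poly p" "\<And>z. cmod z = 1 \<Longrightarrow> cmod (h z - p z) < e / 3"
    using trig_poly_uniform_approx[OF h(1) e3] by blast
  have p2: "p \<in> L2_circle" by (rule L2_continuous[OF trig_poly_L2[OF p(1)]])
  have "L2_circle_norm (\<lambda>z. h z - p z) \<le> e / 3"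
    by (rule L2_circle_norm_bounded[OF L2_measurable[OF L2_diff[OF h2 p2]] less_imp_le[OF p(2)]])
  moreover have "L2_circle_norm (\<lambda>z. f z - p z) \<le> L2_circle_norm (\<lambda>z. f z - g z)
      + L2_circle_norm (\<lambda>z. g z - p z)"
    using L2_circle_norm_triangle[OF L2_diff[OF f g2] L2_diff[OF g2 p2]] by simp
  moreover have "L2_circle_norm (\<lambda>z. g z - p z) \<le> L2_circle_norm (\<lambda>z. g z - h z)
      + L2_circle_norm (\<lambda>z. h z - p z)"
    using L2_circle_norm_triangle[OF L2_diff[OF g2 h2] L2_diff[OF h2 p2]] by simp
  ultimately have "L2_circle_norm (\<lambda>z. f z - p z) < e" using g(3) h(2) by linarith
  with p(1) show ?thesis by blast
qed

lemma fourier_coeff_add: "u \<in> L2_circle \<Longrightarrow> v \<in> L2_circle \<Longrightarrow>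
    fourier_coeff (\<lambda>z. u z + v z) k = fourier_coeff u k + fourier_coeff v k"
  unfolding fourier_coeff_def by (rule circle_inner_add_left) (auto intro: L2_char)

lemma fourier_coeff_diff: "u \<in> L2_circle \<Longrightarrow> v \<in> L2_circle \<Longrightarrow>
    fourier_coeff (\<lambda>z. u z - v z) k = fourier_coeff u k - fourier_coeff v k"
  unfolding fourier_coeff_def by (rule circle_inner_diff_left) (auto intro: L2_char)

lemma fourier_coeff_cmult: "fourier_coeff (\<lambda>z. c * u z) k = c * fourier_coeff u k"
  unfolding fourier_coeff_def by (rule circle_inner_cmult_left)

lemma fourier_coeff_char: "fourier_coeff (\<lambda>z. z powi j) k = (if j = k then 1 else 0)"
  unfolding fourier_coeff_def by (rule circle_inner_char)

lemma fourier_coeff_cong: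
  assumes "u \<in> L2_circle" "v \<in> L2_circle" "AE z in circle_measure. u z = v z"
  shows "fourier_coeff u k = fourier_coeff v k"
  unfolding fourier_coeff_def circle_inner_integral
proof (rule integral_cong_AE)
  show "AE z in circle_measure. u z * cnj (z powi k) = v z * cnj (z powi k)"
    using assms(3) by eventually_elim simp
qed (intro borel_measurable_integrable L2_inner_integrable assms L2_char)+

lemma L2_circle_norm_char: "L2_circle_norm (\<lambda>z. z powi k) = 1"
proof -
  have "complex_of_real ((L2_circle_norm (\<lambda>z. z powi k))\<^sup>2) = 1"
    unfolding circle_inner_self[symmetric] circle_inner_char by simp
  then have "(L2_circle_norm (\<lambda>z. z powi k))\<^sup>2 = 1" using of_real_eq_1_iff by blast
  then show ?thesis using power2_eq_iff_nonneg[of "L2_circle_norm (\<lambda>z. z powi k)" 1] by simp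
qed

lemma fourier_coeff_bound: "u \<in> L2_circle \<Longrightarrow> cmod (fourier_coeff u k) \<le> L2_circle_norm u"
  using circle_cauchy_schwarz[of u "\<lambda>z. z powi k"] L2_char
      by (simp add: fourier_coeff_def L2_circle_norm_char)

definition fourier_partial :: "nat \<Rightarrow> (complex \<Rightarrow> complex) \<Rightarrow> complex \<Rightarrow> complex" where
  "fourier_partial N f z = (\<Sum>k\<in>{-int N..int N}. fourier_coeff f k * z powi k)"

lemma L2_fourier_partial: "fourier_partial N f \<in> L2_circle"
  unfolding fourier_partial_def by (intro L2_sum L2_cmult L2_char)

lemma circle_inner_partial:
  assumes "g \<in> L2_circle"
  shows "circle_inner (fourier_partial N f) g
      = (\<Sum>k\<in>{-int N..int N}. fourier_coeff f k * cnj (fourier_coeff g k))"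
proof -
  have "circle_inner (fourier_partial N f) g
      = (\<Sum>k\<in>{-int N..int N}. circle_inner (\<lambda>z. fourier_coeff f k * z powi k) g)"
    unfolding fourier_partial_def by (rule circle_inner_sum_left[OF L2_cmult[OF L2_char] assms])
  also have "\<dots> = (\<Sum>k\<in>{-int N..int N}. fourier_coeff f k * cnj (fourier_coeff g k))"
    by (rule sum.cong[OF refl], subst circle_inner_cmult_left, subst circle_inner_cnj[symmetric],
        simp add: fourier_coeff_def)
  finally show ?thesis .
qed

lemma fourier_coeff_partial:
  "fourier_coeff (fourier_partial N f) k = (if \<bar>k\<bar> \<le> int N then fourier_coeff f k else 0)"
proof -
  have "fourier_coeff (fourier_partial N f) k =
      (\<Sum>j\<in>{-int N..int N}. fourier_coeff f j * cnj (fourier_coeff (\<lambda>z. z powi k) j))"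
    unfolding fourier_coeff_def[of "fourier_partial N f"] by (rule circle_inner_partial[OF L2_char])
  also have "\<dots> = (\<Sum>j\<in>{-int N..int N}. if j = k then fourier_coeff f j else 0)"
    by (rule sum.cong) (auto simp: fourier_coeff_char)
  also have "\<dots> = (if \<bar>k\<bar> \<le> int N then fourier_coeff f k else 0)"
    by (subst sum.delta) auto
  finally show ?thesis .
qed

text \<open>Pythagoras: the partial sum is an orthogonal projection of \<open>f\<close>.\<close>

lemma norm_sub_fourier_partial:
  assumes f: "f \<in> L2_circle"
  shows "(L2_circle_norm (\<lambda>z. f z - fourier_partial N f z))\<^sup>2 =
    (L2_circle_norm f)\<^sup>2 - (\<Sum>k\<in>{-int N..int N}. (cmod (fourier_coeff f k))\<^sup>2)"
proof -
  let ?S = "fourier_partial N f" and ?s = "\<Sum>k\<in>{-int N..int N}. (cmod (fourier_coeff f k))\<^sup>2"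
  note S = L2_fourier_partial[of N f]
  have d: "(\<lambda>z. f z - ?S z) \<in> L2_circle" by (rule L2_diff[OF f S])
  have Sf: "circle_inner ?S f = of_real ?s"
    unfolding circle_inner_partial[OF f] of_real_sum by (rule sum.cong[OF refl])
        (rule complex_norm_square[symmetric])
  then have fS: "circle_inner f ?S = of_real ?s"
      by (metis circle_inner_cnj complex_cnj_complex_of_real)
  have SS: "circle_inner ?S ?S = of_real ?s"
    unfolding circle_inner_partial[OF S] of_real_sum
    by (rule sum.cong[OF refl])
        (auto simp: fourier_coeff_partial complex_norm_square simp del: of_real_power)
  have "complex_of_real ((L2_circle_norm (\<lambda>z. f z - ?S z))\<^sup>2) = circle_inner f f - of_real ?s
      - (of_real ?s - of_real ?s)"
    unfolding circle_inner_self[symmetric] circle_inner_diff_left[OF f S d]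
      circle_inner_diff_right[OF f S f] circle_inner_diff_right[OF f S S] Sf fS SS by simp
  also have "\<dots> = of_real ((L2_circle_norm f)\<^sup>2 - ?s)" unfolding circle_inner_self by simp
  finally show ?thesis using of_real_eq_iff by blast
qed

lemma norm_sub_fourier_partial_le:
  "f \<in> L2_circle \<Longrightarrow> L2_circle_norm (\<lambda>z. f z - fourier_partial N f z) \<le> L2_circle_norm f"
  by (rule power2_le_imp_le) (auto simp: norm_sub_fourier_partial intro!: sum_nonneg)

lemma trig_poly_fourier_partial:
  "trig_poly p \<Longrightarrow> \<exists>N0. \<forall>N\<ge>N0. \<forall>z. cmod z = 1 \<longrightarrow> fourier_partial N p z = p z"
proof (induction rule: trig_poly.induct)
  case (char j)
  show ?case
  proof (intro exI[of _ "nat \<bar>j\<bar>"] allI impI)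
    fix N and z :: complex assume "nat \<bar>j\<bar> \<le> N"
    have "fourier_partial N (\<lambda>z. z powi j) z = (\<Sum>k\<in>{-int N..int N}. if k = j then z powi k else 0)"
      unfolding fourier_partial_def by (rule sum.cong) (auto simp: fourier_coeff_char)
    also have "\<dots> = z powi j" using \<open>nat \<bar>j\<bar> \<le> N\<close> by (subst sum.delta) auto
    finally show "fourier_partial N (\<lambda>z. z powi j) z = z powi j" .
  qed
next
  case (cmult f c)
  then show ?case by (simp add: fourier_partial_def fourier_coeff_cmult sum_distrib_left[symmetric]
      mult.assoc) blast
next
  case (add f g)
  obtain N1 N2 where N: "\<forall>N\<ge>N1. \<forall>z. cmod z = 1 \<longrightarrow> fourier_partial N f z = f z"
    "\<forall>N\<ge>N2. \<forall>z. cmod z = 1 \<longrightarrow> fourier_partial N g z = g z" using add.IH by blast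
  have "fourier_partial N (\<lambda>z. f z + g z) z = fourier_partial N f z + fourier_partial N g z" for N z
    unfolding fourier_partial_def
    by (simp add: fourier_coeff_add L2_continuous trig_poly_L2 add.hyps distrib_right sum.distrib)
  then show ?case using N by (intro exI[of _ "max N1 N2"]) simp
next
  case (cong f g)
  have L: "f \<in> L2_circle" "g \<in> L2_circle"
    using trig_poly_L2 trig_poly.cong[OF cong.hyps] cong.hyps by (auto intro!: L2_continuous)
  have "fourier_partial N g z = fourier_partial N f z" for N z
    unfolding fourier_partial_def
    using fourier_coeff_cong[OF L(2,1) AE_circleI] cong.hyps(2) by simp
  then show ?case using cong.IH cong.hyps(2) by simp
qed

text \<open>A trigonometric polynomial \<open>p\<close> is its own partial sum from some index on. From then on, \<open>f\<close> and
  \<open>r = f - p\<close> have the same distance to their partial sums, which is at most the norm of \<open>r\<close>.\<close>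

theorem fourier_partial_converges:
  assumes f: "f \<in> L2_circle"
  shows "(\<lambda>N. L2_circle_norm (\<lambda>z. f z - fourier_partial N f z)) \<longlonglongrightarrow> 0"
proof (rule LIMSEQ_I)
  fix e :: real assume "0 < e"
  obtain p where p: "trig_poly p" "L2_circle_norm (\<lambda>z. f z - p z) < e"
    using trig_poly_dense[OF f \<open>0 < e\<close>] by blast
  have p2: "p \<in> L2_circle" by (rule L2_continuous[OF trig_poly_L2[OF p(1)]])
  obtain N0 where N0: "\<And>N z. N \<ge> N0 \<Longrightarrow> cmod z = 1 \<Longrightarrow> fourier_partial N p z = p z"
    using trig_poly_fourier_partial[OF p(1)] by blast
  show "\<exists>no. \<forall>n\<ge>no. norm (L2_circle_norm (\<lambda>z. f z - fourier_partial n f z) - 0) < e"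
  proof (intro exI[of _ N0] allI impI)
    fix N assume N: "N0 \<le> N"
    let ?r = "\<lambda>z. f z - p z"
    have r: "?r \<in> L2_circle" by (rule L2_diff[OF f p2])
    have "fourier_partial N ?r z = fourier_partial N f z - fourier_partial N p z" for z
      unfolding fourier_partial_def
          by (simp add: fourier_coeff_diff[OF f p2] left_diff_distrib sum_subtractf)
    then have eqz: "\<And>z. cmod z = 1 \<Longrightarrow> f z - fourier_partial N f z = ?r z - fourier_partial N ?r z"
      using N0[OF N] by simp
    have "AE z in circle_measure. (cmod (f z - fourier_partial N f z))\<^sup>2
        = (cmod (?r z - fourier_partial N ?r z))\<^sup>2"
      by (rule AE_circleI) (simp only: eqz)
    then have "(\<integral>z. (cmod (f z - fourier_partial N f z))\<^sup>2 \<partial>circle_measure)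
        = (\<integral>z. (cmod (?r z - fourier_partial N ?r z))\<^sup>2 \<partial>circle_measure)"
      by (intro integral_cong_AE borel_measurable_integrable L2_square_integrable L2_diff f r
          L2_fourier_partial)
    then have "L2_circle_norm (\<lambda>z. f z - fourier_partial N f z)
        = L2_circle_norm (\<lambda>z. ?r z - fourier_partial N ?r z)"
      unfolding L2_circle_norm_def circle_mean_integral by simp
    also have "\<dots> \<le> L2_circle_norm ?r" by (rule norm_sub_fourier_partial_le[OF r])
    finally show "norm (L2_circle_norm (\<lambda>z. f z - fourier_partial N f z) - 0) < e" using p(2)
        by simp
  qed
qed

theorem parseval_limit:
  assumes f: "f \<in> L2_circle"
  shows "(\<lambda>N. \<Sum>k\<in>{-int N..int N}. (cmod (fourier_coeff f k))\<^sup>2) \<longlonglongrightarrow> (L2_circle_norm f)\<^sup>2"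
proof -
  have "(\<lambda>N. (L2_circle_norm f)\<^sup>2
      - (L2_circle_norm (\<lambda>z. f z - fourier_partial N f z))\<^sup>2) \<longlonglongrightarrow> (L2_circle_norm f)\<^sup>2 - 0\<^sup>2"
    by (intro tendsto_intros fourier_partial_converges f)
  then show ?thesis by (simp add: norm_sub_fourier_partial[OF f])
qed

theorem parseval_inner_limit:
  assumes f: "f \<in> L2_circle" and g: "g \<in> L2_circle"
  shows "(\<lambda>N. \<Sum>k\<in>{-int N..int N}. fourier_coeff f k * cnj (fourier_coeff g k)) \<longlonglongrightarrow> circle_inner f g"
proof (rule LIM_zero_cancel, rule tendsto_0_le[where K="L2_circle_norm g"])
  show "(\<lambda>N. L2_circle_norm (\<lambda>z. f z - fourier_partial N f z)) \<longlonglongrightarrow> 0"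
      by (rule fourier_partial_converges[OF f])
  show "\<forall>\<^sub>F N in sequentially. norm ((\<Sum>k\<in>{-int N..int N}. fourier_coeff f k
      * cnj (fourier_coeff g k)) - circle_inner f g)
      \<le> norm (L2_circle_norm (\<lambda>z. f z - fourier_partial N f z)) * L2_circle_norm g"
  proof (rule always_eventually, rule allI)
    fix N
    have "(\<Sum>k\<in>{-int N..int N}. fourier_coeff f k * cnj (fourier_coeff g k)) - circle_inner f g =
        - circle_inner (\<lambda>z. f z - fourier_partial N f z) g"
      unfolding circle_inner_diff_left[OF f L2_fourier_partial g] circle_inner_partial[OF g] by simp
    then show "norm ((\<Sum>k\<in>{-int N..int N}. fourier_coeff f k * cnj (fourier_coeff g k))
        - circle_inner f g)
      \<le> norm (L2_circle_norm (\<lambda>z. f z - fourier_partial N f z)) * L2_circle_norm g"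
      using circle_cauchy_schwarz[OF L2_diff[OF f L2_fourier_partial] g] by simp
  qed
qed

lemma circle_inner_eq_0:
  assumes "f \<in> L2_circle" "g \<in> L2_circle" "\<And>k. fourier_coeff f k = 0 \<or> fourier_coeff g k = 0"
  shows "circle_inner f g = 0"
proof -
  have "(\<Sum>k\<in>{-int N..int N}. fourier_coeff f k * cnj (fourier_coeff g k)) = 0" for N
    using assms(3) by (intro sum.neutral) auto
  with parseval_inner_limit[OF assms(1,2)] show ?thesis by (simp add: LIMSEQ_const_iff)
qed

text \<open>The difference of \<open>f\<close> and its projection has negative frequencies only, so it is orthogonal to \<open>w\<close>.\<close>

lemma szego_proj_inner:
  assumes "is_szego_proj f g" "w \<in> L2_plus"
  shows "circle_inner g w = circle_inner f w"
proof -
  have L: "f \<in> L2_circle" "g \<in> L2_circle" "w \<in> L2_circle"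
    using assms by (auto simp: is_szego_proj_def L2_plus_def)
  have "circle_inner (\<lambda>z. g z - f z) w = 0"
    by (rule circle_inner_eq_0) 
       (use assms in \<open>auto simp: is_szego_proj_def L2_plus_def L2_diff fourier_coeff_diff\<close>)
  then show ?thesis by (simp add: circle_inner_diff_left L)
qed

section \<open>Estimates in the Sobolev space of order one half\<close>

lemma Hs_plus_L2: "u \<in> Hs_plus s \<Longrightarrow> u \<in> L2_circle"
  and Hs_plus_negative: "u \<in> Hs_plus s \<Longrightarrow> k < 0 \<Longrightarrow> fourier_coeff u k = 0"
  by (auto simp: Hs_plus_def Hs_circle_def L2_plus_def)

lemma Hs_norm_nonneg [simp]: "0 \<le> Hs_norm s u"
  unfolding Hs_norm_def by (intro real_sqrt_ge_zero infsum_nonneg) simp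

lemma Hs_norm_sq:
  "(Hs_norm s u)\<^sup>2 = (\<Sum>\<^sub>\<infinity>k::int. (1 + (real_of_int k)\<^sup>2) powr s * (cmod (fourier_coeff u k))\<^sup>2)"
  unfolding Hs_norm_def by (intro real_sqrt_pow2 infsum_nonneg) simp

lemma Hs_norm_sum_le:
  assumes "u \<in> Hs_circle s" "finite F"
  shows "(\<Sum>k\<in>F. (1 + (real_of_int k)\<^sup>2) powr s * (cmod (fourier_coeff u k))\<^sup>2) \<le> (Hs_norm s u)\<^sup>2"
  unfolding Hs_norm_sq
  by (rule finite_sum_le_infsum) (use assms in \<open>auto simp: Hs_circle_def\<close>)

text \<open>On nonnegative frequencies the weight \<open>1 + k\<close> is equivalent to that of \<open>H\<^sup>1\<^sup>/\<^sup>2\<close>. It suits convolutions,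
  because \<open>1 + n \<le> (1 + k) (1 + n - k)\<close>.\<close>

lemma Hs_half_weighted_sum:
  assumes u: "u \<in> Hs_plus (1/2)"
  shows "(\<Sum>k\<in>{..N}. (1 + real k) * (cmod (fourier_coeff u (int k)))\<^sup>2) \<le> 2 * (Hs_norm (1/2) u)\<^sup>2"
proof -
  have "(\<Sum>k\<in>{..N}. (1 + real k) * (cmod (fourier_coeff u (int k)))\<^sup>2)
      \<le> (\<Sum>k\<in>{..N}. 2 * ((1 + (real_of_int (int k))\<^sup>2) powr (1/2)
          * (cmod (fourier_coeff u (int k)))\<^sup>2))"
  proof (rule sum_mono)
    fix k
    have "1 + real k \<le> 2 * sqrt (1 + (real k)\<^sup>2)"
    proof -
      have "1 \<le> sqrt (1 + (real k)\<^sup>2)" by simp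
      moreover have "real k \<le> sqrt (1 + (real k)\<^sup>2)" by (rule real_le_rsqrt) simp
      ultimately show ?thesis by linarith
    qed
    then show "(1 + real k) * (cmod (fourier_coeff u (int k)))\<^sup>2
        \<le> 2 * ((1 + (real_of_int (int k))\<^sup>2) powr (1/2) * (cmod (fourier_coeff u (int k)))\<^sup>2)"
      unfolding mult.assoc[symmetric] by (intro mult_right_mono) (auto simp: powr_half_sqrt)
  qed
  also have "\<dots> = 2 * (\<Sum>k\<in>int ` {..N}. (1 + (real_of_int k)\<^sup>2) powr (1/2)
      * (cmod (fourier_coeff u k))\<^sup>2)"
    by (simp add: sum.reindex sum_distrib_left)
  also have "\<dots> \<le> 2 * (Hs_norm (1/2) u)\<^sup>2"
    by (intro mult_left_mono Hs_norm_sum_le) (use u in \<open>auto simp: Hs_plus_def\<close>)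
  finally show ?thesis .
qed

lemma sum_symmetric_nonneg:
  fixes f :: "int \<Rightarrow> 'a::comm_monoid_add"
  assumes "\<And>k. k < 0 \<Longrightarrow> f k = 0"
  shows "(\<Sum>k\<in>{-int N..int N}. f k) = (\<Sum>k\<in>{..N}. f (int k))"
proof -
  have "(\<Sum>k\<in>{-int N..int N}. f k) = (\<Sum>k\<in>{0..int N}. f k)"
    by (rule sum.mono_neutral_right) (auto intro: assms)
  also have "{0..int N} = int ` {..N}"
    by (auto simp: image_iff intro!: bexI[of _ "nat _"])
  finally show ?thesis by (simp add: sum.reindex)
qed

text \<open>The embedding of \<open>H\<^sup>1\<^sup>/\<^sup>2\<close> into bounded functions fails only logarithmically: the coefficients are
  summed by Cauchy--Schwarz against \<open>1 / (1 + k)\<close>.\<close>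

lemma fourier_partial_sup_bound:
  assumes u: "u \<in> Hs_plus (1/2)" and z: "cmod z = 1"
  shows "(cmod (fourier_partial N u z))\<^sup>2 \<le> 2 * (Hs_norm (1/2) u)\<^sup>2 * (1 + ln (real (Suc N)))"
proof -
  let ?a = "\<lambda>k. cmod (fourier_coeff u (int k))"
  have "harm (Suc 0) = (1::real)" by (simp add: harm_def)
  then have harm_bound: "harm (Suc N) \<le> 1 + ln (real (Suc N))"
    using decseqD[OF decseq_harm_diff_ln, of 0 N] by simp
  have "fourier_partial N u z = (\<Sum>k\<in>{..N}. fourier_coeff u (int k) * z powi int k)"
    unfolding fourier_partial_def by (rule sum_symmetric_nonneg) (simp add: Hs_plus_negative[OF u])
  also have "cmod \<dots> \<le> (\<Sum>k\<in>{..N}. ?a k)"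
    by (rule sum_norm_le) (simp add: norm_mult norm_power z)
  finally have "(cmod (fourier_partial N u z))\<^sup>2 \<le> (\<Sum>k\<in>{..N}. ?a k)\<^sup>2" by (intro power_mono) auto
  also have "(\<Sum>k\<in>{..N}. ?a k) = (\<Sum>k\<in>{..N}. (sqrt (1 + real k) * ?a k) * (1 / sqrt (1 + real k)))"
  proof (rule sum.cong[OF refl])
    fix k :: nat
    have "sqrt (1 + real k) > 0" by simp
    then show "?a k = (sqrt (1 + real k) * ?a k) * (1 / sqrt (1 + real k))"
        by (simp add: field_simps)
  qed
  also have "\<dots>\<^sup>2 \<le> (\<Sum>k\<in>{..N}. (sqrt (1 + real k) * ?a k)\<^sup>2) * (\<Sum>k\<in>{..N}. (1 / sqrt (1 + real k))\<^sup>2)"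
    by (rule Cauchy_Schwarz_ineq_sum)
  also have "\<dots> = (\<Sum>k\<in>{..N}. (1 + real k) * (?a k)\<^sup>2) * (\<Sum>k\<in>{..N}. 1 / (1 + real k))"
    by (simp add: power_mult_distrib power_divide)
  also have "(\<Sum>k\<in>{..N}. 1 / (1 + real k)) = harm (Suc N)"
    unfolding harm_altdef lessThan_Suc_atMost by (simp add: inverse_eq_divide)
  also have "(\<Sum>k\<in>{..N}. (1 + real k) * (?a k)\<^sup>2) * harm (Suc N) \<le> (2 * (Hs_norm (1/2) u)\<^sup>2)
      * (1 + ln (real (Suc N)))"
    using harm_bound by (intro mult_mono Hs_half_weighted_sum u harm_nonneg) auto
  finally show ?thesis .
qed

lemma norm_sub_fourier_partial_half:
  assumes u: "u \<in> Hs_plus (1/2)"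
  shows "(L2_circle_norm (\<lambda>z. u z - fourier_partial N u z))\<^sup>2 \<le> 2 * (Hs_norm (1/2) u)\<^sup>2
      / (1 + real N)"
proof -
  let ?c = "\<lambda>k. (cmod (fourier_coeff u k))\<^sup>2"
  have S: "(\<Sum>k\<in>{-int m..int m}. ?c k) = (\<Sum>k\<in>{..m}. ?c (int k))" for m
    by (rule sum_symmetric_nonneg) (simp add: Hs_plus_negative[OF u])
  have "(L2_circle_norm u)\<^sup>2 \<le> (\<Sum>k\<in>{..N}. ?c (int k)) + 2 * (Hs_norm (1/2) u)\<^sup>2 / (1 + real N)"
  proof (rule LIMSEQ_le_const2[OF parseval_limit[OF Hs_plus_L2[OF u]]], intro exI[of _ N] allI impI)
    fix m assume "N \<le> m"
    have "(\<Sum>k\<in>{..m}. ?c (int k)) = (\<Sum>k\<in>{..N}. ?c (int k)) + (\<Sum>k\<in>{N<..m}. ?c (int k))"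
      using \<open>N \<le> m\<close> by (subst sum.union_disjoint[symmetric]) (auto intro!: sum.cong)
    moreover have "(1 + real N) * (\<Sum>k\<in>{N<..m}. ?c (int k)) \<le> 2 * (Hs_norm (1/2) u)\<^sup>2"
    proof -
      have "(1 + real N) * (\<Sum>k\<in>{N<..m}. ?c (int k)) \<le> (\<Sum>k\<in>{N<..m}. (1 + real k) * ?c (int k))"
        unfolding sum_distrib_left by (intro sum_mono mult_right_mono) auto
      also have "\<dots> \<le> (\<Sum>k\<in>{..m}. (1 + real k) * ?c (int k))" by (intro sum_mono2) auto
      finally show ?thesis using Hs_half_weighted_sum[OF u, of m] by linarith
    qed
    then have "(\<Sum>k\<in>{N<..m}. ?c (int k)) \<le> 2 * (Hs_norm (1/2) u)\<^sup>2 / (1 + real N)"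
      by (subst pos_le_divide_eq) (simp_all add: mult.commute)
    ultimately show "(\<Sum>k\<in>{-int m..int m}. ?c k) \<le> (\<Sum>k\<in>{..N}. ?c (int k)) + 2 * (Hs_norm (1/2) u)\<^sup>2
        / (1 + real N)"
      unfolding S by linarith
  qed
  then show ?thesis unfolding norm_sub_fourier_partial[OF Hs_plus_L2[OF u]] S by linarith
qed

text \<open>The coefficient of \<open>u\<^sup>2\<close> is the inner product of \<open>u\<close> and \<open>z\<^sup>n u\<^sup>*\<close>, so Parseval's identity
  expresses it by a convolution of the coefficients of \<open>u\<close>.\<close>

lemma fourier_coeff_square_limit:
  assumes u: "u \<in> L2_circle"
  shows "(\<lambda>N. \<Sum>k\<in>{-int N..int N}. fourier_coeff u k
      * fourier_coeff u (n - k)) \<longlonglongrightarrow> fourier_coeff (\<lambda>z. (u z)\<^sup>2) n"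
proof -
  let ?v = "\<lambda>z. z powi n * cnj (u z)"
  have v: "?v \<in> L2_circle"
    by (rule L2_mult_bounded[where B=1, OF L2_cnj[OF u] L2_measurable[OF L2_char]])
        (simp add: norm_power_int)
  have fv: "fourier_coeff ?v k = cnj (fourier_coeff u (n - k))" for k
  proof -
    have "fourier_coeff ?v k = (\<integral>z. cnj (u z * cnj (z powi (n - k))) \<partial>circle_measure)"
      unfolding fourier_coeff_def circle_inner_integral
    proof (rule integral_cong_AE)
      show "AE z in circle_measure. z powi n * cnj (u z) * cnj (z powi k)
          = cnj (u z * cnj (z powi (n - k)))"
      proof (rule AE_circleI)
        fix z :: complex assume z: "cmod z = 1"
        then have "z \<noteq> 0" by auto
        have "cnj (u z * cnj (z powi (n - k))) = cnj (u z) * z powi (n - k)"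
            by (simp only: complex_cnj_mult complex_cnj_cnj)
        moreover have "z powi n * cnj (u z) * cnj (z powi k) = cnj (u z) * z powi (n - k)"
          using \<open>z \<noteq> 0\<close> unfolding cnj_powi_unit[OF z]
              by (simp add: power_int_diff power_int_minus divide_inverse)
        ultimately show "z powi n * cnj (u z) * cnj (z powi k) = cnj (u z * cnj (z powi (n - k)))"
            by simp
      qed
      show "(\<lambda>z. z powi n * cnj (u z) * cnj (z powi k)) \<in> borel_measurable circle_measure"
        by (rule borel_measurable_integrable[OF L2_inner_integrable[OF v L2_char]])
      show "(\<lambda>z. cnj (u z * cnj (z powi (n - k)))) \<in> borel_measurable circle_measure"
        by (rule borel_measurable_integrable[OF
            integrable_cnj[OF L2_inner_integrable[OF u L2_char]]])
    qed
    also have "\<dots> = cnj (fourier_coeff u (n - k))"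
      unfolding fourier_coeff_def circle_inner_integral by (rule Bochner_Integration.integral_cnj)
    finally show ?thesis .
  qed
  have "circle_inner u ?v = fourier_coeff (\<lambda>z. (u z)\<^sup>2) n"
    unfolding fourier_coeff_def circle_inner_integral
        by (simp add: power2_eq_square mult_ac del: complex_cnj_power_int)
  then show ?thesis using parseval_inner_limit[OF u v] by (simp add: fv)
qed

text \<open>The embedding of \<open>H\<^sup>1\<^sup>/\<^sup>2\<^sub>+\<close> into \<open>L\<^sup>4\<close>: the coefficients of \<open>u\<^sup>2\<close> are finite convolutions, and
  \<open>(1 + k) (1 + n - k) \<ge> 1 + n\<close>.\<close>

lemma L4_bound_half:
  assumes u: "u \<in> Hs_plus (1/2)" and u4: "(\<lambda>z. (u z)\<^sup>2) \<in> L2_circle"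
  shows "L2_circle_norm (\<lambda>z. (u z)\<^sup>2) \<le> 2 * (Hs_norm (1/2) u)\<^sup>2"
proof (rule power2_le_imp_le)
  let ?a = "\<lambda>k. fourier_coeff u (int k)"
  define w where "w k = (1 + real k) * (cmod (?a k))\<^sup>2" for k
  have w0: "w k \<ge> 0" for k by (simp add: w_def)
  have conv: "fourier_coeff (\<lambda>z. (u z)\<^sup>2) n
      = (if n < 0 then 0 else (\<Sum>k\<in>{..nat n}. ?a k * ?a (nat n - k)))" for n
  proof (rule LIMSEQ_unique[OF fourier_coeff_square_limit[OF Hs_plus_L2[OF u], of n]], rule
      tendsto_eventually)
    show "\<forall>\<^sub>F N in sequentially. (\<Sum>k\<in>{-int N..int N}. fourier_coeff u k * fourier_coeff u (n - k)) =
        (if n < 0 then 0 else (\<Sum>k\<in>{..nat n}. ?a k * ?a (nat n - k)))"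
      unfolding eventually_sequentially
    proof (intro exI[of _ "nat n"] allI impI)
      fix N assume N: "nat n \<le> N"
      have "(\<Sum>k\<in>{-int N..int N}. fourier_coeff u k * fourier_coeff u (n - k)) =
          (\<Sum>k\<in>{..N}. ?a k * fourier_coeff u (n - int k))"
        by (rule sum_symmetric_nonneg) (simp add: Hs_plus_negative[OF u])
      also have "\<dots> = (if n < 0 then 0 else (\<Sum>k\<in>{..nat n}. ?a k * ?a (nat n - k)))"
      proof (cases "n < 0")
        case True
        then show ?thesis by (auto intro!: sum.neutral simp: Hs_plus_negative[OF u])
      next
        case False
        have "(\<Sum>k\<in>{..N}. ?a k * fourier_coeff u (n - int k))
            = (\<Sum>k\<in>{..nat n}. ?a k * fourier_coeff u (n - int k))"
          using N False by (intro sum.mono_neutral_right) (auto simp: Hs_plus_negative[OF u])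
        also have "\<dots> = (\<Sum>k\<in>{..nat n}. ?a k * ?a (nat n - k))"
          by (rule sum.cong[OF refl]) (use False in \<open>auto simp: of_nat_diff\<close>)
        finally show ?thesis using False by simp
      qed
      finally show "(\<Sum>k\<in>{-int N..int N}. fourier_coeff u k * fourier_coeff u (n - k)) =
        (if n < 0 then 0 else (\<Sum>k\<in>{..nat n}. ?a k * ?a (nat n - k)))" .
    qed
  qed
  have conv_bound: "(cmod (fourier_coeff (\<lambda>z. (u z)\<^sup>2) (int n)))\<^sup>2 \<le> (\<Sum>k\<in>{..n}. w k * w (n - k))"
      for n
  proof -
    have "cmod (fourier_coeff (\<lambda>z. (u z)\<^sup>2) (int n)) \<le> (\<Sum>k\<in>{..n}. cmod (?a k * ?a (n - k)))"
      unfolding conv by (simp add: norm_sum)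
    then have "(cmod (fourier_coeff (\<lambda>z. (u z)\<^sup>2) (int n)))\<^sup>2
        \<le> (\<Sum>k\<in>{..n}. cmod (?a k * ?a (n - k)) * 1)\<^sup>2"
      by (intro power_mono) auto
    also have "\<dots> \<le> (\<Sum>k\<in>{..n}. (cmod (?a k * ?a (n - k)))\<^sup>2) * (\<Sum>k\<in>{..n}. 1\<^sup>2)"
      by (rule Cauchy_Schwarz_ineq_sum)
    also have "\<dots> = (\<Sum>k\<in>{..n}. (1 + real n) * (cmod (?a k * ?a (n - k)))\<^sup>2)"
      by (simp add: sum_distrib_left mult.commute)
    also have "\<dots> \<le> (\<Sum>k\<in>{..n}. w k * w (n - k))"
    proof (rule sum_mono)
      fix k assume "k \<in> {..n}"
      then have "1 + real n \<le> (1 + real k) * (1 + real (n - k))"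
        by (simp add: of_nat_diff algebra_simps mult_left_mono)
      then have "(1 + real n) * (cmod (?a k * ?a (n - k)))\<^sup>2 \<le> (1 + real k) * (1 + real (n - k))
          * (cmod (?a k * ?a (n - k)))\<^sup>2"
        by (intro mult_right_mono) auto
      then show "(1 + real n) * (cmod (?a k * ?a (n - k)))\<^sup>2 \<le> w k * w (n - k)"
        by (simp add: w_def norm_mult power_mult_distrib mult_ac)
    qed
    finally show ?thesis .
  qed
  show "(L2_circle_norm (\<lambda>z. (u z)\<^sup>2))\<^sup>2 \<le> (2 * (Hs_norm (1/2) u)\<^sup>2)\<^sup>2"
  proof (rule LIMSEQ_le_const2[OF parseval_limit[OF u4]], intro exI[of _ 0] allI impI)
    fix N
    have "(\<Sum>k\<in>{-int N..int N}. (cmod (fourier_coeff (\<lambda>z. (u z)\<^sup>2) k))\<^sup>2) =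
        (\<Sum>n\<in>{..N}. (cmod (fourier_coeff (\<lambda>z. (u z)\<^sup>2) (int n)))\<^sup>2)"
      by (rule sum_symmetric_nonneg) (simp add: conv)
    also have "\<dots> \<le> (\<Sum>n\<in>{..N}. \<Sum>k\<in>{..n}. w k * w (n - k))" by (rule sum_mono) (rule conv_bound)
    also have "\<dots> = (\<Sum>(n, k)\<in>(SIGMA n:{..N}. {..n}). w k * w (n - k))" by (simp add: sum.Sigma)
    also have "\<dots> = (\<Sum>(i, j)\<in>(\<lambda>(n, k). (k, n - k)) ` (SIGMA n:{..N}. {..n}). w i * w j)"
      by (subst sum.reindex) (auto simp: inj_on_def o_def split_def)
    also have "\<dots> \<le> (\<Sum>(i, j)\<in>{..N} \<times> {..N}. w i * w j)"
      by (rule sum_mono2) (auto simp: w0)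
    also have "\<dots> = (\<Sum>i\<in>{..N}. w i)\<^sup>2"
        by (simp add: sum.cartesian_product[symmetric] sum_product power2_eq_square)
    also have "\<dots> \<le> (2 * (Hs_norm (1/2) u)\<^sup>2)\<^sup>2"
      using Hs_half_weighted_sum[OF u, of N] by (intro power_mono)
          (auto simp: w_def intro!: sum_nonneg)
    finally show "(\<Sum>k\<in>{-int N..int N}. (cmod (fourier_coeff (\<lambda>z. (u z)\<^sup>2) k))\<^sup>2)
        \<le> (2 * (Hs_norm (1/2) u)\<^sup>2)\<^sup>2" .
  qed
qed simp

section \<open>Global solutions of ordinary differential equations\<close>

text \<open>The integral from \<open>0\<close> to \<open>t\<close> for \<open>t\<close> of either sign: one of the two intervals has at most one point.\<close>

definition signed_integral :: "(real \<Rightarrow> 'a::banach) \<Rightarrow> real \<Rightarrow> 'a" where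
  "signed_integral g t = integral {0..t} g - integral {t..0} g"

lemma signed_integral_has_vector_derivative:
  fixes g :: "real \<Rightarrow> 'a::banach"
  assumes g: "continuous_on UNIV g"
  shows "(signed_integral g has_vector_derivative g t) (at t)"
proof -
  define a where "a = - \<bar>t\<bar> - 1"
  have int: "g integrable_on {c..d}" for c d
    by (rule integrable_continuous_real[OF continuous_on_subset[OF g subset_UNIV]])
  have eq: "integral {a..s} g - integral {a..0} g = signed_integral g s" if "s \<in> {a<..<\<bar>t\<bar> + 1}" for
      s
  proof (cases "0 \<le> s")
    case True
    have "integral {a..s} g = integral {a..0} g + integral {0..s} g"
      by (rule sym, rule Henstock_Kurzweil_Integration.integral_combine)
          (use True in \<open>auto simp: a_def int\<close>)
    moreover have "integral {s..0} g = 0"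
      using True by (cases "s = 0") auto
    ultimately show ?thesis by (simp add: signed_integral_def)
  next
    case False
    have "integral {a..s} g + integral {s..0} g = integral {a..0} g"
      by (rule Henstock_Kurzweil_Integration.integral_combine) (use False that in \<open>auto simp: int\<close>)
    then show ?thesis using False by (simp add: signed_integral_def algebra_simps)
  qed
  have "((\<lambda>s. integral {a..s} g) has_vector_derivative g t) (at t within {a..\<bar>t\<bar> + 1})"
    by (rule integral_has_vector_derivative) (auto simp: a_def continuous_on_subset[OF g])
  then have "((\<lambda>s. integral {a..s} g) has_vector_derivative g t) (at t)"
    by (subst (asm) at_within_Icc_at) (auto simp: a_def)
  then have "((\<lambda>s. integral {a..s} g - integral {a..0} g) has_vector_derivative g t) (at t)"
    using has_vector_derivative_diff[OF _ has_vector_derivative_const] by fastforce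
  then show ?thesis
    by (rule has_vector_derivative_transform_within_open[where S="{a<..<\<bar>t\<bar> + 1}"])
        (use eq in \<open>auto simp: a_def\<close>)
qed

lemma signed_integral_diff:
  fixes f g :: "real \<Rightarrow> 'a::banach"
  assumes "continuous_on UNIV f" "continuous_on UNIV g"
  shows "signed_integral (\<lambda>s. f s - g s) t = signed_integral f t - signed_integral g t"
proof -
  have "f integrable_on {c..d}" "g integrable_on {c..d}" for c d
    using assms by (auto intro!: integrable_continuous_real intro: continuous_on_subset)
  then show ?thesis by (simp add: signed_integral_def Henstock_Kurzweil_Integration.integral_diff)
qed

lemma norm_signed_integral_le:
  fixes d :: "real \<Rightarrow> 'a::banach"
  assumes d: "continuous_on UNIV d" and r: "r > 0" and C: "C \<ge> 0"
    and bound: "\<And>s. norm (d s) \<le> C * exp (r * \<bar>s\<bar>)"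
  shows "norm (signed_integral d t) \<le> C / r * exp (r * \<bar>t\<bar>)"
proof (cases "0 \<le> t")
  case True
  have "((\<lambda>s. C * exp (r * s)) has_integral (C / r * exp (r * t) - C / r * exp (r * 0))) {0..t}"
    using True r
    by (intro fundamental_theorem_of_calculus)
       (auto intro!: derivative_eq_intros simp:
           has_real_derivative_iff_has_vector_derivative[symmetric])
  then have hi: "(\<lambda>s. C * exp (r * s)) integrable_on {0..t}"
    "integral {0..t} (\<lambda>s. C * exp (r * s)) = C / r * exp (r * t) - C / r * exp (r * 0)"
    by (rule has_integral_integrable, rule integral_unique)
  have "norm (integral {0..t} d) \<le> integral {0..t} (\<lambda>s. C * exp (r * s))"
  proof (rule integral_norm_bound_integral[OF
      integrable_continuous_real[OF continuous_on_subset[OF d]] hi(1)])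
    show "norm (d s) \<le> C * exp (r * s)" if "s \<in> {0..t}" for s
      using bound[of s] that by (simp add: abs_of_nonneg)
  qed simp
  moreover have "signed_integral d t = integral {0..t} d"
    using True by (cases "t = 0") (auto simp: signed_integral_def)
  moreover have "0 \<le> C / r" using C r by simp
  ultimately show ?thesis using True hi(2) by simp
next
  case False
  have "((\<lambda>s. C * exp (- r * s))
      has_integral (- C / r * exp (- r * 0) - (- C / r * exp (- r * t)))) {t..0}"
    using False r
    by (intro fundamental_theorem_of_calculus)
       (auto intro!: derivative_eq_intros simp:
           has_real_derivative_iff_has_vector_derivative[symmetric])
  then have hi: "(\<lambda>s. C * exp (- r * s)) integrable_on {t..0}"
    "integral {t..0} (\<lambda>s. C * exp (- r * s)) = - C / r * exp (- r * 0) - (- C / r * exp (- r * t))"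
    by (rule has_integral_integrable, rule integral_unique)
  have "norm (integral {t..0} d) \<le> integral {t..0} (\<lambda>s. C * exp (- r * s))"
  proof (rule integral_norm_bound_integral[OF
      integrable_continuous_real[OF continuous_on_subset[OF d]] hi(1)])
    show "norm (d s) \<le> C * exp (- r * s)" if "s \<in> {t..0}" for s
      using bound[of s] that by (simp add: abs_of_nonpos)
  qed simp
  moreover have "signed_integral d t = - integral {t..0} d"
    using False by (simp add: signed_integral_def)
  moreover have "0 \<le> C / r" using C r by simp
  ultimately show ?thesis using False hi(2) by (simp add: abs_of_neg)
qed

text \<open>Picard iteration in the bounded continuous functions of \<open>t\<close>, after division by \<open>exp (2 L |t|)\<close>:
  with this weight the Picard operator is a contraction with constant \<open>1/2\<close> on the whole line, so
  that no local solutions have to be glued.\<close>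

theorem global_ode_solution:
  fixes F :: "'a::banach \<Rightarrow> 'a"
  assumes lip: "\<And>x y. norm (F x - F y) \<le> L * norm (x - y)" and bd: "\<And>x. norm (F x) \<le> M"
  shows "\<exists>X. X 0 = x0 \<and> (\<forall>t. (X has_vector_derivative F (X t)) (at t))"
proof -
  define r where "r = 2 * (\<bar>L\<bar> + 1)"
  have r: "r > 0" by (simp add: r_def)
  have M: "M \<ge> 0" using bd[of 0] norm_ge_zero order_trans by blast
  have lip': "norm (F x - F y) \<le> (r / 2) * norm (x - y)" for x y
  proof -
    have "L \<le> r / 2" by (simp add: r_def)
    then show ?thesis using lip[of x y] mult_right_mono[of L "r / 2" "norm (x - y)"] by simp
  qed
  have contF: "continuous_on UNIV F"
    by (rule lipschitz_on_continuous_on[of "r / 2"])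
       (use r lip' in \<open>auto simp: lipschitz_on_def dist_norm\<close>)
  define w where "w t = exp (- r * \<bar>t\<bar>)" for t :: real
  have w: "w t > 0" "w t * exp (r * \<bar>t\<bar>) = 1" "w t \<le> 1" "inverse (w t) = exp (r * \<bar>t\<bar>)" for t
    using r by (auto simp: w_def exp_minus field_simps mult_nonneg_nonneg)
  have contw: "continuous_on UNIV w" unfolding w_def by (intro continuous_intros)
  define X where "X z t = inverse (w t) *\<^sub>R apply_bcontfun z t" for z :: "real \<Rightarrow>\<^sub>C 'a" and t
  have contX: "continuous_on UNIV (X z)" for z
    unfolding X_def using contw w(1) by (intro continuous_intros)
        (auto simp: less_imp_neq[symmetric])
  have contFX: "continuous_on UNIV (\<lambda>s. F (X z s))" for z
    by (rule continuous_on_compose2[OF contF contX]) simp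
  define T where "T z t = w t *\<^sub>R (x0 + signed_integral (\<lambda>s. F (X z s)) t)" for z t
  have T_bcontfun: "T z \<in> bcontfun" for z
  proof -
    have "continuous_on UNIV (signed_integral (\<lambda>s. F (X z s)))"
      by (rule continuous_at_imp_continuous_on)
         (auto intro!: has_vector_derivative_continuous signed_integral_has_vector_derivative
             contFX)
    then have "continuous_on UNIV (T z)" unfolding T_def by (intro continuous_intros contw)
    moreover have "norm (T z t) \<le> norm x0 + M / r" for t
    proof -
      have "norm (signed_integral (\<lambda>s. F (X z s)) t) \<le> M / r * exp (r * \<bar>t\<bar>)"
      proof (rule norm_signed_integral_le[OF contFX r M])
        fix s
        have "M * 1 \<le> M * exp (r * \<bar>s\<bar>)" using r by (intro mult_left_mono M) auto
        then show "norm (F (X z s)) \<le> M * exp (r * \<bar>s\<bar>)" using bd[of "X z s"] by linarith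
      qed
      then have "w t * norm (signed_integral (\<lambda>s. F (X z s)) t) \<le> w t * (M / r * exp (r * \<bar>t\<bar>))"
        using w(1)[of t] by (intro mult_left_mono) auto
      also have "\<dots> = M / r" using w(2)[of t] by (simp add: mult.left_commute)
      finally have "w t * norm (signed_integral (\<lambda>s. F (X z s)) t) \<le> M / r" .
      moreover have "w t * norm x0 \<le> 1 * norm x0" using w(3)[of t] by (intro mult_right_mono) auto
      moreover have "norm (T z t) \<le> w t * norm x0 + w t * norm (signed_integral (\<lambda>s. F (X z s)) t)"
        unfolding T_def norm_scaleR using w(1)[of t]
            by (simp add: distrib_left[symmetric] norm_triangle_ineq)
      ultimately show ?thesis by linarith
    qed
    then have "bounded (range (T z))" unfolding bounded_iff by blast
    ultimately show ?thesis by (simp add: bcontfun_def)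
  qed
  have "\<exists>!z. Bcontfun (T z) = z"
  proof (rule banach_fix_type[of "1/2"], simp_all, intro allI)
    fix z z' :: "real \<Rightarrow>\<^sub>C 'a"
    have "dist (Bcontfun (T z)) (Bcontfun (T z')) \<le> 1/2 * dist z z'"
    proof (rule dist_bound)
      fix t
      have "norm (signed_integral (\<lambda>s. F (X z s) - F (X z' s)) t) \<le> (r / 2 * dist z z') / r
          * exp (r * \<bar>t\<bar>)"
      proof (rule norm_signed_integral_le[OF _ r])
        show "continuous_on UNIV (\<lambda>s. F (X z s) - F (X z' s))" by (intro continuous_intros contFX)
        show "0 \<le> r / 2 * dist z z'" using r by simp
        fix s
        have "norm (F (X z s) - F (X z' s)) \<le> r / 2 * norm (X z s - X z' s)" by (rule lip')
        also have "norm (X z s - X z' s) = exp (r * \<bar>s\<bar>)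
            * dist (apply_bcontfun z s) (apply_bcontfun z' s)"
          unfolding X_def w(4) scaleR_diff_right[symmetric] norm_scaleR dist_norm by simp
        also have "r / 2 * \<dots> \<le> r / 2 * (exp (r * \<bar>s\<bar>) * dist z z')"
          using r by (intro mult_left_mono dist_bounded) auto
        finally show "norm (F (X z s) - F (X z' s)) \<le> r / 2 * dist z z' * exp (r * \<bar>s\<bar>)"
            by (simp add: mult_ac)
      qed
      then have "w t * norm (signed_integral (\<lambda>s. F (X z s) - F (X z' s)) t) \<le> w t
          * ((r / 2 * dist z z') / r * exp (r * \<bar>t\<bar>))"
        using w(1)[of t] by (intro mult_left_mono) auto
      also have "\<dots> = 1/2 * dist z z' * (w t * exp (r * \<bar>t\<bar>))" using r by simp
      also have "\<dots> = 1/2 * dist z z'" unfolding w(2) by simp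
      finally show "dist (apply_bcontfun (Bcontfun (T z)) t) (apply_bcontfun (Bcontfun (T z')) t)
          \<le> 1/2 * dist z z'"
        unfolding Bcontfun_inverse[OF T_bcontfun] dist_norm T_def scaleR_diff_right[symmetric]
          signed_integral_diff[OF contFX contFX] norm_scaleR using w(1)[of t] by simp
    qed
    then show "dist (Bcontfun (T z)) (Bcontfun (T z')) * 2 \<le> dist z z'" by simp
  qed
  then obtain z where "Bcontfun (T z) = z" by blast
  then have "apply_bcontfun z t = T z t" for t by (metis Bcontfun_inverse[OF T_bcontfun])
  then have X_eq: "X z t = x0 + signed_integral (\<lambda>s. F (X z s)) t" for t
    unfolding X_def[of z t] T_def using w(1)[of t] by simp
  have "(X z has_vector_derivative F (X z t)) (at t)" for t
  proof -
    have "((\<lambda>t. x0 + signed_integral (\<lambda>s. F (X z s)) t) has_vector_derivative 0 + F (X z t)) (at t)"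
      by (intro has_vector_derivative_add
          has_vector_derivative_const signed_integral_has_vector_derivative contFX)
    then show ?thesis by (simp add: X_eq[abs_def, symmetric])
  qed
  moreover have "X z 0 = x0" by (subst X_eq) (simp add: signed_integral_def)
  ultimately show ?thesis by blast
qed

text \<open>Lipschitz functions are closed under products only where they are bounded, so the bound is made part of the
  notion.\<close>

definition bounded_lipschitz_on :: "'a::metric_space set \<Rightarrow> ('a \<Rightarrow> 'b::real_normed_vector) \<Rightarrow> bool"
    where
  "bounded_lipschitz_on S f \<longleftrightarrow>
     (\<exists>B L. (\<forall>x\<in>S. norm (f x) \<le> B) \<and> (\<forall>x\<in>S. \<forall>y\<in>S. norm (f x - f y) \<le> L * dist x y))"

lemma bounded_lipschitz_onE:
  assumes "bounded_lipschitz_on S f"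
  obtains B L where "B \<ge> 0" "L \<ge> 0" "\<And>x. x \<in> S \<Longrightarrow> norm (f x) \<le> B"
    "\<And>x y. x \<in> S \<Longrightarrow> y \<in> S \<Longrightarrow> norm (f x - f y) \<le> L * dist x y"
proof -
  obtain B L where BL: "\<forall>x\<in>S. norm (f x) \<le> B" "\<forall>x\<in>S. \<forall>y\<in>S. norm (f x - f y) \<le> L * dist x y"
    using assms unfolding bounded_lipschitz_on_def by blast
  show ?thesis
  proof (rule that[of "\<bar>B\<bar>" "\<bar>L\<bar>"])
    fix x assume "x \<in> S" then show "norm (f x) \<le> \<bar>B\<bar>" using BL(1) by force
  next
    fix x y assume "x \<in> S" "y \<in> S"
    then have "norm (f x - f y) \<le> L * dist x y" using BL(2) by blast
    also have "\<dots> \<le> \<bar>L\<bar> * dist x y" by (intro mult_right_mono) auto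
    finally show "norm (f x - f y) \<le> \<bar>L\<bar> * dist x y" .
  qed auto
qed

lemma bounded_lipschitz_on_const: "bounded_lipschitz_on S (\<lambda>_. c)"
  unfolding bounded_lipschitz_on_def by (intro exI[of _ "norm c"] exI[of _ 0]) auto

lemma bounded_lipschitz_on_add:
  assumes "bounded_lipschitz_on S f" "bounded_lipschitz_on S g"
  shows "bounded_lipschitz_on S (\<lambda>x. f x + g x)"
proof -
  obtain B L where f: "\<And>x. x \<in> S \<Longrightarrow> norm (f x) \<le> B"
      "\<And>x y. x \<in> S \<Longrightarrow> y \<in> S \<Longrightarrow> norm (f x - f y) \<le> L * dist x y"
    using bounded_lipschitz_onE[OF assms(1)] by metis
  obtain B' L' where g: "\<And>x. x \<in> S \<Longrightarrow> norm (g x) \<le> B'"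
      "\<And>x y. x \<in> S \<Longrightarrow> y \<in> S \<Longrightarrow> norm (g x - g y) \<le> L' * dist x y"
    using bounded_lipschitz_onE[OF assms(2)] by metis
  show ?thesis
    unfolding bounded_lipschitz_on_def
  proof (rule exI[of _ "B + B'"], rule exI[of _ "L + L'"], intro conjI ballI)
    fix x assume "x \<in> S" then show "norm (f x + g x) \<le> B + B'"
      using norm_triangle_ineq[of "f x" "g x"] f(1)[of x] g(1)[of x] by linarith
  next
    fix x y assume "x \<in> S" "y \<in> S"
    then show "norm (f x + g x - (f y + g y)) \<le> (L + L') * dist x y"
      using norm_diff_triangle_ineq[of "f x" "g x" "f y" "g y"] f(2)[of x y] g(2)[of x y]
      unfolding distrib_right by linarith
  qed
qed

lemma bounded_lipschitz_on_bilinear: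
  assumes "bounded_bilinear h" "bounded_lipschitz_on S f" "bounded_lipschitz_on S g"
  shows "bounded_lipschitz_on S (\<lambda>x. h (f x) (g x))"
proof -
  interpret h: bounded_bilinear h by fact
  obtain K where K: "K \<ge> 0" "\<And>a b. norm (h a b) \<le> norm a * norm b * K" using h.nonneg_bounded
      by blast
  obtain B L where f: "B \<ge> 0" "L \<ge> 0" "\<And>x. x \<in> S \<Longrightarrow> norm (f x) \<le> B"
      "\<And>x y. x \<in> S \<Longrightarrow> y \<in> S \<Longrightarrow> norm (f x - f y) \<le> L * dist x y"
    using bounded_lipschitz_onE[OF assms(2)] by metis
  obtain B' L' where g: "B' \<ge> 0" "L' \<ge> 0" "\<And>x. x \<in> S \<Longrightarrow> norm (g x) \<le> B'"
      "\<And>x y. x \<in> S \<Longrightarrow> y \<in> S \<Longrightarrow> norm (g x - g y) \<le> L' * dist x y"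
    using bounded_lipschitz_onE[OF assms(3)] by metis
  show ?thesis
    unfolding bounded_lipschitz_on_def
  proof (rule exI[of _ "B * B' * K"], rule exI[of _ "(L * B' + B * L') * K"], intro conjI ballI)
    fix x assume "x \<in> S" then show "norm (h (f x) (g x)) \<le> B * B' * K"
      by (intro order_trans[OF K(2)] mult_right_mono mult_mono f g K) auto
  next
    fix x y assume xy: "x \<in> S" "y \<in> S"
    have "h (f x) (g x) - h (f y) (g y) = h (f x - f y) (g x) + h (f y) (g x - g y)"
      by (simp add: h.diff_left h.diff_right)
    then have "norm (h (f x) (g x) - h (f y) (g y)) \<le> norm (h (f x - f y) (g x))
        + norm (h (f y) (g x - g y))"
      by (simp add: norm_triangle_ineq)
    also have "\<dots> \<le> (L * dist x y) * B' * K + B * (L' * dist x y) * K"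
      using xy f(1,2) g(1,2)
      by (intro add_mono order_trans[OF K(2)] mult_right_mono mult_mono f g K) auto
    also have "\<dots> = (L * B' + B * L') * K * dist x y" by (simp add: algebra_simps)
    finally show "norm (h (f x) (g x) - h (f y) (g y)) \<le> (L * B' + B * L') * K * dist x y" .
  qed
qed

lemmas bounded_lipschitz_on_mult =
  bounded_lipschitz_on_bilinear[OF bounded_bilinear_mult]
lemmas bounded_lipschitz_on_scaleR =
  bounded_lipschitz_on_bilinear[OF bounded_bilinear_scaleR]

lemma bounded_lipschitz_on_linear:
  assumes "bounded_linear h" "bounded_lipschitz_on S f"
  shows "bounded_lipschitz_on S (\<lambda>x. h (f x))"
proof -
  interpret h: bounded_linear h by fact
  obtain K where K: "K \<ge> 0" "\<And>a. norm (h a) \<le> norm a * K" using h.nonneg_bounded by blast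
  obtain B L where f: "\<And>x. x \<in> S \<Longrightarrow> norm (f x) \<le> B"
      "\<And>x y. x \<in> S \<Longrightarrow> y \<in> S \<Longrightarrow> norm (f x - f y) \<le> L * dist x y"
    using bounded_lipschitz_onE[OF assms(2)] by metis
  show ?thesis
    unfolding bounded_lipschitz_on_def
  proof (rule exI[of _ "B * K"], rule exI[of _ "L * K"], intro conjI ballI)
    fix x assume "x \<in> S" then show "norm (h (f x)) \<le> B * K"
      using K(1) by (intro order_trans[OF K(2)] mult_right_mono f)
  next
    fix x y assume "x \<in> S" "y \<in> S"
    then have "norm (h (f x - f y)) \<le> L * dist x y * K"
      using K(1) by (intro order_trans[OF K(2)] mult_right_mono f)
    then show "norm (h (f x) - h (f y)) \<le> L * K * dist x y" by (simp add: h.diff mult_ac)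
  qed
qed

lemma bounded_lipschitz_on_id: "bounded S \<Longrightarrow> bounded_lipschitz_on S (\<lambda>x::'a::real_normed_vector. x)"
  unfolding bounded_lipschitz_on_def bounded_iff by (metis dist_norm mult_1 order_refl)

lemma bounded_lipschitz_on_Pair:
  assumes "bounded_lipschitz_on S f" "bounded_lipschitz_on S g"
  shows "bounded_lipschitz_on S (\<lambda>x. (f x, g x))"
proof -
  have "bounded_lipschitz_on S (\<lambda>x. (f x, 0) + (0, g x))"
    by (intro bounded_lipschitz_on_add bounded_lipschitz_on_linear[OF _ assms(1)]
        bounded_lipschitz_on_linear[OF _ assms(2)] bounded_linear_Pair bounded_linear_ident
            bounded_linear_zero)
  then show ?thesis by simp
qed

text \<open>A field multiplied by a cutoff that vanishes outside a ball factors through the nearest-point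
  projection onto the ball, which does not increase distances.\<close>

lemma ode_solution_cutoff:
  fixes F :: "'a::euclidean_space \<Rightarrow> 'a"
  assumes F: "bounded_lipschitz_on (cball 0 (R + 1)) F" and R: "R \<ge> 0"
  shows "\<exists>X. X 0 = x0 \<and> (\<forall>t. (X has_vector_derivative max 0 (min 1 (R + 1 - norm (X t)))
      *\<^sub>R F (X t)) (at t))"
proof -
  let ?S = "cball (0::'a) (R + 1)"
  let ?P = "closest_point ?S"
  define G where "G x = max 0 (min 1 (R + 1 - norm x)) *\<^sub>R F x" for x
  have S: "closed ?S" "?S \<noteq> {}" "convex ?S" using R by auto
  have PS: "?P x \<in> ?S" for x by (rule closest_point_in_set[OF S(1,2)])
  have chi: "bounded_lipschitz_on ?S (\<lambda>x. max 0 (min 1 (R + 1 - norm x)))"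
    unfolding bounded_lipschitz_on_def
  proof (intro exI[of _ 1] conjI ballI)
    fix x y :: 'a
    have "\<bar>norm x - norm y\<bar> \<le> dist x y" by (simp add: dist_norm norm_triangle_ineq3)
    then show "norm (max 0 (min 1 (R + 1 - norm x)) - max 0 (min 1 (R + 1 - norm y))) \<le> 1
        * dist x y"
      unfolding real_norm_def by linarith
  qed auto
  have "bounded_lipschitz_on ?S G" unfolding G_def[abs_def]
      by (rule bounded_lipschitz_on_scaleR[OF chi F])
  then obtain B L where BL: "L \<ge> 0" "\<And>x. x \<in> ?S \<Longrightarrow> norm (G x) \<le> B"
    "\<And>x y. x \<in> ?S \<Longrightarrow> y \<in> ?S \<Longrightarrow> norm (G x - G y) \<le> L * dist x y"
    by (rule bounded_lipschitz_onE) metis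
  have GP: "G x = G (?P x)" for x
  proof (cases "x \<in> ?S")
    case True then show ?thesis by (simp add: closest_point_self)
  next
    case False
    then have "?P x \<in> rel_frontier ?S"
      using R by (intro closest_point_in_rel_frontier S) 
        (auto simp: rel_interior_cball affine_hull_nonempty_interior)
    then have "norm (?P x) = R + 1" using R
        by (simp add: rel_frontier_nonempty_interior frontier_cball)
    then show ?thesis using False by (simp add: G_def)
  qed
  have "\<exists>X. X 0 = x0 \<and> (\<forall>t. (X has_vector_derivative G (X t)) (at t))"
  proof (rule global_ode_solution)
    fix x y
    have "norm (G x - G y) \<le> L * dist (?P x) (?P y)" using BL(3)[OF PS PS] GP by metis
    also have "\<dots> \<le> L * dist x y" by (intro mult_left_mono closest_point_lipschitz S BL(1))
    finally show "norm (G x - G y) \<le> L * norm (x - y)" by (simp add: dist_norm)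
    show "norm (G x) \<le> B" using BL(2)[OF PS] GP by metis
  qed
  then show ?thesis by (simp add: G_def)
qed

lemma bounded_lipschitz_on_diff:
  assumes "bounded_lipschitz_on S f" "bounded_lipschitz_on S g"
  shows "bounded_lipschitz_on S (\<lambda>x. f x - g x)"
  using bounded_lipschitz_on_add[OF assms(1)
      bounded_lipschitz_on_linear[OF bounded_linear_minus[OF bounded_linear_ident] assms(2)]]
  by simp

section \<open>The flow of the parameters\<close>

text \<open>The system of the parameters of \<open>b + c z / (1 - p z)\<close> under the equation. In the system as it results from
  the cubic term, \<open>K\<close> is \<open>|c|\<^sup>2 / (1 - |p|\<^sup>2)\<^sup>2\<close>.\<close>

definition profile_field ::
    "real \<Rightarrow> real \<Rightarrow> complex \<times> complex \<times> complex \<Rightarrow> complex \<times> complex \<times> complex" where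
  "profile_field \<alpha> K = (\<lambda>(b, c, p).
     (- \<i> * (b * b * cnj b + 2 * b * (of_real K * (1 - p * cnj p)) + of_real K * c * cnj p
         + of_real \<alpha> * b),
      - \<i> * (2 * b * cnj b * c + 2 * b * (of_real K * (1 - p * cnj p)) * p + of_real K * c),
      - \<i> * (of_real K * (1 - p * cnj p) * p + cnj b * c)))"

lemma profile_field_lipschitz:
  assumes "bounded S"
  shows "bounded_lipschitz_on S (profile_field \<alpha> K)"
proof -
  note id = bounded_lipschitz_on_id[OF assms]
  have b: "bounded_lipschitz_on S (\<lambda>x::complex\<times>complex\<times>complex. fst x)"
    by (rule bounded_lipschitz_on_linear[OF bounded_linear_fst id])
  have c: "bounded_lipschitz_on S (\<lambda>x::complex\<times>complex\<times>complex. fst (snd x))"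
    by (rule bounded_lipschitz_on_linear[OF
        bounded_linear_compose[OF bounded_linear_fst bounded_linear_snd, unfolded o_def] id])
  have p: "bounded_lipschitz_on S (\<lambda>x::complex\<times>complex\<times>complex. snd (snd x))"
    by (rule bounded_lipschitz_on_linear[OF
        bounded_linear_compose[OF bounded_linear_snd bounded_linear_snd, unfolded o_def] id])
  note cn = bounded_lipschitz_on_linear[OF bounded_linear_cnj]
  show ?thesis
    unfolding profile_field_def split_def
    by (intro bounded_lipschitz_on_Pair bounded_lipschitz_on_mult bounded_lipschitz_on_add
        bounded_lipschitz_on_diff bounded_lipschitz_on_const b c p cn)
qed

text \<open>On the two sides of \<open>0\<close> the function \<open>y\<^sup>2 exp (\<plusminus>2 C t)\<close> increases away from \<open>0\<close>. Hence \<open>y\<close> has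
  no zero, and it keeps its sign.\<close>

lemma differential_inequality_pos:
  fixes y y' :: "real \<Rightarrow> real"
  assumes der: "\<And>t. (y has_real_derivative y' t) (at t)" and bound: "\<And>t. \<bar>y' t\<bar> \<le> C * \<bar>y t\<bar>" and
      "y 0 > 0"
  shows "y t > 0"
proof -
  have sq: "((\<lambda>t. (y t)\<^sup>2) has_real_derivative 2 * y t * y' t) (at t)" for t
    using der[of t] by (auto intro!: derivative_eq_intros)
  have yy: "\<bar>2 * y t * y' t\<bar> \<le> 2 * C * (y t)\<^sup>2" for t
  proof -
    have "\<bar>y t\<bar> * \<bar>y' t\<bar> \<le> \<bar>y t\<bar> * (C * \<bar>y t\<bar>)" by (intro mult_left_mono bound) simp
    then show ?thesis by (simp add: abs_mult power2_eq_square mult_ac)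
  qed
  have d1: "((\<lambda>t. (y t)\<^sup>2 * exp (2 * C * t)) has_real_derivative (2 * y t * y' t + 2 * C * (y t)\<^sup>2)
      * exp (2 * C * t)) (at t)" for t
    by (rule derivative_eq_intros sq refl)+ (simp add: algebra_simps)
  have d2: "((\<lambda>t. (y t)\<^sup>2 * exp (- 2 * C * t))
      has_real_derivative (2 * y t * y' t - 2 * C * (y t)\<^sup>2) * exp (- 2 * C * t)) (at t)" for t
    by (rule derivative_eq_intros sq refl)+ (simp add: algebra_simps)
  have nz: "y t \<noteq> 0" for t
  proof (cases "t \<ge> 0")
    case True
    have "(y 0)\<^sup>2 * exp (2 * C * 0) \<le> (y t)\<^sup>2 * exp (2 * C * t)"
    proof (rule DERIV_nonneg_imp_nondecreasing[OF True])
      fix x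
      have "0 \<le> 2 * y x * y' x + 2 * C * (y x)\<^sup>2" using yy[of x] by linarith
      then show "\<exists>z. ((\<lambda>t. (y t)\<^sup>2 * exp (2 * C * t)) has_real_derivative z) (at x) \<and> 0 \<le> z"
        using d1[of x] mult_nonneg_nonneg[OF _ exp_ge_zero[of "2 * C * x"]] by blast
    qed
    then show ?thesis using \<open>y 0 > 0\<close> by auto
  next
    case False
    then have t: "t \<le> 0" by simp
    have "(y t)\<^sup>2 * exp (- 2 * C * t) \<ge> (y 0)\<^sup>2 * exp (- 2 * C * 0)"
    proof (rule DERIV_nonpos_imp_nonincreasing[OF t])
      fix x
      have "2 * y x * y' x - 2 * C * (y x)\<^sup>2 \<le> 0" using yy[of x] by linarith
      then show "\<exists>z. ((\<lambda>t. (y t)\<^sup>2 * exp (- 2 * C * t)) has_real_derivative z) (at x) \<and> z \<le> 0"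
        using d2[of x] mult_nonpos_nonneg[OF _ exp_ge_zero[of "- 2 * C * x"]] by blast
    qed
    then show ?thesis using \<open>y 0 > 0\<close> by auto
  qed
  have cont: "continuous_on S y" for S
    using der by (meson DERIV_isCont continuous_at_imp_continuous_on)
  show ?thesis
  proof (rule ccontr)
    assume "\<not> y t > 0"
    then have "\<exists>s. y s = 0"
      using IVT'[of y t 0 0] IVT2'[of y t 0 0] cont \<open>y 0 > 0\<close> by (cases "t \<le> 0") auto
    then show False using nz by blast
  qed
qed

lemma has_vector_derivative_triple:
  assumes "((\<lambda>t. (b t, c t, p t)) has_vector_derivative (b', c', p')) (at t)"
  shows "(b has_vector_derivative b') (at t)" "(c has_vector_derivative c') (at t)"
    "(p has_vector_derivative p') (at t)"
proof -
  note snd = bounded_linear.has_vector_derivative[OF bounded_linear_snd assms]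
  show "(b has_vector_derivative b') (at t)"
    using bounded_linear.has_vector_derivative[OF bounded_linear_fst assms] by simp
  show "(c has_vector_derivative c') (at t)"
    using bounded_linear.has_vector_derivative[OF bounded_linear_fst snd] by simp
  show "(p has_vector_derivative p') (at t)"
    using bounded_linear.has_vector_derivative[OF bounded_linear_snd snd] by simp
qed

lemma vector_derivative_zero_eq:
  fixes f :: "real \<Rightarrow> 'a::real_normed_vector"
  assumes "\<And>t. (f has_vector_derivative 0) (at t)"
  shows "f t = f 0"
proof -
  obtain c where "\<And>x. x \<in> UNIV \<Longrightarrow> f x = c"
    using has_vector_derivative_zero_constant[OF convex_UNIV, of f] assms by blast
  then show ?thesis by simp
qed

text \<open>The system of the parameters of a rational profile, with \<open>|c|\<^sup>2 / (1 - |p|\<^sup>2)\<^sup>2\<close> replaced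
  by its constant value \<open>K\<close>. This makes the field polynomial. Multiplying the field by a cutoff only
  changes the speed along its orbits, so the truncated flow has the same invariants; these keep it
  in the region where the cutoff is \<open>1\<close>.\<close>

theorem profile_flow:
  fixes \<alpha> K :: real
  assumes p0: "cmod p0 < 1" and K: "(cmod c0)\<^sup>2 = K * (1 - (cmod p0)\<^sup>2)\<^sup>2"
  obtains b c p :: "real \<Rightarrow> complex" where
    "b 0 = b0" "c 0 = c0" "p 0 = p0"
    "\<And>t. ((\<lambda>t. (b t, c t, p t)) has_vector_derivative profile_field \<alpha> K (b t, c t, p t)) (at t)"
    "\<And>t. cmod (p t) < 1"
    "\<And>t. (cmod (c t))\<^sup>2 = K * (1 - (cmod (p t))\<^sup>2)\<^sup>2"
    "\<And>t. (cmod (b t))\<^sup>2 - K * (cmod (p t))\<^sup>2 = (cmod b0)\<^sup>2 - K * (cmod p0)\<^sup>2"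
proof -
  have y0: "1 - (cmod p0)\<^sup>2 > 0" using p0 by (simp add: power_less_one_iff abs_square_less_1)
  have "0 \<le> K * (1 - (cmod p0)\<^sup>2)\<^sup>2" unfolding K[symmetric] by simp
  then have K0: "K \<ge> 0" using y0 by (simp add: zero_le_mult_iff)
  define Q where "Q = (cmod b0)\<^sup>2 - K * (cmod p0)\<^sup>2 + K"
  have "K * (cmod p0)\<^sup>2 \<le> K * 1" using y0 K0 by (intro mult_left_mono) auto
  then have Q0: "Q \<ge> 0" unfolding Q_def using zero_le_power2[of "cmod b0"] by linarith
  \<comment> \<open>The invariants give \<open>|b|\<^sup>2 \<le> Q\<close>, \<open>|c|\<^sup>2 \<le> K\<close> and \<open>|p|\<^sup>2 \<le> 1\<close>, once \<open>|p| < 1\<close> is known.\<close>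
  define R where "R = sqrt (Q + K + 1)"
  have R0: "R \<ge> 0" by (simp add: R_def Q0 K0)
  define chi where "chi x = max 0 (min 1 (R + 1 - norm x))" for x :: "complex \<times> complex \<times> complex"
  obtain X where X0: "X 0 = (b0, c0, p0)"
    and X': "\<And>t. (X has_vector_derivative chi (X t) *\<^sub>R profile_field \<alpha> K (X t)) (at t)"
    using ode_solution_cutoff[OF profile_field_lipschitz[OF bounded_cball] R0, where
        ?x0.0="(b0, c0, p0)"] unfolding chi_def by blast
  define b c p where "b t = fst (X t)" and "c t = fst (snd (X t))" and "p t = snd (snd (X t))" for t
  have Xbcp: "X t = (b t, c t, p t)" for t by (simp add: b_def c_def p_def)
  define h where "h t = complex_of_real (chi (X t))" for t
  define W where "W t = c t * cnj (p t) * cnj (b t)" for t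
  let ?K = "complex_of_real K" and ?a = "complex_of_real \<alpha>"
  define fb where "fb t = h t
      * (- \<i> * (b t * b t * cnj (b t) + 2 * b t * (?K * (1 - p t * cnj (p t))) + ?K * c t
      * cnj (p t) + ?a * b t))" for t
  define fc where "fc t = h t
      * (- \<i> * (2 * b t * cnj (b t) * c t + 2 * b t * (?K * (1 - p t * cnj (p t))) * p t + ?K
      * c t))" for t
  define fp where "fp t = h t * (- \<i> * (?K * (1 - p t * cnj (p t)) * p t + cnj (b t) * c t))" for t
  have "(X has_vector_derivative (fb t, fc t, fp t)) (at t)" for t
    using X'[of t] unfolding Xbcp[of t] profile_field_def fb_def fc_def fp_def h_def
    by (simp add: scaleR_conv_of_real)
  moreover have "X = (\<lambda>t. (b t, c t, p t))" by (rule ext) (rule Xbcp)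
  ultimately have X'': "((\<lambda>t. (b t, c t, p t)) has_vector_derivative (fb t, fc t, fp t)) (at t)" for
      t
    by (simp only:)
  note db = has_vector_derivative_triple(1)[OF X''] and dc = has_vector_derivative_triple(2)[OF X'']
    and dp = has_vector_derivative_triple(3)[OF X'']
  have hc: "cnj (h t) = h t" for t by (simp add: h_def)
  have dPP: "((\<lambda>t. p t * cnj (p t)) has_vector_derivative h t * (- \<i> * (W t - cnj (W t)))) (at t)"
      for t
  proof -
    have "p t * cnj (fp t) + fp t * cnj (p t) = h t * (- \<i> * (W t - cnj (W t)))"
      unfolding fp_def W_def by (simp add: hc algebra_simps)
    then show ?thesis
      using has_vector_derivative_mult[OF dp[of t] has_vector_derivative_cnj[OF dp[of t]]] by simp
  qed
  have dBB: "((\<lambda>t. b t * cnj (b t)) has_vector_derivative ?K * (h t * (- \<i> * (W t - cnj (W t)))))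
      (at t)" for t
  proof -
    have "b t * cnj (fb t) + fb t * cnj (b t) = ?K * (h t * (- \<i> * (W t - cnj (W t))))"
      unfolding fb_def W_def by (simp add: hc algebra_simps)
    then show ?thesis
      using has_vector_derivative_mult[OF db[of t] has_vector_derivative_cnj[OF db[of t]]] by simp
  qed
  have dCC: "((\<lambda>t. c t * cnj (c t)) has_vector_derivative - 2 * ?K * (1 - p t * cnj (p t))
      * (h t * (- \<i> * (W t - cnj (W t))))) (at t)" for t
  proof -
    have "c t * cnj (fc t) + fc t * cnj (c t) = - 2 * ?K * (1 - p t * cnj (p t))
        * (h t * (- \<i> * (W t - cnj (W t))))"
      unfolding fc_def W_def by (simp add: hc algebra_simps)
    then show ?thesis
      using has_vector_derivative_mult[OF dc[of t] has_vector_derivative_cnj[OF dc[of t]]] by simp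
  qed
  define y where "y t = 1 - (cmod (p t))\<^sup>2" for t
  have yP: "of_real (y t) = 1 - p t * cnj (p t)" for t
    unfolding y_def by (simp only: of_real_diff complex_norm_square of_real_1)
  have dY: "((\<lambda>t. 1 - p t * cnj (p t)) has_vector_derivative h t * (\<i> * (W t - cnj (W t)))) (at t)"
      for t
    using has_vector_derivative_diff[OF has_vector_derivative_const dPP] by simp
  have "((\<lambda>t. c t * cnj (c t) - ?K * ((1 - p t * cnj (p t)) * (1 - p t * cnj (p t))))
      has_vector_derivative 0) (at t)" for t
  proof -
    have "((\<lambda>t. c t * cnj (c t) - ?K * ((1 - p t * cnj (p t)) * (1 - p t * cnj (p t))))
        has_vector_derivative
       - 2 * ?K * (1 - p t * cnj (p t)) * (h t * (- \<i> * (W t - cnj (W t)))) -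
       ?K * ((1 - p t * cnj (p t)) * (h t * (\<i> * (W t - cnj (W t)))) + h t * (\<i> * (W t - cnj (W t)))
           * (1 - p t * cnj (p t)))) (at t)"
      by (intro has_vector_derivative_diff has_vector_derivative_mult_right
          has_vector_derivative_mult dCC dY)
    then show ?thesis by (simp add: algebra_simps)
  qed
  note eq1 = vector_derivative_zero_eq[OF this]
  have "complex_of_real ((cmod (c t))\<^sup>2 - K * (y t)\<^sup>2)
      = complex_of_real ((cmod (c 0))\<^sup>2 - K * (y 0)\<^sup>2)" for t
    unfolding of_real_diff of_real_mult of_real_power[of "y _"] yP complex_norm_square
        using eq1[of t] by (simp add: power2_eq_square)
  then have "(cmod (c t))\<^sup>2 - K * (y t)\<^sup>2 = (cmod (c 0))\<^sup>2 - K * (y 0)\<^sup>2" for t using of_real_eq_iff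
      by blast
  then have cy: "(cmod (c t))\<^sup>2 = K * (y t)\<^sup>2" for t
    using K X0 by (simp add: y_def c_def p_def)
  have "((\<lambda>t. b t * cnj (b t) - ?K * (p t * cnj (p t))) has_vector_derivative 0) (at t)" for t
    using has_vector_derivative_diff[OF dBB has_vector_derivative_mult_right[OF dPP, of ?K]] by simp
  note eq2 = vector_derivative_zero_eq[OF this]
  have "complex_of_real ((cmod (b t))\<^sup>2 - K * (cmod (p t))\<^sup>2)
      = complex_of_real ((cmod (b 0))\<^sup>2 - K * (cmod (p 0))\<^sup>2)" for t
    unfolding of_real_diff of_real_mult complex_norm_square by (rule eq2)
  then have "(cmod (b t))\<^sup>2 - K * (cmod (p t))\<^sup>2 = (cmod (b 0))\<^sup>2 - K * (cmod (p 0))\<^sup>2" for t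
      using of_real_eq_iff by blast
  then have bp: "(cmod (b t))\<^sup>2 - K * (cmod (p t))\<^sup>2 = (cmod b0)\<^sup>2 - K * (cmod p0)\<^sup>2" for t
    using X0 by (simp add: b_def p_def)
  have dy: "(y has_real_derivative - 2 * chi (X t) * Im (W t)) (at t)" for t
  proof -
    have "((\<lambda>t. Re (1 - p t * cnj (p t))) has_vector_derivative Re (h t * (\<i> * (W t - cnj (W t)))))
        (at t)"
      by (rule bounded_linear.has_vector_derivative[OF bounded_linear_Re dY])
    moreover have "Re (1 - p t * cnj (p t)) = y t" for t unfolding yP[symmetric] by simp
    ultimately show ?thesis
        by (simp add: has_real_derivative_iff_has_vector_derivative h_def mult_ac)
  qed
  have ypos: "y t > 0" for t
  proof (rule differential_inequality_pos[OF dy])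
    show "y 0 > 0" using y0 X0 by (simp add: y_def p_def)
    fix t
    have "cmod (c t) = sqrt ((cmod (c t))\<^sup>2)" by simp
    also have "\<dots> = sqrt K * \<bar>y t\<bar>" by (simp only: cy real_sqrt_mult real_sqrt_abs)
    finally have cK: "cmod (c t) = sqrt K * \<bar>y t\<bar>" .
    have chi01: "0 \<le> chi (X t)" "chi (X t) \<le> 1" by (auto simp: chi_def)
    show "\<bar>- 2 * chi (X t) * Im (W t)\<bar> \<le> (2 * sqrt K * (R + 1)\<^sup>2) * \<bar>y t\<bar>"
    proof (cases "norm (X t) \<le> R + 1")
      case True
      have "cmod (b t) \<le> R + 1" "cmod (p t) \<le> R + 1"
        using True norm_fst_le[of "b t" "(c t, p t)"] norm_snd_le[of "(c t, p t)" "b t"]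
            norm_snd_le[of "p t" "c t"]
        unfolding Xbcp by linarith+
      then have pb: "cmod (p t) * cmod (b t) \<le> (R + 1)\<^sup>2"
        unfolding power2_eq_square using R0 by (intro mult_mono) auto
      have "\<bar>Im (W t)\<bar> \<le> cmod (W t)" by (rule abs_Im_le_cmod)
      also have "\<dots> = cmod (c t) * (cmod (p t) * cmod (b t))" by (simp add: W_def norm_mult)
      also have "\<dots> \<le> sqrt K * \<bar>y t\<bar> * (R + 1)\<^sup>2" unfolding cK using K0 by (intro mult_left_mono pb)
          simp
      finally have "\<bar>Im (W t)\<bar> \<le> sqrt K * \<bar>y t\<bar> * (R + 1)\<^sup>2" .
      then have "chi (X t) * \<bar>Im (W t)\<bar> \<le> 1 * (sqrt K * \<bar>y t\<bar> * (R + 1)\<^sup>2)"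
        using chi01 by (intro mult_mono) auto
      then show ?thesis using chi01 by (simp add: abs_mult mult_ac)
    next
      case False
      then show ?thesis using K0 by (simp add: chi_def)
    qed
  qed
  have "chi (X t) = 1" for t
  proof -
    have "(cmod (p t))\<^sup>2 \<le> 1" using ypos[of t] by (simp add: y_def)
    moreover from this have "(cmod (b t))\<^sup>2 \<le> Q" using bp[of t]
        mult_left_mono[OF _ K0, of "(cmod (p t))\<^sup>2" 1] by (simp add: Q_def)
    moreover have "(cmod (c t))\<^sup>2 \<le> K"
      using cy[of t] ypos[of t] mult_left_mono[OF power_le_one[of "y t" 2] K0] by (simp add: y_def)
    ultimately have "(norm (X t))\<^sup>2 \<le> Q + K + 1"
      by (simp add: Xbcp norm_Pair)
    then have "norm (X t) \<le> R" unfolding R_def by (rule real_le_rsqrt)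
    then show ?thesis by (simp add: chi_def)
  qed
  then have "(X has_vector_derivative profile_field \<alpha> K (X t)) (at t)" for t using X'[of t] by simp
  then have "((\<lambda>t. (b t, c t, p t)) has_vector_derivative profile_field \<alpha> K (b t, c t, p t)) (at t)"
      for t
    by (simp add: Xbcp[symmetric])
  moreover have "cmod (p t) < 1" for t
    using ypos[of t] by (simp add: y_def abs_square_less_1)
  ultimately show ?thesis
    using that[of b c p] X0 cy bp by (simp add: b_def c_def p_def y_def)
qed

section \<open>Rational profiles\<close>

definition pole_profile :: "complex \<Rightarrow> complex \<Rightarrow> complex" where
  "pole_profile p z = z / (1 - p * z)"

lemma pole_denominator:
  assumes "cmod p < 1" "cmod z = 1"
  shows "1 - cmod p \<le> cmod (1 - p * z)" "1 - p * z \<noteq> 0"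
proof -
  have "cmod 1 - cmod (p * z) \<le> cmod (1 - p * z)" by (rule norm_triangle_ineq2)
  then show 1: "1 - cmod p \<le> cmod (1 - p * z)" using assms(2) by (simp add: norm_mult)
  then show "1 - p * z \<noteq> 0" using assms(1) by auto
qed

lemma pole_profile_bound:
  assumes "cmod p < 1" "cmod z = 1"
  shows "cmod (pole_profile p z) \<le> 1 / (1 - cmod p)"
  unfolding pole_profile_def norm_divide assms(2)
  using pole_denominator[OF assms] assms(1) by (intro divide_left_mono) (auto intro: mult_pos_pos)

lemma continuous_on_pole_profile: "cmod p < 1 \<Longrightarrow> continuous_on (sphere 0 1) (pole_profile p)"
  unfolding pole_profile_def[abs_def]
  by (intro continuous_intros ballI pole_denominator(2)) auto

lemma L2_pole_profile: "cmod p < 1 \<Longrightarrow> pole_profile p \<in> L2_circle"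
  by (intro L2_continuous continuous_on_pole_profile)

lemma fourier_coeff_shift:
  assumes f: "f \<in> L2_circle"
  shows "fourier_coeff (\<lambda>z. z * f z) k = fourier_coeff f (k - 1)"
proof -
  have zf: "(\<lambda>z. z * f z) \<in> L2_circle"
    by (rule L2_mult_bounded[OF f, where B=1])
        (auto intro: continuous_measurable_circle continuous_intros)
  show ?thesis
    unfolding fourier_coeff_def circle_inner_integral
  proof (rule integral_cong_AE[OF borel_measurable_integrable[OF L2_inner_integrable[OF zf L2_char]]
        borel_measurable_integrable[OF L2_inner_integrable[OF f L2_char]] AE_circleI])
    fix z :: complex assume z: "cmod z = 1"
    then have "z \<noteq> 0" by auto
    then have "z * z powi (-k) = z powi (-(k - 1))" using power_int_add_1'[of z "-k"] by simp
    then show "z * f z * cnj (z powi k) = f z * cnj (z powi (k - 1))"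
      unfolding cnj_powi_unit[OF z] by (simp add: mult_ac)
  qed
qed

lemma fourier_coeff_cnj:
  assumes f: "f \<in> L2_circle"
  shows "fourier_coeff (\<lambda>z. cnj (f z)) k = cnj (fourier_coeff f (-k))"
proof -
  have "fourier_coeff (\<lambda>z. cnj (f z)) k = (\<integral>z. cnj (f z * cnj (z powi (-k))) \<partial>circle_measure)"
    unfolding fourier_coeff_def circle_inner_integral
  proof (rule integral_cong_AE[OF
      borel_measurable_integrable[OF L2_inner_integrable[OF L2_cnj[OF f] L2_char]]
        borel_measurable_integrable[OF integrable_cnj[OF L2_inner_integrable[OF f L2_char]]]
            AE_circleI])
    fix z :: complex assume z: "cmod z = 1"
    have e: "cnj (f z * cnj (z powi (-k))) = cnj (f z) * z powi (-k)"
        by (simp only: complex_cnj_mult complex_cnj_cnj)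
    show "cnj (f z) * cnj (z powi k) = cnj (f z * cnj (z powi (-k)))" unfolding e
        by (simp only: cnj_powi_unit[OF z])
  qed
  also have "\<dots> = cnj (fourier_coeff f (-k))"
    unfolding fourier_coeff_def circle_inner_integral by (rule Bochner_Integration.integral_cnj)
  finally show ?thesis .
qed

text \<open>The relation \<open>q = z + p z q\<close> gives a recursion for the coefficients. Those of nonpositive index \<open>k\<close>
  are \<open>p\<^sup>n\<close> times the coefficient of index \<open>k - n\<close>, for every \<open>n\<close>, and vanish because the coefficients are
  bounded.\<close>

lemma fourier_coeff_pole_profile:
  assumes p: "cmod p < 1"
  shows "fourier_coeff (pole_profile p) k = (if k \<ge> 1 then p ^ nat (k - 1) else 0)"
proof -
  note q = L2_pole_profile[OF p]
  have z: "(\<lambda>z::complex. z) \<in> L2_circle" by (intro L2_continuous continuous_intros)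
  have zq: "(\<lambda>z. z * pole_profile p z) \<in> L2_circle"
    by (intro L2_continuous continuous_intros continuous_on_pole_profile p)
  have rec: "fourier_coeff (pole_profile p) k = (if k = 1 then 1 else 0) + p
      * fourier_coeff (pole_profile p) (k - 1)" for k
  proof -
    have "fourier_coeff (pole_profile p) k = fourier_coeff (\<lambda>z. z + p * (z * pole_profile p z)) k"
    proof (rule fourier_coeff_cong[OF q L2_add[OF z L2_cmult[OF zq]] AE_circleI])
      fix z :: complex assume "cmod z = 1"
      then show "pole_profile p z = z + p * (z * pole_profile p z)"
        using pole_denominator(2)[OF p] by (simp add: pole_profile_def divide_simps)
            (simp add: algebra_simps)
    qed
    also have "\<dots> = fourier_coeff (\<lambda>z. z powi 1) k + p * fourier_coeff (pole_profile p) (k - 1)"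
      unfolding fourier_coeff_add[OF z L2_cmult[OF zq]] fourier_coeff_cmult
          fourier_coeff_shift[OF q] by simp
    finally show ?thesis unfolding fourier_coeff_char by (simp only: eq_commute[of 1 k])
  qed
  have nonpos: "fourier_coeff (pole_profile p) k = 0" if "k \<le> 0" for k
  proof -
    have "cmod (fourier_coeff (pole_profile p) k) \<le> cmod p ^ n * L2_circle_norm (pole_profile p)"
        for n
    proof -
      have "fourier_coeff (pole_profile p) k = p ^ n * fourier_coeff (pole_profile p) (k - int n)"
      proof (induction n)
        case (Suc n)
        have "fourier_coeff (pole_profile p) (k - int n) = p
            * fourier_coeff (pole_profile p) (k - int n - 1)"
          using rec[of "k - int n"] that by simp
        also have "k - int n - 1 = k - int (Suc n)" by simp
        finally show ?case using Suc.IH by simp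
      qed simp
      then show ?thesis using fourier_coeff_bound[OF q, of "k - int n"]
        by (simp add: norm_mult norm_power mult_left_mono)
    qed
    moreover have "(\<lambda>n. cmod p ^ n * L2_circle_norm (pole_profile p)) \<longlonglongrightarrow> 0
        * L2_circle_norm (pole_profile p)"
      by (intro tendsto_mult LIMSEQ_power_zero tendsto_const) (use p in auto)
    ultimately have "cmod (fourier_coeff (pole_profile p) k) \<le> 0"
      by (intro LIMSEQ_le_const[where X="\<lambda>n. cmod p ^ n * L2_circle_norm (pole_profile p)"]) auto
    then show ?thesis by simp
  qed
  have "fourier_coeff (pole_profile p) (int (Suc n)) = p ^ n" for n
  proof (induction n)
    case 0 show ?case using rec[of 1] nonpos[of 0] by simp
  next
    case (Suc n) then show ?case using rec[of "int (Suc (Suc n))"] by simp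
  qed
  from this[of "nat (k - 1)"] show ?thesis using nonpos[of k] by (auto simp: Suc_nat_eq_nat_zadd1)
qed

lemma fourier_coeff_pole_profile_sq:
  assumes p: "cmod p < 1" and k: "k \<le> 1"
  shows "fourier_coeff (\<lambda>z. (pole_profile p z)\<^sup>2) k = 0"
proof (rule LIMSEQ_unique[OF fourier_coeff_square_limit[OF L2_pole_profile[OF p], of k]])
  have "(\<Sum>j\<in>{-int N..int N}. fourier_coeff (pole_profile p) j
      * fourier_coeff (pole_profile p) (k - j)) = 0" for N
    by (rule sum.neutral) (use k in \<open>auto simp: fourier_coeff_pole_profile[OF p]\<close>)
  then show "(\<lambda>N. \<Sum>j\<in>{-int N..int N}. fourier_coeff (pole_profile p) j
      * fourier_coeff (pole_profile p) (k - j)) \<longlonglongrightarrow> 0"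
    by simp
qed

lemma L2_const: "(\<lambda>_. c) \<in> L2_circle"
  by (intro L2_continuous continuous_intros)

lemma fourier_coeff_const: "fourier_coeff (\<lambda>_. c) k = (if k = 0 then c else 0)"
  using fourier_coeff_cmult[of c "\<lambda>z. z powi 0" k] unfolding fourier_coeff_char by (cases "k = 0")
      auto

lemma one_minus_mult_cnj: "1 - p * cnj p = of_real (1 - (cmod p)\<^sup>2)"
  by (simp only: of_real_diff complex_norm_square of_real_1)

lemma one_minus_mult_cnj_nonzero:
  assumes "cmod p < 1"
  shows "1 - p * cnj p \<noteq> 0"
proof -
  have "1 - (cmod p)\<^sup>2 \<noteq> 0" using assms by (simp add: abs_square_eq_1)
  then show ?thesis unfolding one_minus_mult_cnj by (simp only: of_real_eq_0_iff not_False_eq_True)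
qed

text \<open>Partial fractions for \<open>|q|\<^sup>2 = 1 / |1 - p z|\<^sup>2\<close>.\<close>

lemma pole_profile_mod_sq:
  assumes p: "cmod p < 1" and z: "cmod z = 1"
  shows "(1 - p * cnj p) * (pole_profile p z * cnj (pole_profile p z)) =
    1 + p * pole_profile p z + cnj p * cnj (pole_profile p z)"
proof -
  have nz: "1 - p * z \<noteq> 0" by (rule pole_denominator(2)[OF p z])
  then have nz': "1 - cnj p * cnj z \<noteq> 0"
      by (metis complex_cnj_diff complex_cnj_mult complex_cnj_one complex_cnj_zero_iff)
  have zz: "z * cnj z = 1" using z by (simp add: complex_norm_square[symmetric])
  have "(1 - p * cnj p) * (z * cnj z) =
      (1 - p * z) * (1 - cnj p * cnj z) + p * z * (1 - cnj p * cnj z) + cnj p * cnj z * (1 - p * z)"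
  proof -
    have "(1 - p * z) * (1 - cnj p * cnj z) + p * z * (1 - cnj p * cnj z) + cnj p * cnj z
        * (1 - p * z) =
        1 - p * cnj p * (z * cnj z)" by (simp add: algebra_simps)
    then show ?thesis unfolding zz by simp
  qed
  then show ?thesis
    unfolding pole_profile_def using nz nz' by (simp add: divide_simps) (simp add: algebra_simps)
qed

text \<open>Up to the factor \<open>1 - |p|\<^sup>2\<close>, both values are means of the right-hand side of \<open>pole_profile_mod_sq\<close>, the
  second one after multiplication by \<open>q\<close>. The means of \<open>q\<close>, \<open>q\<^sup>2\<close> and \<open>q\<^sup>*\<close> vanish.\<close>

lemma circle_inner_pole_profile:
  assumes p: "cmod p < 1"
  shows "circle_inner (pole_profile p) (pole_profile p) = 1 / (1 - p * cnj p)"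
    and "circle_inner (\<lambda>z. (pole_profile p z)\<^sup>2) (pole_profile p) = cnj p / (1 - p * cnj p)\<^sup>2"
proof -
  let ?q = "pole_profile p" and ?s = "1 - p * cnj p"
  have s: "?s \<noteq> 0" by (rule one_minus_mult_cnj_nonzero[OF p])
  note q = L2_pole_profile[OF p]
  have cq: "continuous_on (sphere 0 1) ?q" by (rule continuous_on_pole_profile[OF p])
  have q2: "(\<lambda>z. (?q z)\<^sup>2) \<in> L2_circle" by (intro L2_continuous continuous_intros cq)
  have int: "integrable circle_measure f" if "continuous_on (sphere 0 1) f" for f ::
      "complex \<Rightarrow> complex"
    using that by (rule circle_integrable_continuous)
  have m1: "(\<integral>z. ?q z \<partial>circle_measure) = 0"
    using fourier_coeff_pole_profile[OF p, of 0]
        by (simp add: fourier_coeff_def circle_inner_integral)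
  then have m2: "(\<integral>z. cnj (?q z) \<partial>circle_measure) = 0"
      by (simp add: Bochner_Integration.integral_cnj)
  have m3: "(\<integral>z. (?q z)\<^sup>2 \<partial>circle_measure) = 0"
    using fourier_coeff_pole_profile_sq[OF p, of 0]
        by (simp add: fourier_coeff_def circle_inner_integral)
  have "?s * circle_inner ?q ?q = (\<integral>z. ?s * (?q z * cnj (?q z)) \<partial>circle_measure)"
    by (simp add: circle_inner_integral)
  also have "\<dots> = (\<integral>z. 1 + p * ?q z + cnj p * cnj (?q z) \<partial>circle_measure)"
    by (intro integral_cong_AE borel_measurable_integrable int AE_circleI pole_profile_mod_sq p)
       (auto intro!: continuous_intros cq)
  also have "\<dots> = 1"
    using int[OF cq] int[OF continuous_on_cnj[OF cq]] by (simp add: m1 m2)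
  finally have qq: "?s * circle_inner ?q ?q = 1" .
  then show "circle_inner ?q ?q = 1 / ?s" using s by (simp add: field_simps)
  have "?s * circle_inner (\<lambda>z. (?q z)\<^sup>2) ?q = (\<integral>z. ?s * ((?q z)\<^sup>2 * cnj (?q z)) \<partial>circle_measure)"
    by (simp add: circle_inner_integral)
  also have "\<dots> = (\<integral>z. ?q z + p * (?q z)\<^sup>2 + cnj p * (?q z * cnj (?q z)) \<partial>circle_measure)"
  proof (intro integral_cong_AE borel_measurable_integrable int AE_circleI)
    fix z :: complex assume "cmod z = 1"
    from pole_profile_mod_sq[OF p this]
    have "?q z * (?s * (?q z * cnj (?q z))) = ?q z * (1 + p * ?q z + cnj p * cnj (?q z))" by simp
    then show "?s * ((?q z)\<^sup>2 * cnj (?q z)) = ?q z + p * (?q z)\<^sup>2 + cnj p * (?q z * cnj (?q z))"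
      by (simp add: power2_eq_square algebra_simps)
  qed (auto intro!: continuous_intros cq)
  also have "\<dots> = cnj p * circle_inner ?q ?q"
    using int[OF cq] L2_integrable[OF q2] L2_inner_integrable[OF q q]
        by (simp add: m1 m3 circle_inner_integral)
  finally have "?s * (?s * circle_inner (\<lambda>z. (?q z)\<^sup>2) ?q) = cnj p * (?s * circle_inner ?q ?q)"
      by (simp add: mult.left_commute)
  then have "?s\<^sup>2 * circle_inner (\<lambda>z. (?q z)\<^sup>2) ?q = cnj p" unfolding qq
      by (simp add: power2_eq_square mult.assoc)
  then show "circle_inner (\<lambda>z. (?q z)\<^sup>2) ?q = cnj p / ?s\<^sup>2" using s by (simp add: field_simps)
qed

definition rational_profile :: "complex \<Rightarrow> complex \<Rightarrow> complex \<Rightarrow> complex \<Rightarrow> complex" where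
  "rational_profile b c p z = b + c * pole_profile p z"

lemma continuous_on_rational_profile:
  "cmod p < 1 \<Longrightarrow> continuous_on (sphere 0 1) (rational_profile b c p)"
  unfolding rational_profile_def[abs_def] by (intro continuous_intros continuous_on_pole_profile)

lemma L2_rational_profile: "cmod p < 1 \<Longrightarrow> rational_profile b c p \<in> L2_circle"
  by (intro L2_continuous continuous_on_rational_profile)

lemma fourier_coeff_rational_profile:
  assumes "cmod p < 1"
  shows "fourier_coeff (rational_profile b c p) k
      = (if k = 0 then b else if k \<ge> 1 then c * p ^ nat (k - 1) else 0)"
  unfolding rational_profile_def[abs_def]
  by (simp add: fourier_coeff_add[OF L2_const L2_cmult[OF L2_pole_profile[OF assms]]]
      fourier_coeff_const
      fourier_coeff_cmult fourier_coeff_pole_profile[OF assms])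

lemma rational_profile_bound:
  assumes "cmod p < 1" "cmod z = 1"
  shows "cmod (rational_profile b c p z) \<le> cmod b + cmod c / (1 - cmod p)"
proof -
  have "cmod (rational_profile b c p z) \<le> cmod b + cmod (c * pole_profile p z)"
    unfolding rational_profile_def by (rule norm_triangle_ineq)
  also have "\<dots> \<le> cmod b + cmod c * (1 / (1 - cmod p))"
    unfolding norm_mult by (intro add_left_mono mult_left_mono pole_profile_bound assms) simp
  finally show ?thesis by simp
qed

text \<open>The projection of the cubic term to \<open>L\<^sup>2\<^sub>+\<close>, which consists of the first three summands, is a combination
  of \<open>1\<close>, \<open>q\<close> and \<open>q\<^sup>2\<close>. So is the derivative \<open>b' + c' q + c p' q\<^sup>2\<close> of a rational profile in its
  parameters, and comparing coefficients gives the field of the parameters: the coefficient of \<open>q\<^sup>2\<close> is divisible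
  by \<open>c\<close>. The hypothesis on \<open>K\<close> removes the powers of \<open>1 - |p|\<^sup>2\<close> from the denominators.\<close>

lemma rational_profile_cubic:
  fixes K :: complex
  assumes p: "cmod p < 1" and z: "cmod z = 1" and K: "c * cnj c = K * (1 - p * cnj p)\<^sup>2"
  defines "A \<equiv> K * (1 - p * cnj p)" and "q \<equiv> pole_profile p z"
  shows "rational_profile b c p z * cnj (rational_profile b c p z) * rational_profile b c p z =
    (b * b * cnj b + 2 * b * A + K * c * cnj p) + (2 * b * cnj b * c + 2 * b * A * p + K * c) * q
      + (A * c * p + cnj b * c * c) * q\<^sup>2
      + (b * b * cnj c + 2 * b * A * cnj p + K * c * cnj p * cnj p) * cnj q"
proof -
  define s m where "s = 1 - p * cnj p" and "m = q * cnj q"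
  have sm: "s * m = 1 + p * q + cnj p * cnj q"
    unfolding s_def m_def q_def by (rule pole_profile_mod_sq[OF p z])
  have cc: "c * cnj c = K * s * s" using K by (simp add: s_def power2_eq_square)
  have t1: "2 * b * (c * cnj c) * m = 2 * b * (K * s) * (s * m)" unfolding cc by simp
  have "c * (c * cnj c) * q * m = K * c * s * q * (s * m)" unfolding cc by simp
  also have "\<dots> = K * c * s * q * (1 + p * q + cnj p * cnj q)" by (simp only: sm)
  also have "\<dots> = K * c * (s * q + s * p * q\<^sup>2 + cnj p * (s * m))"
    unfolding m_def by (simp add: power2_eq_square algebra_simps)
  finally have t2: "c * (c * cnj c) * q * m = K * c * (s * q + s * p * q\<^sup>2 + cnj p * (s * m))" .
  have "rational_profile b c p z * cnj (rational_profile b c p z) * rational_profile b c p z =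
      b * b * cnj b + 2 * b * cnj b * c * q + cnj b * c * c * q\<^sup>2 + b * b * cnj c * cnj q
        + 2 * b * (c * cnj c) * m + c * (c * cnj c) * q * m"
    unfolding rational_profile_def q_def[symmetric] m_def
        by (simp add: power2_eq_square algebra_simps)
  also have "\<dots> = b * b * cnj b + 2 * b * cnj b * c * q + cnj b * c * c * q\<^sup>2 + b * b * cnj c * cnj q
        + 2 * b * (K * s) * (1 + p * q + cnj p * cnj q)
        + K * c * (s * q + s * p * q\<^sup>2 + cnj p * (1 + p * q + cnj p * cnj q))"
    unfolding t1 t2 sm by simp
  also have "\<dots> = (b * b * cnj b + 2 * b * A + K * c * cnj p)
      + (2 * b * cnj b * c + 2 * b * A * p + K * c) * q
      + (A * c * p + cnj b * c * c) * q\<^sup>2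
      + (b * b * cnj c + 2 * b * A * cnj p + K * c * cnj p * cnj p) * cnj q"
    unfolding A_def s_def by (simp add: power2_eq_square algebra_simps)
  finally show ?thesis .
qed

section \<open>Uniqueness of the solution with a rational datum\<close>

text \<open>If \<open>d\<close> is the difference quotient of \<open>w\<close>, the one of the squared norm is \<open>2 Re (d | w) + h \<parallel>d\<parallel>\<^sup>2\<close>.\<close>

lemma L2_norm_sq_has_derivative:
  assumes w: "\<And>s. w s \<in> L2_circle" and w': "w' \<in> L2_circle"
    and lim: "((\<lambda>h. L2_circle_norm (\<lambda>z. (w (t + h) z - w t z) / of_real h - w' z)) \<longlongrightarrow> 0) (at 0)"
  shows "((\<lambda>s. (L2_circle_norm (w s))\<^sup>2) has_real_derivative 2 * Re (circle_inner w' (w t))) (at t)"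
proof -
  define d where "d h = (\<lambda>z. (w (t + h) z - w t z) / complex_of_real h)" for h
  define e where "e h = L2_circle_norm (\<lambda>z. d h z - w' z)" for h
  have d: "d h \<in> L2_circle" for h
    using L2_cmult[OF L2_diff[OF w w], of "1 / of_real h" "t + h" t] by (simp add: d_def)
  have e0: "(e \<longlongrightarrow> 0) (at 0)" using lim unfolding e_def d_def .
  let ?N = "\<lambda>s. (L2_circle_norm (w s))\<^sup>2"
  let ?g = "\<lambda>h. 2 * e h * L2_circle_norm (w t) + \<bar>h\<bar> * (e h + L2_circle_norm w')\<^sup>2"
  have est: "norm ((?N (t + h) - ?N t) / h - 2 * Re (circle_inner w' (w t))) \<le> ?g h" if "h \<noteq> 0" for
      h
  proof -
    have hd: "(\<lambda>z. of_real h * d h z) \<in> L2_circle" by (rule L2_cmult[OF d])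
    have "w (t + h) = (\<lambda>z. of_real h * d h z + w t z)" using that by (simp add: d_def)
    then have "?N (t + h) = h\<^sup>2 * (L2_circle_norm (d h))\<^sup>2 + ?N t + 2
        * Re (of_real h * circle_inner (d h) (w t))"
      using L2_circle_norm_sq_add[OF hd w[of t]]
      by (simp add: L2_circle_norm_cmult circle_inner_cmult_left power_mult_distrib)
    then have "(?N (t + h) - ?N t) / h = h * (L2_circle_norm (d h))\<^sup>2 + 2
        * Re (circle_inner (d h) (w t))"
      using that by (simp add: field_simps power2_eq_square)
    then have "(?N (t + h) - ?N t) / h - 2 * Re (circle_inner w' (w t)) =
        h * (L2_circle_norm (d h))\<^sup>2 + 2 * Re (circle_inner (\<lambda>z. d h z - w' z) (w t))"
      by (simp add: circle_inner_diff_left[OF d w' w])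
    moreover have "\<bar>Re (circle_inner (\<lambda>z. d h z - w' z) (w t))\<bar> \<le> e h * L2_circle_norm (w t)"
      using abs_Re_le_cmod circle_cauchy_schwarz[OF L2_diff[OF d w'] w] unfolding e_def
          by (rule order_trans)
    moreover have "L2_circle_norm (d h) \<le> e h + L2_circle_norm w'"
      using L2_circle_norm_triangle[OF L2_diff[OF d w'] w', of h] unfolding e_def by simp
    then have "\<bar>h * (L2_circle_norm (d h))\<^sup>2\<bar> \<le> \<bar>h\<bar> * (e h + L2_circle_norm w')\<^sup>2"
      by (simp add: abs_mult mult_left_mono power_mono)
    ultimately show ?thesis unfolding real_norm_def by linarith
  qed
  have "(?g \<longlongrightarrow> 2 * 0 * L2_circle_norm (w t) + \<bar>0\<bar> * (0 + L2_circle_norm w')\<^sup>2) (at 0)"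
    by (intro tendsto_intros e0)
  then have g0: "(?g \<longlongrightarrow> 0) (at 0)" by simp
  have "((\<lambda>h. (?N (t + h) - ?N t) / h - 2 * Re (circle_inner w' (w t))) \<longlongrightarrow> 0) (at 0)"
    by (rule Lim_null_comparison[OF _ g0]) (use est in \<open>auto simp: eventually_at_filter\<close>)
  then show ?thesis unfolding DERIV_def by (rule LIM_zero_cancel)
qed

lemma has_vector_derivative_remainder:
  assumes "(f has_vector_derivative f') (at t)"
  shows "((\<lambda>h. cmod ((f (t + h) - f t) / of_real h - f')) \<longlongrightarrow> 0) (at (0::real))"
proof -
  have "((\<lambda>h. norm (f (t + h) - f t - h *\<^sub>R f') / norm h) \<longlongrightarrow> 0) (at 0)"
    using assms unfolding has_vector_derivative_def has_derivative_at by blast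
  moreover have "norm (f (t + h) - f t - h *\<^sub>R f') / norm h
      = cmod ((f (t + h) - f t) / of_real h - f')" if "h \<noteq> 0" for h
  proof -
    have "(f (t + h) - f t) / of_real h - f' = (f (t + h) - f t - h *\<^sub>R f') / of_real h"
      using that by (simp add: field_simps scaleR_conv_of_real)
    then show ?thesis by (simp add: norm_divide)
  qed
  then have "\<forall>\<^sub>F h in at 0. norm (f (t + h) - f t - h *\<^sub>R f') / norm h
      = cmod ((f (t + h) - f t) / of_real h - f')"
    by (simp add: eventually_at_filter)
  ultimately show ?thesis by (rule Lim_transform_eventually)
qed

lemma pole_profile_difference:
  assumes "cmod p < 1" "cmod p' < 1" "cmod z = 1"
  shows "pole_profile p' z - pole_profile p z = (p' - p) * pole_profile p z * pole_profile p' z"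
  using pole_denominator(2)[OF assms(1,3)] pole_denominator(2)[OF assms(2,3)]
  by (simp add: pole_profile_def divide_simps) (simp add: algebra_simps)

text \<open>The difference quotients converge even uniformly on the circle, because the poles stay away from it. By
  \<open>pole_profile_difference\<close> the remainder is a combination of products of at most three bounded profiles,
  with coefficients that tend to \<open>0\<close>.\<close>

lemma rational_profile_has_L2_derivative:
  assumes b: "(b has_vector_derivative b') (at t)" and c: "(c has_vector_derivative c') (at t)"
    and p: "(p has_vector_derivative p') (at t)" and p1: "\<And>s. cmod (p s) < 1"
  shows "((\<lambda>h. L2_circle_norm (\<lambda>z.
      (rational_profile (b (t + h)) (c (t + h)) (p (t + h)) z
          - rational_profile (b t) (c t) (p t) z) / of_real h
        - (b' + c' * pole_profile (p t) z + c t * p' * (pole_profile (p t) z)\<^sup>2))) \<longlongrightarrow> 0)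
            (at (0::real))"
proof -
  define eb where "eb h = cmod ((b (t + h) - b t) / of_real h - b')" for h
  define ec where "ec h = cmod ((c (t + h) - c t) / of_real h - c')" for h
  define ep where "ep h = cmod ((p (t + h) - p t) / of_real h - p')" for h
  define dp where "dp h = cmod (p (t + h) - p t)" for h
  have lims: "(eb \<longlongrightarrow> 0) (at 0)" "(ec \<longlongrightarrow> 0) (at 0)" "(ep \<longlongrightarrow> 0) (at 0)"
    unfolding eb_def[abs_def] ec_def[abs_def] ep_def[abs_def]
    by (intro has_vector_derivative_remainder b c p)+
  have pc: "((\<lambda>h. p (t + h)) \<longlongrightarrow> p t) (at 0)"
    using has_vector_derivative_continuous[OF p] by (simp add: isCont_def LIM_offset_zero)
  then have "((\<lambda>h. cmod (p (t + h) - p t)) \<longlongrightarrow> cmod (p t - p t)) (at 0)" by (intro tendsto_intros)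
  then have dp0: "(dp \<longlongrightarrow> 0) (at 0)" unfolding dp_def[abs_def] by simp
  \<comment> \<open>Twice the bound at \<open>p t\<close> itself, to be valid for all parameters near \<open>p t\<close>.\<close>
  define B where "B = 2 / (1 - cmod (p t))"
  have pt: "1 - cmod (p t) > 0" using p1[of t] by simp
  then have B: "B > 0" by (simp add: B_def)
  let ?q = "pole_profile (p t)"
  have qB: "cmod (?q z) \<le> B" if "cmod z = 1" for z
  proof -
    have "1 / (1 - cmod (p t)) \<le> B" unfolding B_def using pt by (intro divide_right_mono) auto
    then show ?thesis using pole_profile_bound[OF p1 that, of t] by linarith
  qed
  have "((\<lambda>h. cmod (p (t + h))) \<longlongrightarrow> cmod (p t)) (at 0)" by (intro tendsto_intros pc)
  then have "\<forall>\<^sub>F h in at 0. cmod (p (t + h)) < (1 + cmod (p t)) / 2" using pt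
      by (intro order_tendstoD) auto
  then have ev: "\<forall>\<^sub>F h in at 0. h \<noteq> 0 \<and> (\<forall>z. cmod z = 1 \<longrightarrow> cmod (pole_profile (p (t + h)) z) \<le> B)"
  proof (rule eventually_elim2[OF _ eventually_neq_at_within[of 0]], intro conjI allI impI)
    fix h :: real and z :: complex assume h: "cmod (p (t + h)) < (1 + cmod (p t)) / 2" and z:
        "cmod z = 1"
    have "1 / (1 - cmod (p (t + h))) \<le> 1 / ((1 - cmod (p t)) / 2)"
      using h pt by (intro frac_le) auto
    then show "cmod (pole_profile (p (t + h)) z) \<le> B"
      using pole_profile_bound[OF p1 z, of "t + h"] by (simp add: B_def)
  qed auto
  let ?D = "\<lambda>h z. (rational_profile (b (t + h)) (c (t + h)) (p (t + h)) z
      - rational_profile (b t) (c t) (p t) z) / of_real h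
        - (b' + c' * ?q z + c t * p' * (?q z)\<^sup>2)"
  let ?g = "\<lambda>h. eb h + ec h * B + (ec h + cmod c') * dp h * (B * B) + cmod (c t) * ep h * (B * B)
      + cmod (c t) * cmod p' * dp h * (B * B * B)"
  have est: "L2_circle_norm (?D h) \<le> ?g h"
    if h: "h \<noteq> 0" and hq: "\<And>z. cmod z = 1 \<Longrightarrow> cmod (pole_profile (p (t + h)) z) \<le> B" for h
  proof (rule L2_circle_norm_bounded)
    show "?D h \<in> borel_measurable circle_measure"
      using h p1 by (intro continuous_measurable_circle continuous_intros
          continuous_on_rational_profile continuous_on_pole_profile) auto
    fix z :: complex assume z: "cmod z = 1"
    define q r where "q = ?q z" and "r = pole_profile (p (t + h)) z"
    define \<beta> \<gamma> \<pi>' where "\<beta> = (b (t + h) - b t) / of_real h" and "\<gamma> = (c (t + h) - c t) / of_real h"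
      and "\<pi>' = (p (t + h) - p t) / of_real h"
    define \<delta> where "\<delta> = p (t + h) - p t"
    have hz: "complex_of_real h \<noteq> 0" using h by simp
    have eqs: "b (t + h) = b t + of_real h * \<beta>" "c (t + h) = c t + of_real h * \<gamma>"
        "\<delta> = of_real h * \<pi>'"
      using hz by (simp_all add: \<beta>_def \<gamma>_def \<pi>'_def \<delta>_def)
    have rq: "r - q = \<delta> * q * r"
      using pole_profile_difference[OF p1 p1 z, of "t + h" t] unfolding q_def r_def \<delta>_def .
    then have r: "r = q + \<delta> * q * r" by (simp add: diff_eq_eq add.commute)
    have "b (t + h) + c (t + h) * r - (b t + c t * q) = of_real h * \<beta> + of_real h * \<gamma> * r + c t
        * (r - q)"
      unfolding eqs by (simp add: algebra_simps)
    also have "r - q = of_real h * \<pi>' * q * r" unfolding rq eqs(3) ..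
    finally have quot: "(b (t + h) + c (t + h) * r - (b t + c t * q)) / of_real h = \<beta> + \<gamma> * r + c t
        * \<pi>' * q * r"
      using hz by (simp add: field_simps)
    have e1: "\<gamma> * r = \<gamma> * q + \<gamma> * \<delta> * (q * r)" by (subst r) (simp add: algebra_simps)
    have e2: "c t * p' * q\<^sup>2 = c t * p' * (q * r) - c t * p' * \<delta> * (q * q * r)"
    proof -
      have "c t * p' * q\<^sup>2 = c t * p' * (q * r) - c t * p' * q * (r - q)"
        by (simp add: algebra_simps power2_eq_square)
      then show ?thesis unfolding rq by (simp add: mult_ac)
    qed
    have "?D h z = (b (t + h) + c (t + h) * r - (b t + c t * q)) / of_real h
        - (b' + c' * q + c t * p' * q\<^sup>2)"
      unfolding rational_profile_def q_def r_def ..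
    also have "\<dots> = (\<beta> - b') + (\<gamma> - c') * q + \<gamma> * \<delta> * (q * r) + c t * (\<pi>' - p') * (q * r) + c t * p'
        * \<delta> * (q * q * r)"
      unfolding quot e1 e2 by (simp add: algebra_simps)
    finally have "cmod (?D h z)
        = cmod ((\<beta> - b') + (\<gamma> - c') * q + \<gamma> * \<delta> * (q * r) + c t * (\<pi>' - p') * (q * r) + c t * p' * \<delta>
        * (q * q * r))"
      by (rule arg_cong[where f=cmod])
    also have "\<dots> \<le> cmod (\<beta> - b') + cmod ((\<gamma> - c') * q) + cmod (\<gamma> * \<delta> * (q * r))
        + cmod (c t * (\<pi>' - p') * (q * r)) + cmod (c t * p' * \<delta> * (q * q * r))"
      by (intro order_trans[OF norm_triangle_ineq] add_mono order_refl)
    also have "\<dots> \<le> ?g h"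
    proof -
      have qb: "cmod q \<le> B" and rb: "cmod r \<le> B" unfolding q_def r_def by (simp_all add: qB hq z)
      have qrb: "cmod q * cmod r \<le> B * B" using qb rb B by (intro mult_mono) auto
      have qqrb: "cmod q * cmod q * cmod r \<le> B * B * B" using qb rb B by (intro mult_mono) auto
      have "cmod \<gamma> \<le> ec h + cmod c'" using norm_triangle_sub[of \<gamma> c'] by (simp add: ec_def \<gamma>_def)
      moreover have "cmod (\<gamma> - c') = ec h" "cmod (\<pi>' - p') = ep h" "cmod \<delta> = dp h"
          "cmod (\<beta> - b') = eb h"
        by (simp_all add: ec_def \<gamma>_def ep_def \<pi>'_def dp_def \<delta>_def eb_def \<beta>_def)
      moreover have "0 \<le> ec h" "0 \<le> ep h" "0 \<le> dp h" by (simp_all add: ec_def ep_def dp_def)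
      ultimately show ?thesis
        unfolding norm_mult using qb rb qrb qqrb B
        by (intro add_mono mult_mono order_refl mult_nonneg_nonneg add_nonneg_nonneg norm_ge_zero)
            auto
    qed
    finally show "cmod (?D h z) \<le> ?g h" .
  qed
  have "(?g \<longlongrightarrow> 0 + 0 * B + (0 + cmod c') * 0 * (B * B) + cmod (c t) * 0 * (B * B)
      + cmod (c t) * cmod p' * 0 * (B * B * B)) (at 0)"
    by (intro tendsto_intros lims dp0)
  then have g0: "(?g \<longlongrightarrow> 0) (at 0)" by simp
  show ?thesis
  proof (rule Lim_null_comparison[OF _ g0])
    show "\<forall>\<^sub>F h in at 0. norm (L2_circle_norm (?D h)) \<le> ?g h"
      using ev by eventually_elim (use est in auto)
  qed
qed

lemma gronwall_two_sided:
  fixes Y Y' :: "real \<Rightarrow> real"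
  assumes der: "\<And>t. (Y has_real_derivative Y' t) (at t)" and Y0: "Y 0 = 0"
    and bound: "\<And>t. \<bar>t\<bar> \<le> T \<Longrightarrow> \<bar>Y' t\<bar> \<le> a * Y t + \<beta>" and a: "a \<ge> 1" and \<beta>: "\<beta> \<ge> 0" and t: "\<bar>t\<bar> \<le> T"
  shows "Y t \<le> \<beta> * exp (a * T)"
proof -
  have Y: "Y t + \<beta> / a \<le> \<beta> / a * exp (a * \<bar>t\<bar>)"
  proof (cases "0 \<le> t")
    case True
    have "(Y t + \<beta> / a) * exp (- a * t) \<le> (Y 0 + \<beta> / a) * exp (- a * 0)"
    proof (rule DERIV_nonpos_imp_nonincreasing[OF True])
      fix x assume "0 \<le> x" "x \<le> t"
      have "((\<lambda>t. (Y t + \<beta> / a) * exp (- a * t)) has_real_derivative (Y' x - a * Y x - \<beta>)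
          * exp (- a * x)) (at x)"
        using a by (auto intro!: derivative_eq_intros der simp: algebra_simps)
      moreover have "Y' x - a * Y x - \<beta> \<le> 0" using bound[of x] t \<open>0 \<le> x\<close> \<open>x \<le> t\<close> by linarith
      then have "(Y' x - a * Y x - \<beta>) * exp (- a * x) \<le> 0" by (rule mult_nonpos_nonneg) simp
      ultimately show "\<exists>z. ((\<lambda>t. (Y t + \<beta> / a) * exp (- a * t)) has_real_derivative z) (at x) \<and> z
          \<le> 0" by blast
    qed
    then show ?thesis using True Y0 by (simp add: exp_minus field_simps)
  next
    case False
    then have "t \<le> 0" by simp
    have "(Y t + \<beta> / a) * exp (a * t) \<le> (Y 0 + \<beta> / a) * exp (a * 0)"
    proof (rule DERIV_nonneg_imp_nondecreasing[OF \<open>t \<le> 0\<close>])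
      fix x assume "t \<le> x" "x \<le> 0"
      have "((\<lambda>t. (Y t + \<beta> / a) * exp (a * t)) has_real_derivative (Y' x + a * Y x + \<beta>)
          * exp (a * x)) (at x)"
        using a by (auto intro!: derivative_eq_intros der simp: algebra_simps)
      moreover have "0 \<le> Y' x + a * Y x + \<beta>" using bound[of x] t \<open>t \<le> x\<close> \<open>x \<le> 0\<close> by linarith
      then have "0 \<le> (Y' x + a * Y x + \<beta>) * exp (a * x)" by (rule mult_nonneg_nonneg) simp
      ultimately show "\<exists>z. ((\<lambda>t. (Y t + \<beta> / a) * exp (a * t)) has_real_derivative z) (at x) \<and> 0 \<le> z"
          by blast
    qed
    then have "(Y t + \<beta> / a) * exp (a * t) * exp (- a * t) \<le> \<beta> / a * exp (- a * t)"
      using Y0 by (intro mult_right_mono) auto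
    then show ?thesis using False by (simp add: mult.assoc exp_add[symmetric])
  qed
  have "\<beta> / a \<ge> 0" using a \<beta> by simp
  then have "Y t \<le> \<beta> / a * exp (a * \<bar>t\<bar>)" using Y by linarith
  also have "\<dots> \<le> \<beta> * exp (a * T)"
  proof (intro mult_mono)
    show "\<beta> / a \<le> \<beta>" using a \<beta> by (simp add: divide_le_eq mult_le_cancel_left1)
  qed (use a \<beta> t in auto)
  finally show ?thesis .
qed

lemma locally_bounded_imp_bounded_on_Icc:
  fixes f :: "real \<Rightarrow> real"
  assumes loc: "\<And>t. \<exists>B. \<forall>\<^sub>F r in nhds t. f r \<le> B"
  shows "\<exists>B. \<forall>t\<in>{a..b}. f t \<le> B"
proof -
  obtain Bd where "\<And>t. \<forall>\<^sub>F r in nhds t. f r \<le> Bd t" using loc by metis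
  then have "\<And>t. \<exists>S. open S \<and> t \<in> S \<and> (\<forall>r\<in>S. f r \<le> Bd t)" unfolding eventually_nhds by blast
  then obtain S where S: "\<And>t. open (S t)" "\<And>t. t \<in> S t" "\<And>t r. r \<in> S t \<Longrightarrow> f r \<le> Bd t" by metis
  obtain D where D: "D \<subseteq> {a..b}" "finite D" "{a..b} \<subseteq> (\<Union>t\<in>D. S t)"
    by (rule compactE_image[OF compact_Icc[of a b], of "{a..b}" S]) (use S in auto)
  show ?thesis
  proof (intro exI ballI)
    fix t assume "t \<in> {a..b}"
    then obtain d where d: "d \<in> D" "t \<in> S d" using D(3) by blast
    have "f t \<le> Bd d" by (rule S(3)[OF d(2)])
    also have "\<dots> \<le> (\<Sum>d\<in>D. \<bar>Bd d\<bar>)" using d(1) D(2) member_le_sum[of d D "\<lambda>d. \<bar>Bd d\<bar>"] by force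
    finally show "f t \<le> (\<Sum>d\<in>D. \<bar>Bd d\<bar>)" .
  qed
qed

text \<open>The definition of a solution makes \<open>|u|\<^sup>2 u\<close> square integrable, that is, \<open>u\<close> belongs to \<open>L\<^sup>6\<close> and
  hence to \<open>L\<^sup>4\<close>.\<close>

lemma L2_square_of_cubic:
  assumes u: "u \<in> L2_circle" and F: "(\<lambda>z. of_real ((cmod (u z))\<^sup>2) * u z) \<in> L2_circle"
  shows "(\<lambda>z. (u z)\<^sup>2) \<in> L2_circle"
proof (rule L2_I)
  show "(\<lambda>z. (u z)\<^sup>2) \<in> borel_measurable circle_measure" using L2_measurable[OF u] by measurable
  show "integrable circle_measure (\<lambda>z. 1 + (cmod (of_real ((cmod (u z))\<^sup>2) * u z))\<^sup>2)"
    using L2_square_integrable[OF F] by (intro Bochner_Integration.integrable_add) auto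
  have "a ^ 4 \<le> 1 + a ^ 6" if "a \<ge> 0" for a :: real
  proof (cases "a \<le> 1")
    case True then show ?thesis using power_le_one[of a 4] that zero_le_power[of a 6] by linarith
  next
    case False
    have "a ^ 4 \<le> a ^ 6" by (rule power_increasing) (use False in auto)
    then show ?thesis by linarith
  qed
  from this[OF norm_ge_zero] show
      "AE z in circle_measure. (cmod ((u z)\<^sup>2))\<^sup>2 \<le> 1 + (cmod (of_real ((cmod (u z))\<^sup>2) * u z))\<^sup>2"
    by (intro AE_I2) (simp add: norm_mult norm_power power_mult_distrib power_mult[symmetric]
        power_add[symmetric])
qed

lemma L2_circle_norm_mono:
  assumes "u \<in> L2_circle" "v \<in> L2_circle" "\<And>z. cmod z = 1 \<Longrightarrow> cmod (u z) \<le> cmod (v z)"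
  shows "L2_circle_norm u \<le> L2_circle_norm v"
  unfolding L2_circle_norm_def circle_mean_integral
  by (intro real_sqrt_le_mono integral_mono_AE L2_square_integrable assms AE_circleI power_mono)
      (auto intro: assms)

text \<open>With \<open>w = u - v\<close>, the difference of the cubic terms times \<open>w\<^sup>*\<close> is
  \<open>(|u|\<^sup>2 + |v|\<^sup>2) |w|\<^sup>2 + v u (w\<^sup>*)\<^sup>2\<close>, and only the second summand contributes to the imaginary part. It is
  bounded by \<open>V |u| |w|\<^sup>2\<close>, where \<open>u\<close> is split at the frequency \<open>N\<close>: the low frequencies are bounded up
  to the square root of a logarithm, and the high frequencies are small in \<open>L\<^sup>2\<close>, while
  \<open>|w|\<^sup>2\<close> is bounded in \<open>L\<^sup>2\<close> by the embedding into \<open>L\<^sup>4\<close>.\<close>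

lemma cubic_difference_estimate:
  assumes u: "u \<in> Hs_plus (1/2)" and F: "(\<lambda>z. of_real ((cmod (u z))\<^sup>2) * u z) \<in> L2_circle"
    and v: "continuous_on (sphere 0 1) v" and V: "\<And>z. cmod z = 1 \<Longrightarrow> cmod (v z) \<le> V"
    and M: "Hs_norm (1/2) u \<le> M"
  shows "\<bar>Im (circle_inner (\<lambda>z. of_real ((cmod (u z))\<^sup>2) * u z - of_real ((cmod (v z))\<^sup>2)
      * v z) (\<lambda>z. u z - v z))\<bar>
    \<le> V * (sqrt (2 * M\<^sup>2 * (1 + ln (real (Suc N)))) * (L2_circle_norm (\<lambda>z. u z - v z))\<^sup>2
        + sqrt (2 * M\<^sup>2 / (1 + real N)) * (4 * M\<^sup>2 + 2 * V\<^sup>2))"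
proof -
  note u2 = Hs_plus_L2[OF u]
  have v2: "v \<in> L2_circle" by (rule L2_continuous[OF v])
  have V0: "V \<ge> 0" using order_trans[OF norm_ge_zero V[of 1]] by simp
  have M0: "M \<ge> 0" using order_trans[OF Hs_norm_nonneg M] .
  have M2: "(Hs_norm (1/2) u)\<^sup>2 \<le> M\<^sup>2" using M by (intro power_mono) auto
  define w where "w = (\<lambda>z. u z - v z)"
  have w2: "w \<in> L2_circle" unfolding w_def by (rule L2_diff[OF u2 v2])
  have Fv: "(\<lambda>z. of_real ((cmod (v z))\<^sup>2) * v z) \<in> L2_circle"
    by (intro L2_continuous continuous_intros v)
  define G where "G = (\<lambda>z. of_real ((cmod (u z))\<^sup>2) * u z - of_real ((cmod (v z))\<^sup>2) * v z)"
  have G2: "G \<in> L2_circle" unfolding G_def by (rule L2_diff[OF F Fv])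
  have usq: "(\<lambda>z. (u z)\<^sup>2) \<in> L2_circle" by (rule L2_square_of_cubic[OF u2 F])
  have mu: "u \<in> borel_measurable circle_measure" and mv: "v \<in> borel_measurable circle_measure"
    and mw: "w \<in> borel_measurable circle_measure" using u2 v2 w2 by (auto intro: L2_measurable)
  let ?B = "\<lambda>z. complex_of_real (2 * (cmod (u z))\<^sup>2 + 2 * V\<^sup>2)"
  have wB: "(cmod (w z))\<^sup>2 \<le> 2 * (cmod (u z))\<^sup>2 + 2 * V\<^sup>2" if "cmod z = 1" for z
  proof -
    have "cmod (w z) \<le> cmod (u z) + V" unfolding w_def using norm_triangle_ineq4[of "u z" "v z"]
        V[OF that] by linarith
    then have "(cmod (w z))\<^sup>2 \<le> (cmod (u z) + V)\<^sup>2" by (intro power_mono) auto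
    also have "\<dots> \<le> 2 * (cmod (u z))\<^sup>2 + 2 * V\<^sup>2"
      using sum_squares_bound[of "cmod (u z)" V] by (simp add: power2_sum)
    finally show ?thesis .
  qed
  have absusq: "(\<lambda>z. complex_of_real ((cmod (u z))\<^sup>2)) \<in> L2_circle"
    using usq mu by (simp add: L2_circle_iff norm_power)
  have B2: "?B \<in> L2_circle"
    using L2_add[OF L2_cmult[OF absusq, of 2] L2_const[of "of_real (2 * V\<^sup>2)"]] by simp
  define W where "W = (\<lambda>z. complex_of_real ((cmod (w z))\<^sup>2))"
  have WB: "cmod (W z) \<le> cmod (?B z)" if "cmod z = 1" for z
    unfolding W_def norm_of_real using wB[OF that] zero_le_power2[of "cmod (w z)"] by linarith
  have W2: "W \<in> L2_circle"
  proof (rule L2_I)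
    show "W \<in> borel_measurable circle_measure" unfolding W_def using mw by measurable
    show "integrable circle_measure (\<lambda>z. (cmod (?B z))\<^sup>2)" by (rule L2_square_integrable[OF B2])
    show "AE z in circle_measure. (cmod (W z))\<^sup>2 \<le> (cmod (?B z))\<^sup>2"
      by (intro AE_circleI power_mono WB) simp_all
  qed
  have "L2_circle_norm W \<le> L2_circle_norm ?B"
    by (rule L2_circle_norm_mono[OF W2 B2 WB])
  also have "L2_circle_norm ?B \<le> L2_circle_norm (\<lambda>z. 2 * complex_of_real ((cmod (u z))\<^sup>2))
      + L2_circle_norm (\<lambda>_. of_real (2 * V\<^sup>2))"
    using L2_circle_norm_triangle[OF L2_cmult[OF absusq, of 2] L2_const[of "of_real (2 * V\<^sup>2)"]]
        by simp
  also have "L2_circle_norm (\<lambda>z. 2 * complex_of_real ((cmod (u z))\<^sup>2)) = 2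
      * L2_circle_norm (\<lambda>z. (u z)\<^sup>2)"
    unfolding L2_circle_norm_cmult by (simp add: L2_circle_norm_def norm_power)
  also have "L2_circle_norm (\<lambda>_. of_real (2 * V\<^sup>2)) \<le> 2 * V\<^sup>2"
    by (rule L2_circle_norm_bounded) (simp, simp only: norm_of_real, simp)
  also have "2 * L2_circle_norm (\<lambda>z. (u z)\<^sup>2) \<le> 4 * M\<^sup>2"
    using L4_bound_half[OF u usq] M2 by linarith
  finally have normW: "L2_circle_norm W \<le> 4 * M\<^sup>2 + 2 * V\<^sup>2" by simp
  \<comment> \<open>The splitting of \<open>u\<close> at the frequency \<open>N\<close>.\<close>
  define lo where "lo = fourier_partial N u"
  define hi where "hi = (\<lambda>z. u z - lo z)"
  have lo2: "lo \<in> L2_circle" unfolding lo_def by (rule L2_fourier_partial)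
  have hi2: "hi \<in> L2_circle" unfolding hi_def by (rule L2_diff[OF u2 lo2])
  let ?l = "sqrt (2 * M\<^sup>2 * (1 + ln (real (Suc N))))"
  have lo_bound: "cmod (lo z) \<le> ?l" if "cmod z = 1" for z
  proof (rule real_le_rsqrt)
    have "(cmod (lo z))\<^sup>2 \<le> 2 * (Hs_norm (1/2) u)\<^sup>2 * (1 + ln (real (Suc N)))"
      unfolding lo_def by (rule fourier_partial_sup_bound[OF u that])
    also have "\<dots> \<le> 2 * M\<^sup>2 * (1 + ln (real (Suc N)))"
      using M2 by (intro mult_right_mono) auto
    finally show "(cmod (lo z))\<^sup>2 \<le> 2 * M\<^sup>2 * (1 + ln (real (Suc N)))" .
  qed
  have hi_norm: "L2_circle_norm hi \<le> sqrt (2 * M\<^sup>2 / (1 + real N))"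
  proof (rule real_le_rsqrt)
    have "(L2_circle_norm hi)\<^sup>2 \<le> 2 * (Hs_norm (1/2) u)\<^sup>2 / (1 + real N)"
      unfolding hi_def lo_def by (rule norm_sub_fourier_partial_half[OF u])
    also have "\<dots> \<le> 2 * M\<^sup>2 / (1 + real N)" using M2 by (intro divide_right_mono) auto
    finally show "(L2_circle_norm hi)\<^sup>2 \<le> 2 * M\<^sup>2 / (1 + real N)" .
  qed
  have habs: "(\<lambda>z. complex_of_real (cmod (hi z))) \<in> L2_circle"
  proof -
    have [measurable]: "hi \<in> borel_measurable circle_measure" by (rule L2_measurable[OF hi2])
    have "(\<lambda>z. complex_of_real (cmod (hi z))) \<in> borel_measurable circle_measure" by measurable
    then show ?thesis using L2_square_integrable[OF hi2] by (simp add: L2_circle_iff)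
  qed
  have hW: "integrable circle_measure (\<lambda>z. cmod (hi z) * (cmod (w z))\<^sup>2)"
    using integrable_Re[OF L2_mult_integrable[OF habs W2]] by (simp add: W_def)
  have hW_bound: "(\<integral>z. cmod (hi z) * (cmod (w z))\<^sup>2 \<partial>circle_measure) \<le> sqrt (2 * M\<^sup>2 / (1 + real N))
      * (4 * M\<^sup>2 + 2 * V\<^sup>2)"
  proof -
    have "circle_inner (\<lambda>z. complex_of_real (cmod (hi z))) W
        = of_real (\<integral>z. cmod (hi z) * (cmod (w z))\<^sup>2 \<partial>circle_measure)"
      unfolding circle_inner_integral W_def by (simp flip: of_real_mult of_real_power)
    then have "(\<integral>z. cmod (hi z) * (cmod (w z))\<^sup>2 \<partial>circle_measure)
        \<le> cmod (circle_inner (\<lambda>z. complex_of_real (cmod (hi z))) W)"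
      by simp
    also have "\<dots> \<le> L2_circle_norm (\<lambda>z. complex_of_real (cmod (hi z))) * L2_circle_norm W"
      by (rule circle_cauchy_schwarz[OF habs W2])
    also have "L2_circle_norm (\<lambda>z. complex_of_real (cmod (hi z))) = L2_circle_norm hi"
        by (simp add: L2_circle_norm_def)
    also have "L2_circle_norm hi * L2_circle_norm W \<le> sqrt (2 * M\<^sup>2 / (1 + real N))
        * (4 * M\<^sup>2 + 2 * V\<^sup>2)"
      by (intro mult_mono hi_norm normW) auto
    finally show ?thesis .
  qed
  have pointwise: "\<bar>Im (G z * cnj (w z))\<bar> \<le> V
      * (?l * (cmod (w z))\<^sup>2 + cmod (hi z) * (cmod (w z))\<^sup>2)" if z: "cmod z = 1" for z
  proof -
    have "G z * cnj (w z) = of_real (((cmod (u z))\<^sup>2 + (cmod (v z))\<^sup>2) * (cmod (w z))\<^sup>2) + v z * u z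
        * (cnj (w z))\<^sup>2"
      unfolding G_def w_def of_real_mult of_real_add complex_norm_square
      by (simp add: algebra_simps power2_eq_square)
    then have "\<bar>Im (G z * cnj (w z))\<bar> = \<bar>Im (v z * u z * (cnj (w z))\<^sup>2)\<bar>"
        by (simp only: plus_complex.simps Im_complex_of_real add_0_left)
    also have "\<dots> \<le> cmod (v z * u z * (cnj (w z))\<^sup>2)" by (rule abs_Im_le_cmod)
    also have "\<dots> = cmod (v z) * (cmod (u z) * (cmod (w z))\<^sup>2)" by (simp add: norm_mult norm_power)
    also have "\<dots> \<le> V * ((?l + cmod (hi z)) * (cmod (w z))\<^sup>2)"
    proof (intro mult_mono V z)
      have "cmod (u z) \<le> cmod (lo z) + cmod (hi z)" unfolding hi_def
          using norm_triangle_sub[of "u z" "lo z"] by simp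
      then show "cmod (u z) \<le> ?l + cmod (hi z)" using lo_bound[OF z] by linarith
    qed (use V0 in auto)
    finally show ?thesis by (simp add: distrib_right)
  qed
  have GI: "integrable circle_measure (\<lambda>z. G z * cnj (w z))" by (rule L2_inner_integrable[OF G2 w2])
  have Iw: "integrable circle_measure (\<lambda>z. V
      * (?l * (cmod (w z))\<^sup>2 + cmod (hi z) * (cmod (w z))\<^sup>2))"
    by (intro integrable_mult_right Bochner_Integration.integrable_add L2_square_integrable[OF w2]
        hW)
  have "\<bar>Im (circle_inner G w)\<bar> = \<bar>\<integral>z. Im (G z * cnj (w z)) \<partial>circle_measure\<bar>"
    unfolding circle_inner_integral by (subst integral_Im[OF GI]) (rule refl)
  also have "\<dots> \<le> (\<integral>z. \<bar>Im (G z * cnj (w z))\<bar> \<partial>circle_measure)"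
    by (rule integral_abs_bound)
  also have "\<dots> \<le> (\<integral>z. V * (?l * (cmod (w z))\<^sup>2 + cmod (hi z) * (cmod (w z))\<^sup>2) \<partial>circle_measure)"
    by (intro integral_mono_AE integrable_abs integrable_Im GI Iw AE_circleI pointwise)
  also have "\<dots> = V * (?l * (L2_circle_norm w)\<^sup>2
      + (\<integral>z. cmod (hi z) * (cmod (w z))\<^sup>2 \<partial>circle_measure))"
    unfolding L2_circle_norm_sq
    by (subst Bochner_Integration.integral_mult_right_zero, subst Bochner_Integration.integral_add)
       (auto intro: hW L2_square_integrable[OF w2] integrable_mult_right)
  also have "\<dots> \<le> V * (?l * (L2_circle_norm w)\<^sup>2 + sqrt (2 * M\<^sup>2 / (1 + real N))
      * (4 * M\<^sup>2 + 2 * V\<^sup>2))"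
    using hW_bound V0 by (intro mult_left_mono add_left_mono)
  finally show ?thesis unfolding G_def w_def .
qed

lemma Hs_norm_locally_bounded:
  assumes u: "\<And>t. u t \<in> Hs_plus s"
    and cont: "\<And>t. ((\<lambda>r. Hs_norm s (\<lambda>z. u r z - u t z)) \<longlongrightarrow> 0) (at t)"
  shows "\<exists>M. \<forall>t\<in>{a..b::real}. Hs_norm s (u t) \<le> M"
proof (rule locally_bounded_imp_bounded_on_Icc)
  fix t
  let ?c = "\<lambda>r k. (1 + (real_of_int k)\<^sup>2) powr s * (cmod (fourier_coeff (u r) k))\<^sup>2"
  let ?d = "\<lambda>r k. (1 + (real_of_int k)\<^sup>2) powr s * (cmod (fourier_coeff (\<lambda>z. u r z - u t z) k))\<^sup>2"
  have L: "u r \<in> L2_circle" for r by (rule Hs_plus_L2[OF u])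
  have S: "?c r summable_on UNIV" for r using u[of r] by (simp add: Hs_plus_def Hs_circle_def)
  have dle: "?d r k \<le> 2 * ?c r k + 2 * ?c t k" and cle: "?c r k \<le> 2 * ?d r k + 2 * ?c t k" for r k
  proof -
    have sq: "(cmod (x + y))\<^sup>2 \<le> 2 * (cmod x)\<^sup>2 + 2 * (cmod y)\<^sup>2" for x y
    proof -
      have "(cmod (x + y))\<^sup>2 \<le> (cmod x + cmod y)\<^sup>2" by (intro power_mono norm_triangle_ineq) auto
      then show ?thesis using sum_squares_bound[of "cmod x" "cmod y"] by (simp add: power2_sum)
    qed
    have fd: "fourier_coeff (\<lambda>z. u r z - u t z) k = fourier_coeff (u r) k - fourier_coeff (u t) k"
      by (rule fourier_coeff_diff[OF L L])
    have 1: "(cmod (fourier_coeff (\<lambda>z. u r z - u t z) k))\<^sup>2 \<le> 2 * (cmod (fourier_coeff (u r) k))\<^sup>2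
        + 2 * (cmod (fourier_coeff (u t) k))\<^sup>2"
      using sq[of "fourier_coeff (u r) k" "- fourier_coeff (u t) k"] unfolding fd by simp
    have 2: "(cmod (fourier_coeff (u r) k))\<^sup>2 \<le> 2 * (cmod (fourier_coeff (\<lambda>z. u r z - u t z) k))\<^sup>2
        + 2 * (cmod (fourier_coeff (u t) k))\<^sup>2"
      using sq[of "fourier_coeff (u r) k - fourier_coeff (u t) k" "fourier_coeff (u t) k"]
          unfolding fd by simp
    show "?d r k \<le> 2 * ?c r k + 2 * ?c t k" "?c r k \<le> 2 * ?d r k + 2 * ?c t k"
      using mult_left_mono[OF 1, of "(1 + (real_of_int k)\<^sup>2) powr s"]
          mult_left_mono[OF 2, of "(1 + (real_of_int k)\<^sup>2) powr s"]
      by (simp_all add: distrib_left)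
  qed
  have Sd: "?d r summable_on UNIV" for r
  proof (rule summable_on_comparison_test)
    show "(\<lambda>k. 2 * ?c r k + 2 * ?c t k) summable_on UNIV"
      by (intro summable_on_add summable_on_cmult_right S)
  qed (use dle in auto)
  have est: "(Hs_norm s (u r))\<^sup>2 \<le> 2 * (Hs_norm s (\<lambda>z. u r z - u t z))\<^sup>2 + 2 * (Hs_norm s (u t))\<^sup>2"
      for r
  proof -
    have "(\<Sum>\<^sub>\<infinity>k. ?c r k) \<le> (\<Sum>\<^sub>\<infinity>k. 2 * ?d r k + 2 * ?c t k)"
      by (intro infsum_mono S summable_on_add summable_on_cmult_right Sd cle)
    also have "\<dots> = 2 * (\<Sum>\<^sub>\<infinity>k. ?d r k) + 2 * (\<Sum>\<^sub>\<infinity>k. ?c t k)"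
      by (subst infsum_add) (auto intro!: summable_on_cmult_right S Sd simp: infsum_cmult_right')
    finally show ?thesis unfolding Hs_norm_sq .
  qed
  have "\<forall>\<^sub>F r in at t. Hs_norm s (\<lambda>z. u r z - u t z) < 1" using cont[of t] by (rule order_tendstoD)
      simp
  then have "\<forall>\<^sub>F r in nhds t. r \<noteq> t \<longrightarrow> Hs_norm s (\<lambda>z. u r z - u t z) < 1"
      by (simp add: eventually_at_filter)
  then have "\<forall>\<^sub>F r in nhds t. Hs_norm s (u r) \<le> sqrt (2 + 2 * (Hs_norm s (u t))\<^sup>2)"
  proof eventually_elim
    case (elim r)
    show ?case
    proof (rule real_le_rsqrt)
      show "(Hs_norm s (u r))\<^sup>2 \<le> 2 + 2 * (Hs_norm s (u t))\<^sup>2"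
      proof (cases "r = t")
        case False
        then have "(Hs_norm s (\<lambda>z. u r z - u t z))\<^sup>2 \<le> 1" using elim by (intro power_le_one) auto
        then show ?thesis using est[of r] by linarith
      qed (use zero_le_power2[of "Hs_norm s (u t)"] in simp)
    qed
  qed
  then show "\<exists>B. \<forall>\<^sub>F r in nhds t. Hs_norm s (u r) \<le> B" by blast
qed

text \<open>The exponent grows like the square root of \<open>ln N\<close>, which is too slow to compensate for the factor
  \<open>1 / sqrt N\<close>.\<close>

lemma logarithmic_gronwall_limit:
  fixes A B C T :: real
  assumes "A \<ge> 0" "B \<ge> 0" "C \<ge> 0" "T \<ge> 0"
  shows "(\<lambda>N. A * sqrt (B / (1 + real N)) * exp ((1 + C * sqrt (1 + ln (real (Suc N)))) * T)) \<longlonglongrightarrow> 0"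
proof (rule Lim_null_comparison)
  have "(\<lambda>N. A' * sqrt (B' / (1 + real N))
      * exp ((1 + C' * sqrt (1 + ln (real (Suc N)))) * T')) \<longlonglongrightarrow> 0"
    if "A' > 0" "B' > 0" "C' > 0" "T' > 0" for A' B' C' T' :: real
    using that by real_asymp
  from this[of "A + 1" "B + 1" "C + 1" "T + 1"] assms
  show "(\<lambda>N. (A + 1) * sqrt ((B + 1) / (1 + real N))
      * exp ((1 + (C + 1) * sqrt (1 + ln (real (Suc N)))) * (T + 1))) \<longlonglongrightarrow> 0"
    by simp
  show "\<forall>\<^sub>F N in sequentially. norm (A * sqrt (B / (1 + real N))
      * exp ((1 + C * sqrt (1 + ln (real (Suc N)))) * T))
      \<le> (A + 1) * sqrt ((B + 1) / (1 + real N)) * exp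
          ((1 + (C + 1) * sqrt (1 + ln (real (Suc N)))) * (T + 1))"
  proof (rule always_eventually, rule allI)
    fix N
    have l: "0 \<le> sqrt (1 + ln (real (Suc N)))" by simp
    have "(1 + C * sqrt (1 + ln (real (Suc N)))) * T \<le> (1 + (C + 1) * sqrt (1 + ln (real (Suc N))))
        * (T + 1)"
      using assms l by (intro mult_mono add_mono order_refl add_nonneg_nonneg mult_nonneg_nonneg)
          auto
    moreover have "sqrt (B / (1 + real N)) \<le> sqrt ((B + 1) / (1 + real N))"
      by (intro real_sqrt_le_mono divide_right_mono) auto
    ultimately have "A * sqrt (B / (1 + real N)) * exp ((1 + C * sqrt (1 + ln (real (Suc N)))) * T)
      \<le> (A + 1) * sqrt ((B + 1) / (1 + real N)) * exp
          ((1 + (C + 1) * sqrt (1 + ln (real (Suc N)))) * (T + 1))"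
      using assms by (intro mult_mono) auto
    moreover have "0 \<le> A * sqrt (B / (1 + real N))
        * exp ((1 + C * sqrt (1 + ln (real (Suc N)))) * T)"
      using assms by simp
    ultimately show "norm (A * sqrt (B / (1 + real N))
        * exp ((1 + C * sqrt (1 + ln (real (Suc N)))) * T))
      \<le> (A + 1) * sqrt ((B + 1) / (1 + real N)) * exp
          ((1 + (C + 1) * sqrt (1 + ln (real (Suc N)))) * (T + 1))"
      unfolding real_norm_def by linarith
  qed
qed

lemma cnj_pole_profile_orthogonal:
  assumes p: "cmod p < 1" and w: "w \<in> L2_plus"
  shows "circle_inner (\<lambda>z. cnj (pole_profile p z)) w = 0"
proof (rule circle_inner_eq_0)
  show "(\<lambda>z. cnj (pole_profile p z)) \<in> L2_circle" by (rule L2_cnj[OF L2_pole_profile[OF p]])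
  show "w \<in> L2_circle" using w by (simp add: L2_plus_def)
  show "fourier_coeff (\<lambda>z. cnj (pole_profile p z)) k = 0 \<or> fourier_coeff w k = 0" for k
    using w by (cases "k < 0")
      (auto simp: L2_plus_def fourier_coeff_cnj[OF L2_pole_profile[OF p]]
          fourier_coeff_pole_profile[OF p])
qed

text \<open>Let \<open>w\<close> be the difference of \<open>u\<close> and the rational profile \<open>v\<close>. In the derivative of \<open>\<parallel>w\<parallel>\<^sup>2\<close> the projection
  may be dropped, as \<open>w\<close> has no negative frequencies, and the linear term contributes the imaginary part of
  \<open>\<alpha> |(w|1)|\<^sup>2\<close>, which is \<open>0\<close>. What remains is the imaginary part estimated in
  \<open>cubic_difference_estimate\<close>. Gronwall's inequality then bounds \<open>\<parallel>w\<parallel>\<^sup>2\<close> by the sequence of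
  \<open>logarithmic_gronwall_limit\<close>, for every \<open>N\<close>.\<close>

theorem szego_rational_uniqueness:
  assumes sol: "alpha_szego_solution \<alpha> u"
    and flow: "\<And>t. ((\<lambda>t. (b t, c t, p t)) has_vector_derivative profile_field \<alpha> K (b t, c t, p t))
        (at t)"
    and p1: "\<And>t. cmod (p t) < 1"
    and cK: "\<And>t. (cmod (c t))\<^sup>2 = K * (1 - (cmod (p t))\<^sup>2)\<^sup>2"
    and init: "AE z in circle_measure. u 0 z = rational_profile (b 0) (c 0) (p 0) z"
  shows "AE z in circle_measure. u t z = rational_profile (b t) (c t) (p t) z"
proof -
  have uH: "u t \<in> Hs_plus (1/2)" for t using sol by (simp add: alpha_szego_solution_def)
  have ucont: "((\<lambda>r. Hs_norm (1/2) (\<lambda>z. u r z - u t z)) \<longlongrightarrow> 0) (at t)" for t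
    using sol unfolding alpha_szego_solution_def by blast
  have "\<forall>t. \<exists>g. is_szego_proj (\<lambda>z. of_real ((cmod (u t z))\<^sup>2) * u t z) g \<and>
      ((\<lambda>h. L2_circle_norm (\<lambda>z. \<i> * ((u (t + h) z - u t z) / of_real h)
                - (g z + of_real \<alpha> * circle_inner (u t) (\<lambda>_. 1)))) \<longlongrightarrow> 0) (at 0)"
    using sol unfolding alpha_szego_solution_def by blast
  from choice[OF this] obtain g where g:
      "\<And>t. is_szego_proj (\<lambda>z. of_real ((cmod (u t z))\<^sup>2) * u t z) (g t)"
    and gd: "\<And>t. ((\<lambda>h. L2_circle_norm (\<lambda>z. \<i> * ((u (t + h) z - u t z) / of_real h)
                - (g t z + of_real \<alpha> * circle_inner (u t) (\<lambda>_. 1)))) \<longlongrightarrow> 0) (at 0)"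
    by blast
  note u2 = Hs_plus_L2[OF uH]
  have g2: "g t \<in> L2_circle" and F2: "(\<lambda>z. of_real ((cmod (u t z))\<^sup>2) * u t z) \<in> L2_circle" for t
    using g[of t] by (auto simp: is_szego_proj_def)
  define v where "v t = rational_profile (b t) (c t) (p t)" for t
  have vc: "continuous_on (sphere 0 1) (v t)" for t unfolding v_def
      by (rule continuous_on_rational_profile[OF p1])
  have v2: "v t \<in> L2_circle" for t by (rule L2_continuous[OF vc])
  define w where "w t = (\<lambda>z. u t z - v t z)" for t
  have w2: "w t \<in> L2_circle" for t unfolding w_def by (rule L2_diff[OF u2 v2])
  have wplus: "w t \<in> L2_plus" for t
  proof -
    have "fourier_coeff (w t) k = 0" if "k < 0" for k
      unfolding w_def fourier_coeff_diff[OF u2 v2] Hs_plus_negative[OF uH that]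
      unfolding v_def fourier_coeff_rational_profile[OF p1] using that by simp
    then show ?thesis using w2 by (simp add: L2_plus_def)
  qed
  define n0 where "n0 t = b t * b t * cnj (b t) + 2 * b t * (of_real K * (1 - p t * cnj (p t)))
      + of_real K * c t * cnj (p t)" for t
  define n1 where "n1 t = 2 * b t * cnj (b t) * c t + 2 * b t * (of_real K * (1 - p t * cnj (p t)))
      * p t + of_real K * c t" for t
  define n2 where "n2 t = of_real K * (1 - p t * cnj (p t)) * p t + cnj (b t) * c t" for t
  have field: "profile_field \<alpha> K (b t, c t, p t)
      = (- \<i> * (n0 t + of_real \<alpha> * b t), - \<i> * n1 t, - \<i> * n2 t)" for t
    by (simp add: profile_field_def n0_def n1_def n2_def)
  note db = has_vector_derivative_triple(1)[OF flow[unfolded field]]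
    and dc = has_vector_derivative_triple(2)[OF flow[unfolded field]]
    and dp = has_vector_derivative_triple(3)[OF flow[unfolded field]]
  define N0 where "N0 t z = n0 t + n1 t * pole_profile (p t) z + c t * n2 t
      * (pole_profile (p t) z)\<^sup>2" for t z
  have N2: "N0 t \<in> L2_circle" for t
    unfolding N0_def[abs_def]
        by (intro L2_continuous continuous_intros continuous_on_pole_profile p1)
  let ?\<alpha> = "complex_of_real \<alpha>"
  define w0 where "w0 t = circle_inner (w t) (\<lambda>_. 1)" for t
  have w0: "w0 t = circle_inner (u t) (\<lambda>_. 1) - b t" for t
  proof -
    have "circle_inner (v t) (\<lambda>_. 1) = b t"
      using fourier_coeff_rational_profile[OF p1, of "b t" "c t" t 0]
          by (simp add: fourier_coeff_def v_def)
    then show ?thesis unfolding w0_def w_def circle_inner_diff_left[OF u2 v2 L2_const] by simp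
  qed
  define w' where "w' t = (\<lambda>z. - \<i> * (g t z - N0 t z + ?\<alpha> * w0 t))" for t
  have gN: "(\<lambda>z. g t z - N0 t z + ?\<alpha> * w0 t) \<in> L2_circle" for t
    by (rule L2_add[OF L2_diff[OF g2 N2] L2_const])
  have w'2: "w' t \<in> L2_circle" for t unfolding w'_def by (rule L2_cmult[OF gN])
  have wd: "((\<lambda>h. L2_circle_norm (\<lambda>z. (w (t + h) z - w t z) / of_real h - w' t z)) \<longlongrightarrow> 0) (at 0)" for
      t
  proof -
    define U where "U h = (\<lambda>z. (u (t + h) z - u t z) / of_real h - (- \<i>)
        * (g t z + ?\<alpha> * circle_inner (u t) (\<lambda>_. 1)))" for h
    define Vd where "Vd h = (\<lambda>z. (v (t + h) z - v t z) / of_real h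
        - ((- \<i>) * (n0 t + ?\<alpha> * b t) + (- \<i>) * n1 t * pole_profile (p t) z
        + c t * ((- \<i>) * n2 t) * (pole_profile (p t) z)\<^sup>2))" for h
    have U2: "U h \<in> L2_circle" for h
    proof -
      have "U h = (\<lambda>z. (1 / of_real h) * (u (t + h) z - u t z) - (- \<i>)
          * (g t z + ?\<alpha> * circle_inner (u t) (\<lambda>_. 1)))"
        unfolding U_def by (rule ext) (simp only: times_divide_eq_left mult_1_left)
      then show ?thesis
        using L2_diff[OF L2_cmult[OF L2_diff[OF u2 u2]] L2_cmult[OF L2_add[OF g2 L2_const]]]
            by (simp only:)
    qed
    have "(\<lambda>z. (- \<i>) * (n0 t + ?\<alpha> * b t) + (- \<i>) * n1 t * pole_profile (p t) z + c t
        * ((- \<i>) * n2 t) * (pole_profile (p t) z)\<^sup>2) \<in> L2_circle"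
      by (intro L2_continuous continuous_intros continuous_on_pole_profile p1)
    then have V2: "Vd h \<in> L2_circle" for h
      unfolding Vd_def using L2_diff[OF L2_cmult[OF L2_diff[OF v2 v2], of "1 / of_real h" "t
          + h" t]] by simp
    have Ulim: "((\<lambda>h. L2_circle_norm (U h)) \<longlongrightarrow> 0) (at 0)"
    proof -
      have "L2_circle_norm (U h)
          = L2_circle_norm (\<lambda>z. \<i> * ((u (t + h) z - u t z) / of_real h)
          - (g t z + ?\<alpha> * circle_inner (u t) (\<lambda>_. 1)))" for h
      proof -
        have "(\<lambda>z. \<i> * ((u (t + h) z - u t z) / of_real h)
            - (g t z + ?\<alpha> * circle_inner (u t) (\<lambda>_. 1))) = (\<lambda>z. \<i> * U h z)"
        proof -
          have "\<i> * A - X = \<i> * (A - (- \<i>) * X)" for A X :: complex by (simp add: algebra_simps)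
          then show ?thesis unfolding U_def by (intro ext)
        qed
        then show ?thesis by (simp add: L2_circle_norm_cmult)
      qed
      then show ?thesis using gd[of t] by simp
    qed
    have Vlim: "((\<lambda>h. L2_circle_norm (Vd h)) \<longlongrightarrow> 0) (at 0)"
      unfolding Vd_def v_def by (rule rational_profile_has_L2_derivative[OF db dc dp p1])
    have "(\<lambda>z. (w (t + h) z - w t z) / of_real h - w' t z) = (\<lambda>z. U h z - Vd h z)" for h
    proof
      fix z
      let ?a = "(u (t + h) z - u t z) / of_real h" and ?b = "(v (t + h) z - v t z) / of_real h"
      have "(w (t + h) z - w t z) / of_real h = ?a - ?b" by (simp add: w_def diff_divide_distrib)
      moreover have "w' t z = (- \<i>) * (g t z + ?\<alpha> * circle_inner (u t) (\<lambda>_. 1)) -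
          ((- \<i>) * (n0 t + ?\<alpha> * b t) + (- \<i>) * n1 t * pole_profile (p t) z + c t * ((- \<i>) * n2 t)
              * (pole_profile (p t) z)\<^sup>2)"
        unfolding w'_def N0_def w0 by (simp add: algebra_simps)
      ultimately show "(w (t + h) z - w t z) / of_real h - w' t z = U h z - Vd h z" unfolding U_def
          Vd_def by simp
    qed
    then have le: "L2_circle_norm (\<lambda>z. (w (t + h) z - w t z) / of_real h - w' t z)
        \<le> L2_circle_norm (U h) + L2_circle_norm (Vd h)" for h
      using L2_circle_norm_triangle_diff[OF U2 V2] by simp
    have s: "((\<lambda>h. L2_circle_norm (U h) + L2_circle_norm (Vd h)) \<longlongrightarrow> 0) (at 0)"
        using tendsto_add[OF Ulim Vlim] by simp
    show ?thesis by (rule Lim_null_comparison[OF _ s]) (use le in simp)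
  qed
  define Y where "Y t = (L2_circle_norm (w t))\<^sup>2" for t
  have dY: "(Y has_real_derivative 2 * Re (circle_inner (w' t) (w t))) (at t)" for t
    unfolding Y_def[abs_def] by (rule L2_norm_sq_has_derivative[OF w2 w'2 wd])
  have Yd: "2 * Re (circle_inner (w' t) (w t)) =
      2 * Im (circle_inner (\<lambda>z. of_real ((cmod (u t z))\<^sup>2) * u t z - of_real ((cmod (v t z))\<^sup>2)
          * v t z) (w t))" for t
  proof -
    have Fv: "(\<lambda>z. of_real ((cmod (v t z))\<^sup>2) * v t z) \<in> L2_circle"
      by (intro L2_continuous continuous_intros vc)
    have cK': "c t * cnj (c t) = of_real K * (1 - p t * cnj (p t))\<^sup>2"
    proof -
      have "complex_of_real ((cmod (c t))\<^sup>2) = of_real (K * (1 - (cmod (p t))\<^sup>2)\<^sup>2)" unfolding cK ..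
      then show ?thesis unfolding of_real_mult of_real_power[of "1 - _"] of_real_diff of_real_1
          complex_norm_square .
    qed
    define r where "r = b t * b t * cnj (c t) + 2 * b t * (of_real K * (1 - p t * cnj (p t)))
        * cnj (p t) + of_real K * c t * cnj (p t) * cnj (p t)"
    have cq2: "(\<lambda>z. r * cnj (pole_profile (p t) z)) \<in> L2_circle"
        by (rule L2_cmult[OF L2_cnj[OF L2_pole_profile[OF p1]]])
    have "circle_inner (\<lambda>z. of_real ((cmod (v t z))\<^sup>2) * v t z) (w t)
        = circle_inner (\<lambda>z. N0 t z + r * cnj (pole_profile (p t) z)) (w t)"
    proof (rule AE_circle_cong_inner[OF _ refl Fv w2 L2_add[OF N2 cq2] w2])
      fix z :: complex assume z: "cmod z = 1"
      have "of_real ((cmod (v t z))\<^sup>2) * v t z = v t z * cnj (v t z) * v t z"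
          by (simp only: complex_norm_square)
      also have "\<dots> = N0 t z + r * cnj (pole_profile (p t) z)"
        unfolding v_def rational_profile_cubic[OF p1 z cK'] N0_def n0_def n1_def n2_def r_def
        by (simp add: algebra_simps)
      finally show "of_real ((cmod (v t z))\<^sup>2) * v t z = N0 t z + r * cnj (pole_profile (p t) z)" .
    qed
    also have "\<dots> = circle_inner (N0 t) (w t)"
      unfolding circle_inner_add_left[OF N2 cq2 w2] circle_inner_cmult_left
          cnj_pole_profile_orthogonal[OF p1 wplus] by simp
    finally have NF: "circle_inner (N0 t) (w t)
        = circle_inner (\<lambda>z. of_real ((cmod (v t z))\<^sup>2) * v t z) (w t)" ..
    have "circle_inner (\<lambda>_. ?\<alpha> * w0 t) (w t) = ?\<alpha> * w0 t * circle_inner (\<lambda>_. 1) (w t)"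
      using circle_inner_cmult_left[of "?\<alpha> * w0 t" "\<lambda>_. 1" "w t"] by simp
    also have "circle_inner (\<lambda>_. 1) (w t) = cnj (w0 t)" unfolding w0_def circle_inner_cnj ..
    also have "?\<alpha> * w0 t * cnj (w0 t) = of_real (\<alpha> * (cmod (w0 t))\<^sup>2)"
      by (simp only: of_real_mult complex_norm_square mult.assoc)
    finally have W0: "circle_inner (\<lambda>_. ?\<alpha> * w0 t) (w t) = of_real (\<alpha> * (cmod (w0 t))\<^sup>2)" .
    have "circle_inner (w' t) (w t) = - \<i>
        * (circle_inner (g t) (w t) - circle_inner (N0 t) (w t) + of_real (\<alpha> * (cmod (w0 t))\<^sup>2))"
      unfolding w'_def circle_inner_cmult_left[of "- \<i>" "\<lambda>z. g t z - N0 t z + ?\<alpha> * w0 t"]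
          circle_inner_add_left[OF L2_diff[OF g2 N2] L2_const w2]
        circle_inner_diff_left[OF g2 N2 w2] W0 ..
    also have "circle_inner (g t) (w t) - circle_inner (N0 t) (w t) =
        circle_inner (\<lambda>z. of_real ((cmod (u t z))\<^sup>2) * u t z - of_real ((cmod (v t z))\<^sup>2) * v t z)
            (w t)"
      unfolding circle_inner_diff_left[OF F2 Fv w2] szego_proj_inner[OF g wplus] NF ..
    finally show ?thesis by simp
  qed
  have Y0: "Y 0 = 0"
  proof -
    have "AE z in circle_measure. (cmod (w 0 z))\<^sup>2 = 0" using init by eventually_elim
        (simp add: w_def v_def)
    then have "(\<integral>z. (cmod (w 0 z))\<^sup>2 \<partial>circle_measure) = (\<integral>z. 0 \<partial>circle_measure)"
      by (intro integral_cong_AE borel_measurable_integrable[OF L2_square_integrable[OF w2]]) auto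
    then show ?thesis by (simp add: Y_def L2_circle_norm_sq)
  qed
  define T where "T = \<bar>t\<bar>"
  obtain M0 where "\<forall>s\<in>{-T..T}. Hs_norm (1/2) (u s) \<le> M0"
    using Hs_norm_locally_bounded[OF uH ucont] by blast
  then have M0: "Hs_norm (1/2) (u s) \<le> M0" if "\<bar>s\<bar> \<le> T" for s
    using that by (auto simp: abs_le_iff)
  have contf: "continuous_on UNIV f" if "\<And>t. (f has_vector_derivative f' t) (at t)" for f ::
      "real \<Rightarrow> complex" and f'
    using that by (meson continuous_at_imp_continuous_on has_vector_derivative_continuous)
  have "continuous_on {-T..T} (\<lambda>s. cmod (b s) + cmod (c s) / (1 - cmod (p s)))"
    using p1 by (intro continuous_intros continuous_on_subset[OF contf[OF db]]
        continuous_on_subset[OF contf[OF dc]]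
      continuous_on_subset[OF contf[OF dp]]) (auto simp: less_imp_neq)
  then have "bounded ((\<lambda>s. cmod (b s) + cmod (c s) / (1 - cmod (p s))) ` {-T..T})"
    by (intro compact_imp_bounded compact_continuous_image) auto
  then obtain V0 where V0: "\<And>s. s \<in> {-T..T} \<Longrightarrow> norm (cmod (b s) + cmod (c s) / (1 - cmod (p s)))
      \<le> V0"
    unfolding bounded_iff by blast
  have V: "cmod (v s z) \<le> V0" if "\<bar>s\<bar> \<le> T" "cmod z = 1" for s z
  proof -
    have "cmod (v s z) \<le> cmod (b s) + cmod (c s) / (1 - cmod (p s))" unfolding v_def
        by (rule rational_profile_bound[OF p1 that(2)])
    also have "\<dots> \<le> V0" using V0[of s] that(1) by (auto simp: abs_le_iff)
    finally show ?thesis .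
  qed
  have T0: "T \<ge> 0" "\<bar>t\<bar> \<le> T" by (auto simp: T_def)
  have V00: "V0 \<ge> 0" using order_trans[OF norm_ge_zero V[of 0 1]] T0 by simp
  have le: "Y t \<le> 2 * V0 * (4 * M0\<^sup>2 + 2 * V0\<^sup>2) * sqrt (2 * M0\<^sup>2 / (1 + real N))
      * exp ((1 + 2 * V0 * sqrt (2 * M0\<^sup>2) * sqrt (1 + ln (real (Suc N)))) * T)" for N
  proof -
    let ?l = "sqrt (2 * M0\<^sup>2 * (1 + ln (real (Suc N))))" and ?h = "sqrt (2 * M0\<^sup>2 / (1 + real N))"
    have l0: "?l \<ge> 0" by simp
    have "Y t \<le> 2 * V0 * (4 * M0\<^sup>2 + 2 * V0\<^sup>2) * ?h * exp ((1 + 2 * V0 * ?l) * T)"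
    proof (rule gronwall_two_sided[OF dY Y0])
      fix s assume s: "\<bar>s\<bar> \<le> T"
      have "\<bar>Im (circle_inner (\<lambda>z. of_real ((cmod (u s z))\<^sup>2) * u s z - of_real ((cmod (v s z))\<^sup>2)
          * v s z) (w s))\<bar>
          \<le> V0 * (?l * (L2_circle_norm (w s))\<^sup>2 + ?h * (4 * M0\<^sup>2 + 2 * V0\<^sup>2))"
        unfolding w_def by (rule cubic_difference_estimate[OF uH F2 vc V[OF s] M0[OF s]])
      then have "\<bar>2 * Re (circle_inner (w' s) (w s))\<bar> \<le> 2 * V0 * ?l * Y s + 2 * V0
          * (4 * M0\<^sup>2 + 2 * V0\<^sup>2) * ?h"
        unfolding Yd Y_def by (simp add: abs_mult algebra_simps)
      moreover have "0 \<le> Y s" by (simp add: Y_def)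
      ultimately show "\<bar>2 * Re (circle_inner (w' s) (w s))\<bar> \<le> (1 + 2 * V0 * ?l) * Y s + 2 * V0
          * (4 * M0\<^sup>2 + 2 * V0\<^sup>2) * ?h"
        by (simp add: distrib_right)
    qed (use V00 l0 T0 in \<open>auto intro!: mult_nonneg_nonneg\<close>)
    then show ?thesis by (simp add: real_sqrt_mult mult.assoc)
  qed
  have "Y t \<le> 0"
  proof (rule LIMSEQ_le_const[OF logarithmic_gronwall_limit])
    show "\<exists>N. \<forall>n\<ge>N. Y t \<le> 2 * V0 * (4 * M0\<^sup>2 + 2 * V0\<^sup>2) * sqrt (2 * M0\<^sup>2 / (1 + real n)) *
        exp ((1 + 2 * V0 * sqrt (2 * M0\<^sup>2) * sqrt (1 + ln (real (Suc n)))) * T)"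
      using le by blast
  qed (use V00 T0 in simp_all)
  then have "L2_circle_norm (w t) = 0" by (simp add: Y_def)
  from L2_circle_norm_eq_0[OF w2 this] show ?thesis
    by eventually_elim (simp add: w_def v_def)
qed

section \<open>Sobolev norms of rational profiles\<close>

lemma Hs_circle_mono:
  assumes u: "u \<in> Hs_circle s'" and "s \<le> s'"
  shows "u \<in> Hs_circle s \<and> Hs_norm s u \<le> Hs_norm s' u"
proof -
  let ?c = "\<lambda>s k. (1 + (real_of_int k)\<^sup>2) powr s * (cmod (fourier_coeff u k))\<^sup>2"
  have le: "?c s k \<le> ?c s' k" for k
    by (intro mult_right_mono powr_mono assms(2)) auto
  have S': "?c s' summable_on UNIV" using u by (simp add: Hs_circle_def)
  have S: "?c s summable_on UNIV"
    by (rule summable_on_comparison_test[OF S']) (use le in auto)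
  have "Hs_norm s u \<le> Hs_norm s' u"
    unfolding Hs_norm_def by (intro real_sqrt_le_mono infsum_mono S S' le)
  then show ?thesis using S u by (simp add: Hs_circle_def)
qed

lemma has_sum_int_from_zero:
  fixes f :: "int \<Rightarrow> real"
  assumes "\<And>k. k < 0 \<Longrightarrow> f k = 0" and "\<And>n. f (int n) \<ge> 0" and "summable (\<lambda>n. f (int (Suc n)))"
  shows "(f has_sum (f 0 + (\<Sum>n. f (int (Suc n))))) UNIV"
proof -
  have "(\<lambda>n. f (int (Suc n))) sums (\<Sum>n. f (int (Suc n)))" by (rule summable_sums[OF assms(3)])
  then have "(\<lambda>n. f (int n)) sums ((\<Sum>n. f (int (Suc n))) + f (int 0))" by (rule sums_Suc)
  then have "((\<lambda>n. f (int n)) has_sum ((\<Sum>n. f (int (Suc n))) + f (int 0))) UNIV"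
    by (rule sums_nonneg_imp_has_sum) (rule assms(2))
  then have "(f has_sum ((\<Sum>n. f (int (Suc n))) + f (int 0))) (range int)"
    by (subst has_sum_reindex) (auto simp: o_def)
  moreover have "f k = 0" if "k \<in> UNIV - range int" for k
  proof (rule assms(1))
    show "k < 0" using that by (metis Diff_iff int_eq_iff not_less rangeI)
  qed
  ultimately have "(f has_sum ((\<Sum>n. f (int (Suc n))) + f (int 0))) UNIV"
    using has_sum_cong_neutral[of UNIV "range int" f f] by simp
  then show ?thesis by (simp add: add.commute)
qed

text \<open>The squared coefficients of \<open>z / (1 - p z)\<close> with the weights of \<open>H\<^sup>s\<close>, where \<open>x = |p|\<^sup>2\<close>.\<close>

definition weighted_geometric :: "real \<Rightarrow> real \<Rightarrow> nat \<Rightarrow> real" where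
  "weighted_geometric s x n = (1 + (real (Suc n))\<^sup>2) powr s * x ^ n"

definition weighted_geometric_const :: "real \<Rightarrow> real" where
  "weighted_geometric_const s = 2 powr s * (4 * s) powr (2 * s) * exp 1 * 3"

lemma power2_eq_powr: "x > 0 \<Longrightarrow> x\<^sup>2 = x powr 2" for x :: real
  using powr_realpow[of x 2] by simp

lemma power2_powr: "x > 0 \<Longrightarrow> (x\<^sup>2) powr s = x powr (2 * s)" for x :: real
  by (simp only: power2_eq_powr powr_powr)

text \<open>This is \<open>x \<le> exp x\<close> for \<open>x = \<tau> / (2 r)\<close>, raised to the power \<open>r\<close>.\<close>

lemma powr_le_exp:
  fixes r \<tau> :: real
  assumes r: "r > 0" and \<tau>: "\<tau> \<ge> 0"
  shows "\<tau> powr r \<le> (2 * r) powr r * exp (\<tau> / 2)"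
proof -
  have "\<tau> / (2 * r) \<le> exp (\<tau> / (2 * r))" using exp_ge_add_one_self[of "\<tau> / (2 * r)"] by linarith
  then have "(\<tau> / (2 * r)) powr r \<le> (exp (\<tau> / (2 * r))) powr r" using r \<tau> by (intro powr_mono2) auto
  also have "\<dots> = exp (\<tau> / 2)" using r by (simp add: powr_def)
  finally have "(2 * r) powr r * (\<tau> / (2 * r)) powr r \<le> (2 * r) powr r * exp (\<tau> / 2)"
      by (intro mult_left_mono) auto
  moreover have "(2 * r) powr r * (\<tau> / (2 * r)) powr r = \<tau> powr r"
    using r \<tau> by (subst powr_mult[symmetric]) auto
  ultimately show ?thesis by simp
qed

text \<open>\<open>x\<^sup>n \<le> exp (- n (1 - x))\<close>; half of the exponent absorbs the weight, the other half gives a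
  geometric series of size \<open>1 / (1 - x)\<close>.\<close>

lemma weighted_geometric_upper:
  assumes s: "s > 0" and y: "0 < y" "y \<le> 1"
  shows "summable (weighted_geometric s (1 - y))"
    and "(\<Sum>n. weighted_geometric s (1 - y) n) \<le> weighted_geometric_const s * y powr (- 2 * s - 1)"
proof -
  let ?C = "2 powr s * (4 * s) powr (2 * s) * exp 1 * y powr (- 2 * s)"
  have C0: "?C \<ge> 0" by simp
  have bound: "weighted_geometric s (1 - y) n \<le> ?C * exp (- y / 2) ^ n" for n
  proof -
    let ?m = "real (Suc n)"
    have m: "?m \<ge> 1" by simp
    have "1 \<le> ?m\<^sup>2" using m by (rule one_le_power)
    then have "(1 + ?m\<^sup>2) powr s \<le> (2 * ?m\<^sup>2) powr s" using s by (intro powr_mono2) linarith+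
    also have "\<dots> = 2 powr s * ?m powr (2 * s)"
      using m by (subst powr_mult) (simp_all add: power2_powr del: of_nat_Suc)
    also have "?m powr (2 * s) = (?m * y) powr (2 * s) * y powr (- 2 * s)"
      using y by (simp add: powr_mult powr_minus del: of_nat_Suc)
    also have "(?m * y) powr (2 * s) \<le> (4 * s) powr (2 * s) * exp (?m * y / 2)"
      using powr_le_exp[of "2 * s" "?m * y"] s y by simp
    finally have w: "(1 + ?m\<^sup>2) powr s \<le> 2 powr s
        * ((4 * s) powr (2 * s) * exp (?m * y / 2) * y powr (- 2 * s))"
      by (simp add: mult_left_mono mult_right_mono)
    have "(1 - y) ^ n \<le> exp (- y) ^ n" using exp_ge_add_one_self[of "- y"] y by (intro power_mono)
        auto
    then have "weighted_geometric s (1 - y) n \<le>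
        2 powr s * ((4 * s) powr (2 * s) * exp (?m * y / 2) * y powr (- 2 * s)) * exp (- y) ^ n"
      unfolding weighted_geometric_def using y by (intro mult_mono w) auto
    also have "\<dots> = 2 powr s * (4 * s) powr (2 * s) * y powr (- 2 * s)
        * (exp (?m * y / 2) * exp (- y) ^ n)"
      by (simp add: mult_ac)
    also have "exp (?m * y / 2) * exp (- y) ^ n = exp (y / 2) * exp (- y / 2) ^ n"
      by (simp add: exp_of_nat_mult[symmetric] exp_add[symmetric] field_simps)
    finally have 1: "weighted_geometric s (1 - y) n \<le>
        2 powr s * (4 * s) powr (2 * s) * y powr (- 2 * s) * (exp (y / 2) * exp (- y / 2) ^ n)" .
    have "2 powr s * (4 * s) powr (2 * s) * y powr (- 2 * s) * (exp (y / 2) * exp (- y / 2) ^ n) \<le>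
        2 powr s * (4 * s) powr (2 * s) * y powr (- 2 * s) * (exp 1 * exp (- y / 2) ^ n)"
      using y by (intro mult_left_mono mult_right_mono) auto
    from order_trans[OF 1 this] show ?thesis by (simp only: mult_ac)
  qed
  have q: "norm (exp (- y / 2)) < 1" using y by simp
  have sg: "summable (\<lambda>n. ?C * exp (- y / 2) ^ n)" by (intro summable_mult summable_geometric q)
  have nn: "0 \<le> weighted_geometric s (1 - y) n" for n using y by (simp add: weighted_geometric_def)
  show S: "summable (weighted_geometric s (1 - y))"
    by (rule summable_comparison_test[OF _ sg]) (use bound nn in auto)
  have "(\<Sum>n. weighted_geometric s (1 - y) n) \<le> (\<Sum>n. ?C * exp (- y / 2) ^ n)"
    by (rule suminf_le[OF bound S sg])
  also have "\<dots> = ?C * (1 / (1 - exp (- y / 2)))"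
    unfolding suminf_mult[OF summable_geometric[OF q]] suminf_geometric[OF q] ..
  also have "\<dots> \<le> ?C * (3 / y)"
  proof (intro mult_left_mono C0)
    have "1 + y / 2 \<le> exp (y / 2)" by simp
    then have "exp (- y / 2) \<le> 1 / (1 + y / 2)" using y
        by (simp add: exp_minus inverse_eq_divide frac_le)
    also have "\<dots> \<le> 1 - y / 3"
    proof -
      have "y * y \<le> y * 1" using y by (intro mult_left_mono) auto
      then have "1 \<le> (1 - y / 3) * (1 + y / 2)" by (simp add: algebra_simps)
      then show ?thesis using y by (subst pos_divide_le_eq) auto
    qed
    finally have "y / 3 \<le> 1 - exp (- y / 2)" by simp
    then have "1 / (1 - exp (- y / 2)) \<le> 1 / (y / 3)" using y by (intro frac_le) auto
    then show "1 / (1 - exp (- y / 2)) \<le> 3 / y" by simp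
  qed
  also have "\<dots> = weighted_geometric_const s * (y powr (- 2 * s) * y powr (-1))"
  proof -
    have "y powr (-1) = 1 / y" using y powr_minus_divide[of y 1] by simp
    then show ?thesis by (simp add: weighted_geometric_const_def)
  qed
  also have "y powr (- 2 * s) * y powr (-1) = y powr (- 2 * s - 1)"
    unfolding powr_add[symmetric] by (rule arg_cong[where f="\<lambda>e. y powr e"]) simp
  finally show "(\<Sum>n. weighted_geometric s (1 - y) n) \<le> weighted_geometric_const s
      * y powr (- 2 * s - 1)" .
qed

text \<open>The terms with index \<open>n\<close> of the order of \<open>1 / y\<close> suffice: there are at least \<open>1 / y\<close> of them, each with a
  weight of at least \<open>y\<^sup>-\<^sup>2\<^sup>s\<close> and a power of \<open>1 - y\<close> that is bounded below.\<close>

lemma weighted_geometric_lower: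
  assumes s: "s > 0" and y: "0 < y" "y \<le> 1/2"
  shows "exp (-8) * y powr (- 2 * s - 1) \<le> (\<Sum>n. weighted_geometric s (1 - y) n)"
proof -
  \<comment> \<open>The terms used are those with \<open>N \<le> n < 2 N\<close>; they satisfy \<open>n y \<le> 4\<close>, since \<open>N \<le> 2 / y\<close>.\<close>
  define N where "N = nat \<lceil>1 / y\<rceil>"
  have "1 / y \<ge> 0" using y by simp
  then have "real N = real_of_int \<lceil>1 / y\<rceil>" unfolding N_def by (simp add: of_nat_nat)
  then have N1: "1 / y \<le> real N" and N2': "real N \<le> 1 / y + 1" by linarith+
  have "1 \<le> 1 / y" using y by simp
  then have N2: "real N \<le> 2 / y" using N2' by (simp add: field_simps)
  have nn: "0 \<le> weighted_geometric s (1 - y) n" for n using y by (simp add: weighted_geometric_def)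
  have e: "exp (- 2 * y) \<le> 1 - y"
  proof -
    have "1 \<le> (1 + 2 * y) * (1 - y)"
      using mult_left_mono[of y "1/2" y] y by (simp add: algebra_simps)
    also have "\<dots> \<le> exp (2 * y) * (1 - y)" using y by (intro mult_right_mono exp_ge_add_one_self)
        auto
    finally show ?thesis by (simp add: exp_minus field_simps)
  qed
  have term_lower: "y powr (- 2 * s) * exp (-8) \<le> weighted_geometric s (1 - y) n" if n:
      "n \<in> {N..<2 * N}" for n
  proof -
    have "1 / y \<le> real (Suc n)" using N1 n by auto
    then have "(1 / y)\<^sup>2 \<le> (real (Suc n))\<^sup>2" using y by (intro power_mono) auto
    then have "(1 / y)\<^sup>2 \<le> 1 + (real (Suc n))\<^sup>2" by linarith
    then have "((1 / y)\<^sup>2) powr s \<le> (1 + (real (Suc n))\<^sup>2) powr s" using s by (intro powr_mono2)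
        auto
    moreover have "((1 / y)\<^sup>2) powr s = y powr (- 2 * s)"
      using y by (subst power2_powr) (simp_all add: powr_minus_divide powr_divide)
    moreover have "exp (-8) \<le> (1 - y) ^ n"
    proof -
      have "real n * y \<le> 4"
      proof -
        have "real n \<le> 2 * real N" using n by auto
        then have "real n * y \<le> (2 * (2 / y)) * y" using N2 y by (intro mult_right_mono) auto
        then show ?thesis using y by simp
      qed
      then have "exp (-8) \<le> exp (real n * (- 2 * y))" by (simp add: algebra_simps)
      also have "\<dots> = exp (- 2 * y) ^ n" by (rule exp_of_nat_mult)
      also have "\<dots> \<le> (1 - y) ^ n" using e by (intro power_mono) auto
      finally show ?thesis .
    qed
    ultimately show ?thesis unfolding weighted_geometric_def by (intro mult_mono) auto
  qed
  have "exp (-8) * y powr (- 2 * s - 1) = (1 / y) * (y powr (- 2 * s) * exp (-8))"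
  proof -
    have "y powr (- 2 * s - 1) = y powr (- 2 * s) * y powr (-1)"
      unfolding powr_add[symmetric] by (rule arg_cong[where f="\<lambda>e. y powr e"]) simp
    moreover have "y powr (-1) = 1 / y" using y powr_minus_divide[of y 1] by simp
    ultimately show ?thesis by simp
  qed
  also have "\<dots> \<le> real N * (y powr (- 2 * s) * exp (-8))" using N1 by (intro mult_right_mono) auto
  also have "\<dots> = (\<Sum>n\<in>{N..<2 * N}. y powr (- 2 * s) * exp (-8))" by simp
  also have "\<dots> \<le> (\<Sum>n\<in>{N..<2 * N}. weighted_geometric s (1 - y) n)" by (rule sum_mono)
      (rule term_lower)
  also have "\<dots> \<le> (\<Sum>n. weighted_geometric s (1 - y) n)"
    by (rule sum_le_suminf) (use weighted_geometric_upper(1)[OF s, of y] y nn in auto)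
  finally show ?thesis .
qed

lemma rational_profile_Hs_norm:
  assumes u: "u \<in> L2_circle" and ae: "AE z in circle_measure. u z = rational_profile b c p z"
    and p: "cmod p < 1" and s: "s > 0"
  shows "u \<in> Hs_circle s"
    and "(Hs_norm s u)\<^sup>2 = (cmod b)\<^sup>2 + (cmod c)\<^sup>2 * (\<Sum>n. weighted_geometric s ((cmod p)\<^sup>2) n)"
proof -
  have coeff: "fourier_coeff u k = (if k = 0 then b else if k \<ge> 1 then c * p ^ nat (k - 1) else 0)"
      for k
    using fourier_coeff_cong[OF u L2_rational_profile[OF p] ae] fourier_coeff_rational_profile[OF p]
        by metis
  let ?f = "\<lambda>k::int. (1 + (real_of_int k)\<^sup>2) powr s * (cmod (fourier_coeff u k))\<^sup>2"
  have f: "?f (int (Suc n)) = (cmod c)\<^sup>2 * weighted_geometric s ((cmod p)\<^sup>2) n" for n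
    by (simp add: coeff weighted_geometric_def norm_mult norm_power power_mult_distrib
        power_mult[symmetric] mult_ac)
  have "0 < 1 - (cmod p)\<^sup>2" using p by (simp add: abs_square_less_1)
  then have S: "summable (weighted_geometric s ((cmod p)\<^sup>2))"
    using weighted_geometric_upper(1)[OF s, of "1 - (cmod p)\<^sup>2"] by simp
  have "(?f has_sum (?f 0 + (\<Sum>n. ?f (int (Suc n))))) UNIV"
  proof (rule has_sum_int_from_zero)
    show "summable (\<lambda>n. ?f (int (Suc n)))" unfolding f by (rule summable_mult[OF S])
  qed (auto simp: coeff)
  then have hs: "(?f has_sum ((cmod b)\<^sup>2 + (cmod c)\<^sup>2
      * (\<Sum>n. weighted_geometric s ((cmod p)\<^sup>2) n))) UNIV"
    unfolding f suminf_mult[OF S] by (simp add: coeff)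
  then show "u \<in> Hs_circle s" using u unfolding Hs_circle_def by (auto simp: summable_on_def)
  show "(Hs_norm s u)\<^sup>2 = (cmod b)\<^sup>2 + (cmod c)\<^sup>2 * (\<Sum>n. weighted_geometric s ((cmod p)\<^sup>2) n)"
    unfolding Hs_norm_sq by (rule infsumI[OF hs])
qed

text \<open>The sum has size \<open>y\<^sup>-\<^sup>2\<^sup>s\<^sup>-\<^sup>1\<close>, and the factor \<open>|c|\<^sup>2 = K y\<^sup>2\<close> contributes two powers of \<open>y\<close>.\<close>

lemma rational_profile_Hs_bounds:
  assumes u: "u \<in> L2_circle" and ae: "AE z in circle_measure. u z = rational_profile b c p z"
    and p: "cmod p < 1" and s: "s > 0" and K: "(cmod c)\<^sup>2 = K * y\<^sup>2" and K0: "K \<ge> 0"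
    and y_def: "y = 1 - (cmod p)\<^sup>2"
  shows "(Hs_norm s u)\<^sup>2 \<le> (cmod b)\<^sup>2 + K * weighted_geometric_const s * y powr (1 - 2 * s)"
    and "y \<le> 1/2 \<Longrightarrow> K * exp (-8) * y powr (1 - 2 * s) \<le> (Hs_norm s u)\<^sup>2"
proof -
  have y: "0 < y" "y \<le> 1" using p by (simp_all add: y_def abs_square_less_1)
  have x: "(cmod p)\<^sup>2 = 1 - y" by (simp add: y_def)
  have yp: "y\<^sup>2 * y powr (- 2 * s - 1) = y powr (1 - 2 * s)"
    unfolding power2_eq_powr[OF y(1)] by (simp add: powr_add[symmetric])
  have eq: "(Hs_norm s u)\<^sup>2 = (cmod b)\<^sup>2 + K * y\<^sup>2 * (\<Sum>n. weighted_geometric s (1 - y) n)"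
    unfolding rational_profile_Hs_norm(2)[OF u ae p s] K x ..
  have "K * y\<^sup>2 * (\<Sum>n. weighted_geometric s (1 - y) n) \<le> K * y\<^sup>2
      * (weighted_geometric_const s * y powr (- 2 * s - 1))"
    using K0 by (intro mult_left_mono weighted_geometric_upper(2) s y) auto
  also have "\<dots> = K * weighted_geometric_const s * y powr (1 - 2 * s)" unfolding yp[symmetric]
      by (simp add: mult_ac)
  finally show "(Hs_norm s u)\<^sup>2 \<le> (cmod b)\<^sup>2 + K * weighted_geometric_const s * y powr (1 - 2 * s)"
      unfolding eq by simp
  assume y2: "y \<le> 1/2"
  have "K * exp (-8) * y powr (1 - 2 * s) = K * y\<^sup>2 * (exp (-8) * y powr (- 2 * s - 1))"
      unfolding yp[symmetric] by (simp add: mult_ac)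
  also have "\<dots> \<le> K * y\<^sup>2 * (\<Sum>n. weighted_geometric s (1 - y) n)"
    using K0 by (intro mult_left_mono weighted_geometric_lower s y y2) auto
  also have "\<dots> \<le> (Hs_norm s u)\<^sup>2" unfolding eq by simp
  finally show "K * exp (-8) * y powr (1 - 2 * s) \<le> (Hs_norm s u)\<^sup>2" .
qed

section \<open>The distance of the pole to the circle\<close>

lemma has_real_derivative_zero_eq:
  fixes f :: "real \<Rightarrow> real"
  assumes "\<And>t. (f has_real_derivative 0) (at t)"
  shows "f t = f 0"
  using vector_derivative_zero_eq[of f] assms
      by (simp add: has_real_derivative_iff_has_vector_derivative)

lemma linear_ode_solution:
  fixes f :: "real \<Rightarrow> real"
  assumes "\<And>t. (f has_real_derivative k * f t) (at t)"
  shows "f t = f 0 * exp (k * t)"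
proof -
  have "((\<lambda>t. f t * exp (- k * t)) has_real_derivative 0) (at t)" for t
    by (rule derivative_eq_intros assms refl)+ (simp add: algebra_simps)
  from has_real_derivative_zero_eq[of "\<lambda>t. f t * exp (- k * t)", OF this, of t]
  have "f t * exp (- k * t) * exp (k * t) = f 0 * exp (k * t)" by simp
  then show ?thesis by (simp add: mult.assoc exp_add[symmetric])
qed

text \<open>A positive solution of \<open>g'' = k\<^sup>2 (g - a)\<close> with energy \<open>g'\<^sup>2 = k\<^sup>2 (g\<^sup>2 - 2 a g)\<close>: both of
  \<open>g' \<plusminus> k (g - a)\<close> are exponentials, and their product \<open>- k\<^sup>2 a\<^sup>2\<close> is negative, so both exponentials
  are present in \<open>g\<close>. As \<open>g\<close> is positive, their coefficients are positive.\<close>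

lemma hyperbolic_growth:
  fixes g g' :: "real \<Rightarrow> real"
  assumes k: "k > 0" and a: "a > 0" and g: "\<And>t. (g has_real_derivative g' t) (at t)"
    and g': "\<And>t. (g' has_real_derivative k\<^sup>2 * (g t - a)) (at t)"
    and en: "(g' 0)\<^sup>2 = k\<^sup>2 * ((g 0)\<^sup>2 - 2 * a * g 0)" and pos: "\<And>t. g t > 0"
  obtains m M where "m > 0" "M > 0" "\<And>t. m * exp (k * \<bar>t\<bar>) \<le> g t" "\<And>t. g t \<le> M * exp (k * \<bar>t\<bar>)"
proof -
  define P where "P t = g' t + k * (g t - a)" for t
  define R where "R t = k * (g t - a) - g' t" for t
  have "(P has_real_derivative k * P t) (at t)" for t
    unfolding P_def[abs_def]
    by (rule derivative_eq_intros g g' refl)+ (simp add: power2_eq_square algebra_simps)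
  then have P: "P t = P 0 * exp (k * t)" for t by (rule linear_ode_solution)
  have "(R has_real_derivative (- k) * R t) (at t)" for t
    unfolding R_def[abs_def]
    by (rule derivative_eq_intros g g' refl)+ (simp add: power2_eq_square algebra_simps)
  then have R: "R t = R 0 * exp (- k * t)" for t by (rule linear_ode_solution)
  have gPR: "g t = a + (P 0 * exp (k * t) + R 0 * exp (- k * t)) / (2 * k)" for t
    unfolding P[symmetric] R[symmetric] using k by (simp add: P_def R_def field_simps)
  have "P 0 * R 0 = k\<^sup>2 * (g 0 - a)\<^sup>2 - (g' 0)\<^sup>2"
      by (simp add: P_def R_def power2_eq_square algebra_simps)
  also have "\<dots> = k\<^sup>2 * a\<^sup>2" unfolding en by (simp add: power2_eq_square algebra_simps)
  finally have PR: "P 0 * R 0 > 0" using k a by simp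
  have "\<not> P 0 < 0"
  proof
    assume P0: "P 0 < 0"
    then have R0: "R 0 < 0" using PR by (simp add: zero_less_mult_iff)
    \<comment> \<open>By this time the growing exponential outweighs the constant \<open>a\<close>.\<close>
    define t where "t = (2 * k * a / (- P 0)) / k"
    have "k * t = 2 * k * a / (- P 0)" using k by (simp add: t_def)
    then have "1 + 2 * k * a / (- P 0) \<le> exp (k * t)" using exp_ge_add_one_self[of "k * t"] by simp
    then have "P 0 * exp (k * t) \<le> P 0 * (1 + 2 * k * a / (- P 0))" using P0
        by (intro mult_left_mono_neg) auto
    also have "\<dots> = P 0 - 2 * k * a" using P0 by (simp add: field_simps)
    finally have "P 0 * exp (k * t) + R 0 * exp (- k * t) < - (2 * k * a)"
      using P0 mult_neg_pos[OF R0, of "exp (- k * t)"] by simp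
    then have "(P 0 * exp (k * t) + R 0 * exp (- k * t)) / (2 * k) < - a"
      using k by (simp add: pos_divide_less_eq mult_ac)
    then have "g t < 0" using gPR[of t] by simp
    then show False using pos[of t] by simp
  qed
  then have P0: "P 0 > 0" and R0: "R 0 > 0" using PR by (auto simp: zero_less_mult_iff not_less)
  define m where "m = min (P 0) (R 0) / (2 * k)"
  define M where "M = a + (P 0 + R 0) / (2 * k)"
  have E: "exp (k * t) \<le> exp (k * \<bar>t\<bar>)" "exp (- k * t) \<le> exp (k * \<bar>t\<bar>)" "1 \<le> exp (k * \<bar>t\<bar>)" for t
    using k mult_left_mono[of t "\<bar>t\<bar>" k] mult_left_mono[of "- t" "\<bar>t\<bar>" k] by auto
  show ?thesis
  proof (rule that[of m M])
    show "m > 0" using P0 R0 k by (simp add: m_def)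
    show "M > 0" using P0 R0 k a by (simp add: M_def add_pos_pos)
    fix t
    have "min (P 0) (R 0) * exp (k * \<bar>t\<bar>) \<le> P 0 * exp (k * t) + R 0 * exp (- k * t)"
    proof (cases "t \<ge> 0")
      case True
      have "min (P 0) (R 0) * exp (k * t) \<le> P 0 * exp (k * t)" by (intro mult_right_mono) auto
      moreover have "0 \<le> R 0 * exp (- k * t)" using R0 by simp
      ultimately show ?thesis unfolding abs_of_nonneg[OF True] by linarith
    next
      case False
      then have at: "k * \<bar>t\<bar> = - k * t" by simp
      have "min (P 0) (R 0) * exp (- k * t) \<le> R 0 * exp (- k * t)" by (intro mult_right_mono) auto
      moreover have "0 \<le> P 0 * exp (k * t)" using P0 by simp
      ultimately show ?thesis unfolding at by linarith
    qed
    then have "m * exp (k * \<bar>t\<bar>) \<le> (P 0 * exp (k * t) + R 0 * exp (- k * t)) / (2 * k)"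
      using k by (simp add: m_def divide_right_mono)
    then show "m * exp (k * \<bar>t\<bar>) \<le> g t" using gPR[of t] a by linarith
    have "P 0 * exp (k * t) + R 0 * exp (- k * t) \<le> (P 0 + R 0) * exp (k * \<bar>t\<bar>)"
      unfolding distrib_right using P0 R0 E[of t] by (intro add_mono mult_left_mono) auto
    then have "(P 0 * exp (k * t) + R 0 * exp (- k * t)) / (2 * k) \<le> (P 0 + R 0) / (2 * k)
        * exp (k * \<bar>t\<bar>)"
      using k by (simp add: divide_right_mono)
    moreover have "a \<le> a * exp (k * \<bar>t\<bar>)" using a E(3)[of t] by simp
    ultimately show "g t \<le> M * exp (k * \<bar>t\<bar>)" unfolding gPR[of t] M_def distrib_right by linarith
  qed
qed

lemma bounded_below_derivative_has_zero:
  fixes f f' :: "real \<Rightarrow> real"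
  assumes f: "\<And>t. (f has_real_derivative f' t) (at t)" and e: "e > 0" and b: "\<And>t. f' t \<ge> e"
  shows "\<exists>t. f t = 0"
proof -
  define T where "T = \<bar>f 0\<bar> / e"
  have T: "T \<ge> 0" "e * T = \<bar>f 0\<bar>" using e by (auto simp: T_def)
  have d: "((\<lambda>t. f t - e * t) has_real_derivative f' t - e) (at t)" for t
    by (rule derivative_eq_intros f refl)+ simp
  have nd: "f s - e * s \<le> f t - e * t" if "s \<le> t" for s t
    by (rule DERIV_nonneg_imp_nondecreasing[OF that]) (use d b in force)
  have "f (- T) \<le> 0" using nd[of "- T" 0] T by simp
  moreover have "0 \<le> f T" using nd[of 0 T] T by simp
  moreover have "continuous_on {- T..T} f"
    using f by (meson DERIV_isCont continuous_at_imp_continuous_on)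
  ultimately show ?thesis using IVT'[of f "- T" 0 T] T by force
qed

text \<open>The closed system of \<open>y = 1 - |p|\<^sup>2\<close> and \<open>R + \<i> I = c p\<^sup>* b\<^sup>*\<close> along the flow. Here \<open>K\<close> and \<open>Q\<close> are the
  constants of motion \<open>|c|\<^sup>2 / y\<^sup>2\<close> and \<open>|b|\<^sup>2 + K y\<close> (the mass), so that \<open>(1 - y) (Q - K y)\<close> is \<open>|p b|\<^sup>2\<close>;
  the energy is an affine function of \<open>\<delta>\<close>.\<close>

locale profile_dynamics =
  fixes \<alpha> K Q \<beta> \<delta> :: real and y R I :: "real \<Rightarrow> real"
  assumes K: "K > 0"
    and y: "\<And>t. 0 < y t" "\<And>t. y t \<le> 1"
    and \<beta>: "2 * \<beta> = Q + K - \<alpha>"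
    and dy: "\<And>t. (y has_real_derivative - 2 * I t) (at t)"
    and dI: "\<And>t. (I has_real_derivative R t * (4 * K * y t - 2 * \<beta>)
      + (Q - K * y t) * (K * (y t)\<^sup>2 - 2 * (K * y t) * (1 - y t)) + K\<^sup>2 * (y t)\<^sup>2 * (1 - y t))
          (at t)"
    and R: "\<And>t. R t = \<delta> - \<beta> * y t + K * (y t)\<^sup>2"
    and RI: "\<And>t. (R t)\<^sup>2 + (I t)\<^sup>2 = K * (y t)\<^sup>2 * ((1 - y t) * (Q - K * y t))"
    and Qy: "\<And>t. K * y t \<le> Q"
begin

definition D :: real where "D = K * Q - \<beta>\<^sup>2"

text \<open>Since \<open>R\<^sup>2 \<le> K Q y\<^sup>2\<close>, a small \<open>y\<close> makes \<open>R\<close> small, whereas \<open>R\<close> is then close to \<open>\<delta>\<close>.\<close>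

lemma bounded_below_off_critical:
  assumes "\<delta> \<noteq> 0"
  obtains e where "e > 0" "\<And>t. e \<le> y t"
proof -
  have Q: "Q > 0" using Qy[of 0] y(1)[of 0] K mult_pos_pos[OF K y(1)[of 0]] by linarith
  have A: "sqrt (K * Q) + \<bar>\<beta>\<bar> + K > 0" using K Q by (simp add: add_pos_nonneg add_nonneg_pos)
  have le: "\<bar>\<delta>\<bar> \<le> (sqrt (K * Q) + \<bar>\<beta>\<bar> + K) * y t" for t
  proof -
    have "(R t)\<^sup>2 \<le> K * (y t)\<^sup>2 * ((1 - y t) * (Q - K * y t))" using RI[of t]
        zero_le_power2[of "I t"] by linarith
    also have "\<dots> \<le> K * (y t)\<^sup>2 * (1 * Q)"
      using K y[of t] Qy[of t] by (intro mult_left_mono mult_mono) auto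
    also have "\<dots> = (sqrt (K * Q) * y t)\<^sup>2" using K Q by (simp add: power_mult_distrib)
    finally have "\<bar>R t\<bar>\<^sup>2 \<le> (sqrt (K * Q) * y t)\<^sup>2" by simp
    then have "\<bar>R t\<bar> \<le> sqrt (K * Q) * y t"
      by (rule power2_le_imp_le) (use K Q y(1)[of t] in simp)
    moreover have "\<bar>\<beta> * y t\<bar> = \<bar>\<beta>\<bar> * y t" using y(1)[of t] by (simp add: abs_mult)
    moreover have "K * (y t)\<^sup>2 \<le> K * y t" "0 \<le> K * (y t)\<^sup>2"
      using K y[of t] by (auto simp: power2_eq_square mult_left_le)
    ultimately show ?thesis using R[of t] unfolding distrib_right by linarith
  qed
  show ?thesis
  proof (rule that[of "\<bar>\<delta>\<bar> / (sqrt (K * Q) + \<bar>\<beta>\<bar> + K)"])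
    show "\<bar>\<delta>\<bar> / (sqrt (K * Q) + \<bar>\<beta>\<bar> + K) > 0" using A assms by simp
    show "\<bar>\<delta>\<bar> / (sqrt (K * Q) + \<bar>\<beta>\<bar> + K) \<le> y t" for t
      using le[of t] A by (simp add: pos_divide_le_eq mult.commute)
  qed
qed

context
  assumes critical: "\<delta> = 0"
begin

lemma critical_energy: "(I t)\<^sup>2 = (y t)\<^sup>2 * (D - \<alpha> * K * y t)"
proof -
  have \<alpha>: "\<alpha> = Q + K - 2 * \<beta>" using \<beta> by simp
  have "(I t)\<^sup>2 = K * (y t)\<^sup>2 * ((1 - y t) * (Q - K * y t)) - (K * (y t)\<^sup>2 - \<beta> * y t)\<^sup>2"
    using RI[of t] R[of t] critical by simp
  also have "\<dots> = (y t)\<^sup>2 * (D - \<alpha> * K * y t)"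
    unfolding D_def \<alpha> by (simp add: power2_eq_square algebra_simps)
  finally show ?thesis .
qed

lemma critical_dI: "(I has_real_derivative 3 * \<alpha> * K * (y t)\<^sup>2 - 2 * D * y t) (at t)"
proof -
  have \<alpha>: "\<alpha> = Q + K - 2 * \<beta>" using \<beta> by simp
  have Rt: "R t = K * (y t)\<^sup>2 - \<beta> * y t" using R[of t] critical by simp
  have "R t * (4 * K * y t - 2 * \<beta>) + (Q - K * y t) * (K * (y t)\<^sup>2 - 2 * (K * y t) * (1 - y t))
      + K\<^sup>2 * (y t)\<^sup>2 * (1 - y t)
      = 3 * \<alpha> * K * (y t)\<^sup>2 - 2 * D * y t"
    unfolding Rt D_def \<alpha> by (simp add: power2_eq_square algebra_simps)
  then show ?thesis using dI[of t] by simp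
qed

text \<open>If \<open>\<delta> = 0\<close>, the powers of \<open>y\<close> in \<open>critical_energy\<close> are such that \<open>1 / y\<close> satisfies a linear equation
  of second order.\<close>

lemma inverse_derivative: "((\<lambda>t. 1 / y t) has_real_derivative 2 * I t / (y t)\<^sup>2) (at t)"
  using y(1)[of t] by (auto intro!: derivative_eq_intros dy simp: power2_eq_square)

lemma inverse_second_derivative:
  "((\<lambda>t. 2 * I t / (y t)\<^sup>2) has_real_derivative 4 * D * (1 / y t) - 2 * \<alpha> * K) (at t)"
proof -
  have nz: "y t \<noteq> 0" using y(1)[of t] by simp
  have "((\<lambda>t. 2 * I t / (y t)\<^sup>2) has_real_derivative
      (2 * (3 * \<alpha> * K * (y t)\<^sup>2 - 2 * D * y t) * (y t)\<^sup>2 - 2 * I t * (2 * y t * (- 2 * I t))) /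
          ((y t)\<^sup>2 * (y t)\<^sup>2)) (at t)"
    using nz by (auto intro!: derivative_eq_intros dy critical_dI)
  moreover have "(2 * (3 * \<alpha> * K * (y t)\<^sup>2 - 2 * D * y t) * (y t)\<^sup>2 - 2 * I t
      * (2 * y t * (- 2 * I t))) / ((y t)\<^sup>2 * (y t)\<^sup>2)
      = 4 * D * (1 / y t) - 2 * \<alpha> * K"
  proof -
    have "2 * (3 * \<alpha> * K * (y t)\<^sup>2 - 2 * D * y t) * (y t)\<^sup>2 - 2 * I t * (2 * y t * (- 2 * I t)) =
        2 * (3 * \<alpha> * K * (y t)\<^sup>2 - 2 * D * y t) * (y t)\<^sup>2 + 8 * y t * (I t)\<^sup>2"
      by (simp add: power2_eq_square)
    also have "\<dots> = (4 * D * y t - 2 * \<alpha> * K * (y t)\<^sup>2) * (y t)\<^sup>2"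
      unfolding critical_energy by (simp add: power2_eq_square algebra_simps)
    finally have e: "2 * (3 * \<alpha> * K * (y t)\<^sup>2 - 2 * D * y t) * (y t)\<^sup>2 - 2 * I t
        * (2 * y t * (- 2 * I t)) =
        (4 * D * y t - 2 * \<alpha> * K * (y t)\<^sup>2) * (y t)\<^sup>2" .
    show ?thesis unfolding e using nz by (simp add: field_simps power2_eq_square)
  qed
  ultimately show ?thesis by (simp only:)
qed

text \<open>If \<open>D\<close> were nonnegative, the second derivative of \<open>1 / y\<close> would be at least \<open>-2 \<alpha> K > 0\<close>, so its first
  derivative would have a zero, contrary to \<open>critical_energy\<close>. Hence \<open>D < 0\<close>, and \<open>D - \<alpha> K y \<ge> 0\<close> bounds
  \<open>y\<close> from below.\<close>

lemma critical_bounded_below: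
  assumes "\<alpha> < 0"
  obtains e where "e > 0" "\<And>t. e \<le> y t"
proof -
  have aK: "- \<alpha> * K > 0" using assms K by (intro mult_pos_pos) auto
  have "D < 0"
  proof (rule ccontr)
    assume "\<not> D < 0"
    then have D0: "D \<ge> 0" by simp
    have lower: "4 * D * (1 / y t) - 2 * \<alpha> * K \<ge> - 2 * \<alpha> * K" for t
      using D0 y(1)[of t] by simp
    have "- 2 * \<alpha> * K > 0" using aK by linarith
    from bounded_below_derivative_has_zero[OF inverse_second_derivative this lower]
    obtain t where "2 * I t / (y t)\<^sup>2 = 0" by blast
    then have "(I t)\<^sup>2 = 0" using y(1)[of t] by simp
    moreover have "(y t)\<^sup>2 * (D - \<alpha> * K * y t) > 0"
      using y(1)[of t] D0 mult_pos_pos[OF aK y(1)[of t]] by (intro mult_pos_pos) auto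
    ultimately show False unfolding critical_energy by linarith
  qed
  have le: "- D \<le> (- \<alpha> * K) * y t" for t
  proof -
    have "0 \<le> (y t)\<^sup>2 * (D - \<alpha> * K * y t)" unfolding critical_energy[symmetric] by simp
    then have "0 \<le> D - \<alpha> * K * y t" using y(1)[of t] by (simp add: zero_le_mult_iff)
    then show ?thesis by simp
  qed
  show ?thesis
  proof (rule that[of "- D / (- \<alpha> * K)"])
    show "0 < - D / (- \<alpha> * K)" by (rule divide_pos_pos) (use \<open>D < 0\<close> aK in auto)
    show "- D / (- \<alpha> * K) \<le> y t" for t
      unfolding pos_divide_le_eq[OF aK] using le[of t] by (simp only: mult.commute)
  qed
qed

text \<open>Here \<open>D \<ge> \<alpha> K y > 0\<close>, so \<open>hyperbolic_growth\<close> applies to \<open>1 / y\<close> with the rate \<open>2 sqrt D\<close>.\<close>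

lemma critical_growth:
  assumes "\<alpha> > 0"
  obtains k m M where "k > 0" "m > 0" "M > 0" "\<And>t. m * exp (k * \<bar>t\<bar>) \<le> 1 / y t"
      "\<And>t. 1 / y t \<le> M * exp (k * \<bar>t\<bar>)"
proof -
  have aK: "\<alpha> * K > 0" using assms K by simp
  have "0 \<le> (y 0)\<^sup>2 * (D - \<alpha> * K * y 0)" unfolding critical_energy[symmetric] by simp
  then have "0 \<le> D - \<alpha> * K * y 0" using y(1)[of 0] by (simp add: zero_le_mult_iff)
  then have D: "D > 0" using mult_pos_pos[OF aK y(1)[of 0]] by linarith
  define k where "k = 2 * sqrt D"
  define a where "a = \<alpha> * K / (2 * D)"
  have k: "k > 0" "k\<^sup>2 = 4 * D" using D by (auto simp: k_def power_mult_distrib)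
  have a: "a > 0" "4 * D * a = 2 * \<alpha> * K" using D aK by (auto simp: a_def)
  have d2: "((\<lambda>t. 2 * I t / (y t)\<^sup>2) has_real_derivative k\<^sup>2 * (1 / y t - a)) (at t)" for t
    using inverse_second_derivative[of t] unfolding k(2) right_diff_distrib a(2) .
  have en: "(2 * I 0 / (y 0)\<^sup>2)\<^sup>2 = k\<^sup>2 * ((1 / y 0)\<^sup>2 - 2 * a * (1 / y 0))"
  proof -
    have nz: "y 0 \<noteq> 0" using y(1)[of 0] by simp
    have "(2 * I 0 / (y 0)\<^sup>2)\<^sup>2 = 4 * (I 0)\<^sup>2 / ((y 0)\<^sup>2 * (y 0)\<^sup>2)"
        by (simp add: power_divide power_mult_distrib power2_eq_square)
    also have "\<dots> = 4 * (D - \<alpha> * K * y 0) / (y 0)\<^sup>2"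
    proof -
      have "4 * (Y * X) / (Y * Y) = 4 * X / Y" if "Y \<noteq> 0" for X Y :: real using that by simp
      from this[of "(y 0)\<^sup>2" "D - \<alpha> * K * y 0"] show ?thesis
        unfolding critical_energy using nz by (simp only: power_eq_0_iff simp_thms)
    qed
    also have "\<dots> = 4 * D * (1 / y 0)\<^sup>2 - 2 * (2 * \<alpha> * K) * (1 / y 0)"
      using nz by (simp add: field_simps power2_eq_square)
    also have "\<dots> = k\<^sup>2 * ((1 / y 0)\<^sup>2 - 2 * a * (1 / y 0))"
      unfolding k(2) a(2)[symmetric] by (simp add: algebra_simps)
    finally show ?thesis .
  qed
  obtain m M where "m > 0" "M > 0" "\<And>t. m * exp (k * \<bar>t\<bar>) \<le> 1 / y t"
      "\<And>t. 1 / y t \<le> M * exp (k * \<bar>t\<bar>)"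
  proof (rule hyperbolic_growth[OF k(1) a(1) inverse_derivative d2 en])
    show "1 / y t > 0" for t using y(1)[of t] by simp
  qed blast
  with k(1) show ?thesis by (rule that)
qed

end

end

text \<open>The derivative of \<open>W = c p\<^sup>* b\<^sup>*\<close> is \<open>\<i> (W r + r')\<close> with real \<open>r\<close> and \<open>r'\<close>, which are polynomials in
  \<open>|b|\<^sup>2\<close>, \<open>|c|\<^sup>2\<close> and \<open>|p|\<^sup>2\<close>, and these are affine or quadratic functions of \<open>y\<close>.\<close>

lemma profile_flow_dynamics:
  fixes b c p :: "real \<Rightarrow> complex"
  assumes K: "K > 0"
    and flow: "\<And>t. ((\<lambda>t. (b t, c t, p t)) has_vector_derivative profile_field \<alpha> K (b t, c t, p t))
        (at t)"
    and p1: "\<And>t. cmod (p t) < 1"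
    and cK: "\<And>t. (cmod (c t))\<^sup>2 = K * (1 - (cmod (p t))\<^sup>2)\<^sup>2"
    and bQ: "\<And>t. (cmod (b t))\<^sup>2 + K * (1 - (cmod (p t))\<^sup>2) = Q"
  defines "y \<equiv> \<lambda>t. 1 - (cmod (p t))\<^sup>2" and "W \<equiv> \<lambda>t. c t * cnj (p t) * cnj (b t)" and
      "\<beta> \<equiv> (Q + K - \<alpha>) / 2"
  shows "profile_dynamics \<alpha> K Q \<beta> (Re (W 0) + \<beta> * y 0 - K
      * (y 0)\<^sup>2) y (\<lambda>t. Re (W t)) (\<lambda>t. Im (W t))"
proof -
  let ?K = "complex_of_real K" and ?a = "complex_of_real \<alpha>"
  define n0 where "n0 t = b t * b t * cnj (b t) + 2 * b t * (?K * (1 - p t * cnj (p t))) + ?K * c t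
      * cnj (p t) + ?a * b t" for t
  define n1 where "n1 t = 2 * b t * cnj (b t) * c t + 2 * b t * (?K * (1 - p t * cnj (p t))) * p t
      + ?K * c t" for t
  define n2 where "n2 t = ?K * (1 - p t * cnj (p t)) * p t + cnj (b t) * c t" for t
  have field: "profile_field \<alpha> K (b t, c t, p t) = (- \<i> * n0 t, - \<i> * n1 t, - \<i> * n2 t)" for t
    by (simp add: profile_field_def n0_def n1_def n2_def)
  note db = has_vector_derivative_triple(1)[OF flow[unfolded field]]
    and dc = has_vector_derivative_triple(2)[OF flow[unfolded field]]
    and dp = has_vector_derivative_triple(3)[OF flow[unfolded field]]
  have yP: "1 - p t * cnj (p t) = of_real (y t)" for t
    unfolding y_def by (rule one_minus_mult_cnj)
  have y0: "0 < y t" "y t \<le> 1" for t using p1[of t] by (simp_all add: y_def abs_square_less_1)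
  have b2: "(cmod (b t))\<^sup>2 = Q - K * y t" for t using bQ[of t] by (simp add: y_def)
  have c2: "(cmod (c t))\<^sup>2 = K * (y t)\<^sup>2" for t using cK[of t] by (simp add: y_def)
  have p2: "(cmod (p t))\<^sup>2 = 1 - y t" for t by (simp add: y_def)
  have dy: "(y has_real_derivative - 2 * Im (W t)) (at t)" for t
  proof -
    have "((\<lambda>t. p t * cnj (p t)) has_vector_derivative p t * cnj (- \<i> * n2 t) + (- \<i> * n2 t)
        * cnj (p t)) (at t)"
      by (rule has_vector_derivative_mult[OF dp[of t] has_vector_derivative_cnj[OF dp[of t]]])
    from bounded_linear.has_vector_derivative[OF bounded_linear_Re
        has_vector_derivative_diff[OF has_vector_derivative_const[of 1] this]]
    have "((\<lambda>t. Re (1 - p t * cnj (p t)))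
        has_vector_derivative Re (0 - (p t * cnj (- \<i> * n2 t) + (- \<i> * n2 t) * cnj (p t))))
        (at t)" .
    moreover have "Re (1 - p s * cnj (p s)) = y s" for s unfolding yP by simp
    moreover have "0 - (p t * cnj (- \<i> * n2 t) + (- \<i> * n2 t) * cnj (p t)) = \<i> * (W t - cnj (W t))"
      unfolding n2_def W_def by (simp add: algebra_simps)
    moreover have "Re (\<i> * (W t - cnj (W t))) = - 2 * Im (W t)" by simp
    ultimately show ?thesis by (simp only: has_real_derivative_iff_has_vector_derivative)
  qed
  define R1 where "R1 t = 4 * K * y t - 2 * \<beta>" for t
  define R2 where "R2 t = (Q - K * y t) * (K * (y t)\<^sup>2 - 2 * (K * y t) * (1 - y t)) + K\<^sup>2 * (y t)\<^sup>2
      * (1 - y t)" for t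
  have dW: "(W has_vector_derivative \<i> * (W t * of_real (R1 t) + of_real (R2 t))) (at t)" for t
  proof -
    define B C X where "B = b t * cnj (b t)" and "C = c t * cnj (c t)" and "X = p t * cnj (p t)"
    have BCX: "B = of_real (Q - K * y t)" "C = of_real (K * (y t)\<^sup>2)" "X = of_real (1 - y t)"
      unfolding B_def C_def X_def complex_norm_square[symmetric] b2 c2 p2 by simp_all
    have "(W has_vector_derivative c t * cnj (p t) * cnj (- \<i> * n0 t)
        + (c t * cnj (- \<i> * n2 t) + - \<i> * n1 t * cnj (p t)) * cnj (b t)) (at t)"
      unfolding W_def
      by (rule has_vector_derivative_mult[OF
          has_vector_derivative_mult[OF dc has_vector_derivative_cnj[OF dp]]
          has_vector_derivative_cnj[OF db]])
    moreover have "c t * cnj (p t) * cnj (- \<i> * n0 t)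
        + (c t * cnj (- \<i> * n2 t) + - \<i> * n1 t * cnj (p t)) * cnj (b t) =
        \<i> * (W t * (3 * (?K * (1 - X)) - B - ?K + ?a)
            + (B * C - 2 * (?K * (1 - X)) * B * X + ?K * C * X))"
      unfolding n0_def n1_def n2_def W_def B_def C_def X_def by (simp add: algebra_simps)
    moreover have "3 * (?K * (1 - X)) - B - ?K + ?a = of_real (R1 t)"
    proof -
      have "2 * \<beta> = Q + K - \<alpha>" by (simp add: \<beta>_def)
      then have R1_eq: "R1 t = 4 * K * y t - (Q + K - \<alpha>)" by (simp add: R1_def)
      show ?thesis unfolding BCX R1_eq by (simp add: algebra_simps)
    qed
    moreover have "B * C - 2 * (?K * (1 - X)) * B * X + ?K * C * X = of_real (R2 t)"
      unfolding BCX R2_def by (simp add: power2_eq_square algebra_simps)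
    ultimately show ?thesis by simp
  qed
  have dRe: "((\<lambda>t. Re (W t)) has_real_derivative - R1 t * Im (W t)) (at t)" for t
    using bounded_linear.has_vector_derivative[OF bounded_linear_Re dW[of t]]
    by (simp add: has_real_derivative_iff_has_vector_derivative mult.commute)
  have dIm: "((\<lambda>t. Im (W t)) has_real_derivative Re (W t) * R1 t + R2 t) (at t)" for t
    using bounded_linear.has_vector_derivative[OF bounded_linear_Im dW[of t]]
    by (simp add: has_real_derivative_iff_has_vector_derivative)
  have "((\<lambda>t. Re (W t) + \<beta> * y t - K * (y t)\<^sup>2) has_real_derivative 0) (at t)" for t
  proof -
    have "((\<lambda>t. Re (W t) + \<beta> * y t - K * (y t)\<^sup>2) has_real_derivative
        (- R1 t * Im (W t) + \<beta> * (- 2 * Im (W t)) - K * (2 * y t * (- 2 * Im (W t))))) (at t)"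
    proof -
      have "((\<lambda>t. A t + \<beta> * y t - K * (y t)\<^sup>2) has_real_derivative
        (A' + \<beta> * (- 2 * Im (W t)) - K * (2 * y t * (- 2 * Im (W t))))) (at t)"
        if "(A has_real_derivative A') (at t)" for A A'
        using that by (auto intro!: derivative_eq_intros dy)
      from this[OF dRe] show ?thesis .
    qed
    moreover have "- R1 t * Im (W t) + \<beta> * (- 2 * Im (W t)) - K * (2 * y t * (- 2 * Im (W t))) = 0"
      by (simp add: R1_def algebra_simps)
    ultimately show ?thesis by simp
  qed
  note const = has_real_derivative_zero_eq[of "\<lambda>t. Re (W t) + \<beta> * y t - K * (y t)\<^sup>2", OF this]
  show ?thesis
  proof
    show "0 < K" by (rule K)
    show "0 < y t" "y t \<le> 1" for t by (rule y0)+
    show "2 * \<beta> = Q + K - \<alpha>" by (simp add: \<beta>_def)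
    show "(y has_real_derivative - 2 * Im (W t)) (at t)" for t by (rule dy)
    show "((\<lambda>t. Im (W t)) has_real_derivative Re (W t) * (4 * K * y t - 2 * \<beta>) +
        (Q - K * y t) * (K * (y t)\<^sup>2 - 2 * (K * y t) * (1 - y t)) + K\<^sup>2 * (y t)\<^sup>2 * (1 - y t))
            (at t)" for t
      using dIm[of t] unfolding R1_def R2_def by (simp only: add.assoc)
    show "Re (W t) = Re (W 0) + \<beta> * y 0 - K * (y 0)\<^sup>2 - \<beta> * y t + K * (y t)\<^sup>2" for t
      using const[of t] by linarith
    show "(Re (W t))\<^sup>2 + (Im (W t))\<^sup>2 = K * (y t)\<^sup>2 * ((1 - y t) * (Q - K * y t))" for t
    proof -
      have "(Re (W t))\<^sup>2 + (Im (W t))\<^sup>2 = (cmod (W t))\<^sup>2" by (rule cmod_power2[symmetric])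
      also have "\<dots> = (cmod (c t))\<^sup>2 * (cmod (p t))\<^sup>2 * (cmod (b t))\<^sup>2"
        by (simp add: W_def norm_mult power_mult_distrib)
      finally show ?thesis unfolding b2 c2 p2 by simp
    qed
    show "K * y t \<le> Q" for t using b2[of t] zero_le_power2[of "cmod (b t)"] by linarith
  qed
qed

section \<open>Mass and energy of rational profiles\<close>

lemma rational_profile_L2_plus: "cmod p < 1 \<Longrightarrow> rational_profile b c p \<in> L2_plus"
  by (simp add: L2_plus_def L2_rational_profile fourier_coeff_rational_profile)

lemma rational_profile_inner_right:
  assumes p: "cmod p < 1" and f: "f \<in> L2_circle"
  shows "circle_inner f (rational_profile b c p) = cnj b * circle_inner f (\<lambda>_. 1) + cnj c
      * circle_inner f (pole_profile p)"
proof -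
  have "rational_profile b c p = (\<lambda>z. b * 1 + c * pole_profile p z)" by (rule ext)
      (simp add: rational_profile_def)
  then have "circle_inner f (rational_profile b c p)
      = circle_inner f (\<lambda>z. b * 1 + c * pole_profile p z)" by simp
  also have "\<dots> = circle_inner f (\<lambda>z. b * 1) + circle_inner f (\<lambda>z. c * pole_profile p z)"
    by (rule circle_inner_add_right[OF L2_const L2_cmult[OF L2_pole_profile[OF p]] f])
  also have "circle_inner f (\<lambda>z. b * 1) = cnj b * circle_inner f (\<lambda>_. 1)"
    by (rule circle_inner_cmult_right[of f b "\<lambda>_. 1"])
  also have "circle_inner f (\<lambda>z. c * pole_profile p z) = cnj c * circle_inner f (pole_profile p)"
    by (rule circle_inner_cmult_right)
  finally show ?thesis .
qed

lemma circle_inner_one_right: "circle_inner f (\<lambda>_. 1) = fourier_coeff f 0"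
  by (simp add: fourier_coeff_def)

lemma circle_inner_one_left: assumes "f \<in> L2_circle" shows
    "circle_inner (\<lambda>_. 1) f = cnj (fourier_coeff f 0)"
  unfolding circle_inner_one_right[symmetric] circle_inner_cnj ..

lemma rational_profile_mass:
  assumes p: "cmod p < 1" and K: "c * cnj c = K * (1 - p * cnj p)\<^sup>2"
  shows "circle_inner (rational_profile b c p) (rational_profile b c p) = b * cnj b + K
      * (1 - p * cnj p)"
proof -
  note q = L2_pole_profile[OF p]
  have s: "1 - p * cnj p \<noteq> 0" by (rule one_minus_mult_cnj_nonzero[OF p])
  have "circle_inner (rational_profile b c p) (pole_profile p) = c
      * circle_inner (pole_profile p) (pole_profile p)"
    unfolding rational_profile_def[abs_def] circle_inner_add_left[OF L2_const L2_cmult[OF q] q]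
        circle_inner_cmult_left
    using circle_inner_cmult_left[of b "\<lambda>_. 1" "pole_profile p"]
    by (simp add: circle_inner_one_left[OF q] fourier_coeff_pole_profile[OF p])
  then have "circle_inner (rational_profile b c p) (rational_profile b c p) = cnj b * b
      + (c * cnj c) * (1 / (1 - p * cnj p))"
    unfolding rational_profile_inner_right[OF p L2_rational_profile[OF p]]
        circle_inner_pole_profile(1)[OF p]
    by (simp add: circle_inner_one_right fourier_coeff_rational_profile[OF p])
  then show ?thesis unfolding K using s by (simp add: power2_eq_square mult.commute)
qed

text \<open>Only the part in \<open>L\<^sup>2\<^sub>+\<close> of the cubic term matters, by \<open>cnj_pole_profile_orthogonal\<close>; its inner product
  with \<open>b + c q\<close> reduces to those of \<open>1\<close>, \<open>q\<close> and \<open>q\<^sup>2\<close> with \<open>1\<close> and \<open>q\<close>.\<close>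

lemma rational_profile_quartic:
  fixes b c p K :: complex
  assumes p: "cmod p < 1" and K: "c * cnj c = K * (1 - p * cnj p)\<^sup>2"
  defines "v \<equiv> rational_profile b c p" and "s \<equiv> 1 - p * cnj p" and "W \<equiv> c * cnj p * cnj b"
  shows "circle_inner (\<lambda>z. of_real ((cmod (v z))\<^sup>2) * v z) v =
    (b * cnj b)\<^sup>2 + 4 * (b * cnj b) * (K * s) + 2 * K * (W + cnj W) + K\<^sup>2 * s * (2 - s)"
proof -
  let ?q = "pole_profile p"
  note q = L2_pole_profile[OF p]
  have cq: "continuous_on (sphere 0 1) ?q" by (rule continuous_on_pole_profile[OF p])
  have q2: "(\<lambda>z. (?q z)\<^sup>2) \<in> L2_circle" by (intro L2_continuous continuous_intros cq)
  have s0: "s \<noteq> 0" unfolding s_def by (rule one_minus_mult_cnj_nonzero[OF p])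
  have v2: "v \<in> L2_circle" unfolding v_def by (rule L2_rational_profile[OF p])
  have vc: "continuous_on (sphere 0 1) v" unfolding v_def
      by (rule continuous_on_rational_profile[OF p])
  define n0 n1 n2 r where "n0 = b * b * cnj b + 2 * b * (K * s) + K * c * cnj p"
    and "n1 = 2 * b * cnj b * c + 2 * b * (K * s) * p + K * c"
    and "n2 = (K * s) * c * p + cnj b * c * c"
    and "r = b * b * cnj c + 2 * b * (K * s) * cnj p + K * c * cnj p * cnj p"
  have L0: "(\<lambda>z. n0 + n1 * ?q z) \<in> L2_circle" by (rule L2_add[OF L2_const L2_cmult[OF q]])
  have L1: "(\<lambda>z. n0 + n1 * ?q z + n2 * (?q z)\<^sup>2) \<in> L2_circle"
      by (rule L2_add[OF L0 L2_cmult[OF q2]])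
  have L2: "(\<lambda>z. r * cnj (?q z)) \<in> L2_circle" by (rule L2_cmult[OF L2_cnj[OF q]])
  have F2: "(\<lambda>z. of_real ((cmod (v z))\<^sup>2) * v z) \<in> L2_circle"
      by (intro L2_continuous continuous_intros vc)
  have one: "circle_inner (\<lambda>z. n0 + n1 * ?q z + n2 * (?q z)\<^sup>2) (\<lambda>_. 1) = n0"
    unfolding circle_inner_one_right fourier_coeff_add[OF L0 L2_cmult[OF q2]]
        fourier_coeff_add[OF L2_const L2_cmult[OF q]]
      fourier_coeff_cmult
    by (simp add: fourier_coeff_const fourier_coeff_pole_profile[OF p]
        fourier_coeff_pole_profile_sq[OF p])
  have two: "circle_inner (\<lambda>z. n0 + n1 * ?q z + n2 * (?q z)\<^sup>2) ?q = n1 / s + n2 * (cnj p / s\<^sup>2)"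
    unfolding circle_inner_add_left[OF L0 L2_cmult[OF q2] q]
        circle_inner_add_left[OF L2_const L2_cmult[OF q] q]
      circle_inner_cmult_left circle_inner_pole_profile[OF p] s_def[symmetric]
    using circle_inner_cmult_left[of n0 "\<lambda>_. 1" ?q]
    by (simp add: circle_inner_one_left[OF q] fourier_coeff_pole_profile[OF p])
  have "circle_inner (\<lambda>z. of_real ((cmod (v z))\<^sup>2) * v z) v
      = circle_inner (\<lambda>z. (n0 + n1 * ?q z + n2 * (?q z)\<^sup>2) + r * cnj (?q z)) v"
  proof (rule AE_circle_cong_inner[OF _ refl F2 v2 L2_add[OF L1 L2] v2])
    fix z :: complex assume z: "cmod z = 1"
    have "of_real ((cmod (v z))\<^sup>2) * v z = v z * cnj (v z) * v z"
        by (simp only: complex_norm_square)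
    also have "\<dots> = (n0 + n1 * ?q z + n2 * (?q z)\<^sup>2) + r * cnj (?q z)"
      unfolding v_def rational_profile_cubic[OF p z K] n0_def n1_def n2_def r_def s_def ..
    finally show "of_real ((cmod (v z))\<^sup>2) * v z = (n0 + n1 * ?q z + n2 * (?q z)\<^sup>2) + r
        * cnj (?q z)" .
  qed
  also have "\<dots> = circle_inner (\<lambda>z. n0 + n1 * ?q z + n2 * (?q z)\<^sup>2) v"
    unfolding circle_inner_add_left[OF L1 L2 v2] circle_inner_cmult_left
    using cnj_pole_profile_orthogonal[OF p rational_profile_L2_plus[OF p, of b c]]
        by (simp add: v_def)
  also have "\<dots> = cnj b * n0 + cnj c * (n1 / s + n2 * (cnj p / s\<^sup>2))"
    unfolding v_def rational_profile_inner_right[OF p L1] one two ..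
  also have "\<dots> = cnj b * n0 + (cnj c * n1) / s + (cnj c * n2 * cnj p) / s\<^sup>2"
      by (simp add: distrib_left)
  also have "cnj c * n1 = s * (2 * (b * cnj b) * (K * s) + 2 * K * cnj W + K\<^sup>2 * s)"
  proof -
    have "cnj c * n1 = 2 * (b * cnj b) * (c * cnj c) + 2 * (K * s) * cnj W + K * (c * cnj c)"
      unfolding n1_def W_def by (simp add: algebra_simps)
    then show ?thesis unfolding K s_def[symmetric] by (simp add: power2_eq_square algebra_simps)
  qed
  also have "s * (2 * (b * cnj b) * (K * s) + 2 * K * cnj W + K\<^sup>2 * s) / s = 2 * (b * cnj b)
      * (K * s) + 2 * K * cnj W + K\<^sup>2 * s"
    using s0 by simp
  also have "cnj c * n2 * cnj p = s\<^sup>2 * (K\<^sup>2 * s * (1 - s) + K * W)"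
  proof -
    have "cnj c * n2 * cnj p = (c * cnj c) * (K * s * (p * cnj p) + W)"
      unfolding n2_def W_def by (simp add: algebra_simps)
    also have "p * cnj p = 1 - s" by (simp add: s_def)
    finally show ?thesis unfolding K s_def[symmetric] by (simp add: power2_eq_square algebra_simps)
  qed
  also have "s\<^sup>2 * (K\<^sup>2 * s * (1 - s) + K * W) / s\<^sup>2 = K\<^sup>2 * s * (1 - s) + K * W" using s0 by simp
  also have "cnj b * n0 = (b * cnj b)\<^sup>2 + 2 * (b * cnj b) * (K * s) + K * W"
    unfolding n0_def W_def by (simp add: power2_eq_square algebra_simps)
  finally show ?thesis by (simp add: power2_eq_square algebra_simps)
qed

text \<open>The two sides of the condition on energy and mass differ by \<open>K \<delta>\<close>, with the constant of motion \<open>\<delta>\<close> of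
  the locale \<open>profile_dynamics\<close>.\<close>

lemma energy_mass_condition:
  assumes u: "u \<in> L2_circle" and ae: "AE z in circle_measure. u z = rational_profile b c p z"
    and p: "cmod p < 1" and c: "(cmod c)\<^sup>2 = K * (1 - (cmod p)\<^sup>2)\<^sup>2" and K: "K > 0"
    and Q: "Q = (cmod b)\<^sup>2 + K * (1 - (cmod p)\<^sup>2)"
  shows "szego_energy \<alpha> u = 1/4 * (szego_mass u)\<^sup>2 + \<alpha> / 2 * szego_mass u \<longleftrightarrow>
    Re (c * cnj p * cnj b) + (Q + K - \<alpha>) / 2 * (1 - (cmod p)\<^sup>2) - K * (1 - (cmod p)\<^sup>2)\<^sup>2 = 0"
proof -
  define v where "v = rational_profile b c p"
  define y where "y = 1 - (cmod p)\<^sup>2"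
  define W where "W = c * cnj p * cnj b"
  have yP: "1 - p * cnj p = of_real y" unfolding y_def by (rule one_minus_mult_cnj)
  have v2: "v \<in> L2_circle" unfolding v_def by (rule L2_rational_profile[OF p])
  have vc: "continuous_on (sphere 0 1) v" unfolding v_def
      by (rule continuous_on_rational_profile[OF p])
  have cc: "c * cnj c = of_real K * (1 - p * cnj p)\<^sup>2"
  proof -
    have "complex_of_real ((cmod c)\<^sup>2) = of_real (K * y\<^sup>2)" using c by (simp only: y_def)
    then show ?thesis unfolding yP
        by (simp only: of_real_mult of_real_power[of y] complex_norm_square)
  qed
  have bb: "b * cnj b = of_real ((cmod b)\<^sup>2)" by (rule complex_norm_square[symmetric])
  have ae': "AE z in circle_measure. u z = v z" using ae unfolding v_def .
  have [measurable]: "u \<in> borel_measurable circle_measure" "v \<in> borel_measurable circle_measure"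
    by (rule L2_measurable[OF u], rule L2_measurable[OF v2])
  have "szego_mass u = (\<integral>z. (cmod (v z))\<^sup>2 \<partial>circle_measure)"
    unfolding szego_mass_def circle_mean_integral
  proof (rule integral_cong_AE)
    show "AE z in circle_measure. (cmod (u z))\<^sup>2 = (cmod (v z))\<^sup>2" using ae' by eventually_elim simp
  qed measurable
  also have "\<dots> = Q"
  proof -
    have "complex_of_real (\<integral>z. (cmod (v z))\<^sup>2 \<partial>circle_measure) = of_real Q"
      unfolding L2_circle_norm_sq[symmetric] circle_inner_self[symmetric] unfolding v_def
          rational_profile_mass[OF p cc] bb yP
      unfolding Q y_def[symmetric] by simp
    then show ?thesis using of_real_eq_iff by blast
  qed
  finally have mass: "szego_mass u = Q" .
  have "circle_mean (\<lambda>z. (cmod (u z)) ^ 4) = (\<integral>z. (cmod (v z)) ^ 4 \<partial>circle_measure)"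
    unfolding circle_mean_integral
  proof (rule integral_cong_AE)
    show "AE z in circle_measure. (cmod (u z)) ^ 4 = (cmod (v z)) ^ 4" using ae' by eventually_elim
        simp
  qed measurable
  also have "\<dots> = ((cmod b)\<^sup>2)\<^sup>2 + 4 * (cmod b)\<^sup>2 * (K * y) + 4 * K * Re W + K\<^sup>2 * y * (2 - y)"
  proof -
    have "complex_of_real (\<integral>z. (cmod (v z)) ^ 4 \<partial>circle_measure)
        = circle_inner (\<lambda>z. of_real ((cmod (v z))\<^sup>2) * v z) v"
    proof -
      have "of_real ((cmod (v z))\<^sup>2) * v z * cnj (v z) = complex_of_real ((cmod (v z)) ^ 4)" for z
      proof -
        have "(cmod (v z)) ^ 4 = (cmod (v z))\<^sup>2 * (cmod (v z))\<^sup>2"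
            by (simp add: power_add[symmetric])
        then show ?thesis by (simp only: of_real_mult complex_norm_square mult.assoc)
      qed
      then show ?thesis unfolding circle_inner_integral by (simp only: integral_complex_of_real)
    qed
    also have "\<dots> = of_real (((cmod b)\<^sup>2)\<^sup>2 + 4 * (cmod b)\<^sup>2 * (K * y) + 4 * K * Re W + K\<^sup>2 * y
        * (2 - y))"
      unfolding v_def rational_profile_quartic[OF p cc] W_def[symmetric] bb yP complex_add_cnj
          by simp
    finally show ?thesis using of_real_eq_iff by blast
  qed
  finally have quartic: "circle_mean (\<lambda>z. (cmod (u z)) ^ 4) = ((cmod b)\<^sup>2)\<^sup>2 + 4 * (cmod b)\<^sup>2
      * (K * y) + 4 * K * Re W + K\<^sup>2 * y * (2 - y)" .
  have "circle_inner u (\<lambda>_. 1) = b"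
    unfolding circle_inner_one_right fourier_coeff_cong[OF u v2 ae'] unfolding v_def
        fourier_coeff_rational_profile[OF p] by simp
  then have energy: "szego_energy \<alpha> u = 1/4
      * (((cmod b)\<^sup>2)\<^sup>2 + 4 * (cmod b)\<^sup>2 * (K * y) + 4 * K * Re W + K\<^sup>2 * y * (2 - y)) + 1/2 * \<alpha> *
      (cmod b)\<^sup>2"
    unfolding szego_energy_def quartic by simp
  have b2: "(cmod b)\<^sup>2 = Q - K * y" unfolding Q y_def by simp
  have "szego_energy \<alpha> u - (1/4 * (szego_mass u)\<^sup>2 + \<alpha> / 2 * szego_mass u) =
      K * (Re W + (Q + K - \<alpha>) / 2 * y - K * y\<^sup>2)"
    unfolding energy mass b2 by (simp add: power2_eq_square field_simps)
  then show ?thesis using K unfolding W_def y_def by auto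
qed

section \<open>Boundedness and growth\<close>

lemma Hs_bounded_of_pole_distance:
  assumes u: "\<And>t::real. u t \<in> L2_circle"
    and ae: "\<And>t. AE z in circle_measure. u t z = rational_profile (b t) (c t) (p t) z"
    and p: "\<And>t. cmod (p t) < 1" and c: "\<And>t. (cmod (c t))\<^sup>2 = K * (1 - (cmod (p t))\<^sup>2)\<^sup>2" and K:
        "K \<ge> 0"
    and Q: "\<And>t. (cmod (b t))\<^sup>2 \<le> Q" and e: "e > 0" "\<And>t. e \<le> 1 - (cmod (p t))\<^sup>2" and s: "s \<ge> 0"
  shows "\<exists>C. \<forall>t. u t \<in> Hs_circle s \<and> Hs_norm s (u t) \<le> C"
proof (intro exI allI)
  fix t
  define y where "y = 1 - (cmod (p t))\<^sup>2"
  \<comment> \<open>The bounds by powers of \<open>y\<close> need a positive index; \<open>s + 1\<close> includes the case \<open>s = 0\<close>.\<close>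
  have s1: "s + 1 > 0" using s by simp
  have C0: "0 \<le> weighted_geometric_const (s + 1)" by (simp add: weighted_geometric_const_def)
  have "(Hs_norm (s + 1) (u t))\<^sup>2 \<le> (cmod (b t))\<^sup>2 + K * weighted_geometric_const (s + 1)
      * y powr (1 - 2 * (s + 1))"
    by (rule rational_profile_Hs_bounds(1)[OF u ae p s1 _ K y_def]) (simp add: y_def c)
  also have "\<dots> \<le> Q + K * weighted_geometric_const (s + 1) * e powr (1 - 2 * (s + 1))"
    using e s K C0 by (intro add_mono Q mult_left_mono powr_mono2') (auto simp: y_def)
  finally have "Hs_norm (s + 1) (u t)
      \<le> sqrt (Q + K * weighted_geometric_const (s + 1) * e powr (1 - 2 * (s + 1)))"
    by (rule real_le_rsqrt)
  moreover have "u t \<in> Hs_circle s \<and> Hs_norm s (u t) \<le> Hs_norm (s + 1) (u t)"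
    by (rule Hs_circle_mono[OF rational_profile_Hs_norm(1)[OF u ae p s1]]) simp
  ultimately show "u t \<in> Hs_circle s \<and> Hs_norm s (u t)
      \<le> sqrt (Q + K * weighted_geometric_const (s + 1) * e powr (1 - 2 * (s + 1)))"
    by linarith
qed

text \<open>The squared norm is equivalent to \<open>y\<^sup>1\<^sup>-\<^sup>2\<^sup>s\<close>, hence to \<open>exp (k (2 s - 1) |t|)\<close>. The summand
  \<open>|b|\<^sup>2\<close> is bounded and can be absorbed because \<open>1 / y \<ge> 1\<close>.\<close>

lemma Hs_growth_of_pole_distance:
  assumes u: "\<And>t::real. u t \<in> L2_circle"
    and ae: "\<And>t. AE z in circle_measure. u t z = rational_profile (b t) (c t) (p t) z"
    and p: "\<And>t. cmod (p t) < 1" and c: "\<And>t. (cmod (c t))\<^sup>2 = K * (1 - (cmod (p t))\<^sup>2)\<^sup>2" and K: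
        "K > 0"
    and Q: "\<And>t. (cmod (b t))\<^sup>2 \<le> Q" and k: "k > 0" and m: "m > 0" and M: "M > 0"
    and lower: "\<And>t. m * exp (k * \<bar>t\<bar>) \<le> 1 / (1 - (cmod (p t))\<^sup>2)"
    and upper: "\<And>t. 1 / (1 - (cmod (p t))\<^sup>2) \<le> M * exp (k * \<bar>t\<bar>)"
  shows "exponential_sobolev_growth u"
  unfolding exponential_sobolev_growth_def
proof (intro allI impI)
  fix s :: real assume s: "s > 1/2"
  then have s0: "s > 0" and r: "2 * s - 1 > 0" by simp_all
  define r where "r = 2 * s - 1"
  define y where "y t = 1 - (cmod (p t))\<^sup>2" for t
  have y: "0 < y t" "y t \<le> 1" for t using p[of t] by (simp_all add: y_def abs_square_less_1)
  have r0: "r > 0" using r by (simp add: r_def)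
  have C0: "0 \<le> weighted_geometric_const s" by (simp add: weighted_geometric_const_def)
  have Q0: "0 \<le> Q" using order_trans[OF zero_le_power2 Q] .
  have yr: "y t powr (1 - 2 * s) = (1 / y t) powr r" for t
    using y[of t] powr_minus_divide[of "y t" r] by (simp add: r_def powr_divide)
  have E: "(A * exp (k * \<bar>t\<bar>)) powr r = A powr r * (exp (k * r / 2 * \<bar>t\<bar>))\<^sup>2" if "A > 0" for A t
  proof -
    have "(A * exp (k * \<bar>t\<bar>)) powr r = A powr r * exp (k * \<bar>t\<bar>) powr r" using that
        by (simp add: powr_mult)
    also have "exp (k * \<bar>t\<bar>) powr r = (exp (k * r / 2 * \<bar>t\<bar>))\<^sup>2"
      by (simp add: powr_def power2_eq_square exp_add[symmetric])
    finally show ?thesis .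
  qed
  have up: "(Hs_norm s (u t))\<^sup>2 \<le> (Q + K * weighted_geometric_const s) * M powr r
      * (exp (k * r / 2 * \<bar>t\<bar>))\<^sup>2" for t
  proof -
    have "1 \<le> (1 / y t) powr r" using y[of t] r0 by (intro ge_one_powr_ge_zero) auto
    then have "Q * 1 \<le> Q * (1 / y t) powr r" by (intro mult_left_mono Q0)
    moreover have "(Hs_norm s (u t))\<^sup>2 \<le> (cmod (b t))\<^sup>2 + K * weighted_geometric_const s
        * y t powr (1 - 2 * s)"
      by (rule rational_profile_Hs_bounds(1)[OF u ae p s0 _ less_imp_le[OF K] y_def])
          (simp add: y_def c)
    ultimately have "(Hs_norm s (u t))\<^sup>2 \<le> (Q + K * weighted_geometric_const s) * (1 / y t) powr r"
      using Q[of t] unfolding yr distrib_right by linarith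
    also have "\<dots> \<le> (Q + K * weighted_geometric_const s) * (M * exp (k * \<bar>t\<bar>)) powr r"
      using upper[of t] y[of t] r0 Q0 K C0 by (intro mult_left_mono powr_mono2) (auto simp: y_def)
    finally show ?thesis unfolding E[OF M] by (simp add: mult.assoc)
  qed
  have lo: "K * exp (-8) * m powr r * (exp (k * r / 2 * \<bar>t\<bar>))\<^sup>2 \<le> (Hs_norm s (u t))\<^sup>2" if t:
      "\<bar>t\<bar> \<ge> 2 / (m * k)" for t
  proof -
    have "2 \<le> m * (k * \<bar>t\<bar>)" using t m k by (simp add: pos_divide_le_eq mult_ac)
    also have "\<dots> \<le> m * exp (k * \<bar>t\<bar>)" using exp_ge_add_one_self[of "k * \<bar>t\<bar>"] m
        by (intro mult_left_mono) linarith+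
    also have "\<dots> \<le> 1 / y t" using lower[of t] by (simp add: y_def)
    finally have y2: "y t \<le> 1/2" using y(1)[of t] by (simp add: pos_le_divide_eq)
    have "(m * exp (k * \<bar>t\<bar>)) powr r \<le> (1 / y t) powr r"
      using lower[of t] m r0 by (intro powr_mono2) (auto simp: y_def)
    then have "K * exp (-8) * (m * exp (k * \<bar>t\<bar>)) powr r \<le> K * exp (-8) * y t powr (1 - 2 * s)"
      unfolding yr using K by (intro mult_left_mono) auto
    also have "\<dots> \<le> (Hs_norm s (u t))\<^sup>2"
      by (rule rational_profile_Hs_bounds(2)[OF u ae p s0 _ less_imp_le[OF K] y_def y2])
          (simp add: y_def c)
    finally show ?thesis unfolding E[OF m] by (simp add: mult.assoc)
  qed
  show "\<exists>C>0. (\<lambda>t. Hs_norm s (u t)) \<in> \<Theta>[at_infinity](\<lambda>t. exp (C * \<bar>t\<bar>))"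
  proof (intro exI[of _ "k * r / 2"] conjI bigthetaI)
    show "k * r / 2 > 0" using k r0 by simp
    show "(\<lambda>t. Hs_norm s (u t)) \<in> O[at_infinity](\<lambda>t. exp (k * r / 2 * \<bar>t\<bar>))"
    proof (rule bigoI[of _ "sqrt ((Q + K * weighted_geometric_const s)
        * M powr r)"], rule always_eventually, rule allI)
      fix t
      have "Hs_norm s (u t) \<le> sqrt ((Q + K * weighted_geometric_const s) * M powr r
          * (exp (k * r / 2 * \<bar>t\<bar>))\<^sup>2)"
        by (rule real_le_rsqrt[OF up])
      then show "norm (Hs_norm s (u t)) \<le> sqrt ((Q + K * weighted_geometric_const s) * M powr r)
          * norm (exp (k * r / 2 * \<bar>t\<bar>))"
        by (simp only: real_sqrt_mult real_sqrt_abs real_norm_def abs_of_nonneg[OF Hs_norm_nonneg])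
    qed
    show "(\<lambda>t. Hs_norm s (u t)) \<in> \<Omega>[at_infinity](\<lambda>t. exp (k * r / 2 * \<bar>t\<bar>))"
    proof (rule landau_omega.bigI[of "sqrt (K * exp (-8) * m powr r)"])
      show "sqrt (K * exp (-8) * m powr r) > 0" using K m by simp
      show "\<forall>\<^sub>F t in at_infinity. norm (Hs_norm s (u t)) \<ge> sqrt (K * exp (-8) * m powr r)
          * norm (exp (k * r / 2 * \<bar>t\<bar>))"
        unfolding eventually_at_infinity
      proof (intro exI[of _ "2 / (m * k)"] allI impI)
        fix t :: real assume "2 / (m * k) \<le> norm t"
        then have "sqrt (K * exp (-8) * m powr r * (exp (k * r / 2 * \<bar>t\<bar>))\<^sup>2) \<le> Hs_norm s (u t)"
          by (intro real_le_lsqrt lo Hs_norm_nonneg) auto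
        then show "norm (Hs_norm s (u t)) \<ge> sqrt (K * exp (-8) * m powr r)
            * norm (exp (k * r / 2 * \<bar>t\<bar>))"
          by (simp only: real_sqrt_mult real_sqrt_abs real_norm_def
              abs_of_nonneg[OF Hs_norm_nonneg])
      qed
    qed
  qed
qed

lemma bounded_not_exponential_growth:
  assumes "\<And>t. Hs_norm 1 (u t) \<le> B"
  shows "\<not> exponential_sobolev_growth u"
proof
  assume "exponential_sobolev_growth u"
  then obtain C where C: "C > 0" "(\<lambda>t. Hs_norm 1 (u t)) \<in> \<Theta>[at_infinity](\<lambda>t. exp (C * \<bar>t\<bar>))"
    unfolding exponential_sobolev_growth_def
        by (metis one_less_numeral_iff divide_less_eq_1_pos semiring_norm(76) zero_less_numeral)
  then have "(\<lambda>t. exp (C * \<bar>t\<bar>)) \<in> O[at_infinity](\<lambda>t. Hs_norm 1 (u t))"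
    by (simp add: bigtheta_def bigomega_iff_bigo)
  then obtain a where a: "a > 0"
      "\<forall>\<^sub>F t in at_infinity. norm (exp (C * \<bar>t\<bar>)) \<le> a * norm (Hs_norm 1 (u t))"
    by (rule landau_o.bigE)
  then obtain T where T: "\<And>t. norm t \<ge> T \<Longrightarrow> norm (exp (C * \<bar>t\<bar>)) \<le> a * norm (Hs_norm 1 (u t))"
    unfolding eventually_at_infinity by blast
  \<comment> \<open>The exponential exceeds \<open>1 + C t\<close>, and hence \<open>a B\<close>, at this time.\<close>
  define t where "t = \<bar>T\<bar> + \<bar>a * B\<bar> / C"
  have "0 \<le> \<bar>a * B\<bar> / C" using C by simp
  then have t: "norm t \<ge> T" "\<bar>t\<bar> \<ge> \<bar>a * B\<bar> / C" by (auto simp: t_def)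
  have "\<bar>a * B\<bar> \<le> C * \<bar>t\<bar>" using t(2) C by (simp add: pos_divide_le_eq mult.commute)
  moreover have "1 + C * \<bar>t\<bar> \<le> exp (C * \<bar>t\<bar>)" by simp
  moreover have "exp (C * \<bar>t\<bar>) \<le> a * Hs_norm 1 (u t)" using T[OF t(1)] by simp
  moreover have "a * Hs_norm 1 (u t) \<le> a * B" using a assms by (intro mult_left_mono) auto
  ultimately show False by linarith
qed

theorem theorem1p3:
  fixes \<alpha> :: real and b0 c0 p0 :: complex and u :: "real \<Rightarrow> complex \<Rightarrow> complex"
  assumes "\<alpha> \<noteq> 0"
    and "c0 \<noteq> 0"
    and "cmod p0 < 1"
    and "alpha_szego_solution \<alpha> u"
    and "circle_ae_eq (u 0) (\<lambda>z. b0 + c0 * z / (1 - p0 * z))"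
  shows "(\<alpha> < 0 \<longrightarrow> (\<forall>s\<ge>0. \<exists>C. \<forall>t. u t \<in> Hs_circle s \<and> Hs_norm s (u t) \<le> C)) \<and>
    (\<alpha> > 0 \<longrightarrow>
      (exponential_sobolev_growth u \<longleftrightarrow>
        szego_energy \<alpha> (u 0) = 1/4 * (szego_mass (u 0))\<^sup>2 + \<alpha> / 2 * szego_mass (u 0)))"
proof -
  define K where "K = (cmod c0)\<^sup>2 / (1 - (cmod p0)\<^sup>2)\<^sup>2"
  have y0: "1 - (cmod p0)\<^sup>2 > 0" using assms(3) by (simp add: abs_square_less_1)
  then have K: "K > 0" and K0: "(cmod c0)\<^sup>2 = K * (1 - (cmod p0)\<^sup>2)\<^sup>2" using assms(2)
      by (auto simp: K_def)
  obtain b c p :: "real \<Rightarrow> complex" where init: "b 0 = b0" "c 0 = c0" "p 0 = p0"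
    and flow: "\<And>t. ((\<lambda>t. (b t, c t, p t)) has_vector_derivative profile_field \<alpha> K (b t, c t, p t))
        (at t)"
    and p1: "\<And>t. cmod (p t) < 1"
    and cK: "\<And>t. (cmod (c t))\<^sup>2 = K * (1 - (cmod (p t))\<^sup>2)\<^sup>2"
    and bK: "\<And>t. (cmod (b t))\<^sup>2 - K * (cmod (p t))\<^sup>2 = (cmod b0)\<^sup>2 - K * (cmod p0)\<^sup>2"
    by (rule profile_flow[OF assms(3) K0]) blast
  define Q where "Q = (cmod b0)\<^sup>2 + K * (1 - (cmod p0)\<^sup>2)"
  have bQ: "(cmod (b t))\<^sup>2 + K * (1 - (cmod (p t))\<^sup>2) = Q" for t
    using bK[of t] by (simp add: Q_def algebra_simps)
  have bleQ: "(cmod (b t))\<^sup>2 \<le> Q" for t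
  proof -
    have "0 \<le> K * (1 - (cmod (p t))\<^sup>2)" using K p1[of t] by (simp add: abs_square_le_1)
    then show ?thesis using bQ[of t] by linarith
  qed
  have u2: "u t \<in> L2_circle" for t using assms(4)
      by (auto simp: alpha_szego_solution_def intro: Hs_plus_L2)
  have ae: "AE z in circle_measure. u t z = rational_profile (b t) (c t) (p t) z" for t
  proof (rule szego_rational_uniqueness[OF assms(4) flow p1 cK])
    show "AE z in circle_measure. u 0 z = rational_profile (b 0) (c 0) (p 0) z"
      using circle_ae_eq_iff[OF assms(5)] by eventually_elim
          (simp add: init rational_profile_def pole_profile_def)
  qed
  define \<delta> where "\<delta> = Re (c0 * cnj p0 * cnj b0) + (Q + K - \<alpha>) / 2 * (1 - (cmod p0)\<^sup>2) - K
      * (1 - (cmod p0)\<^sup>2)\<^sup>2"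
  have condition: "szego_energy \<alpha> (u 0) = 1/4 * (szego_mass (u 0))\<^sup>2 + \<alpha> / 2 * szego_mass (u 0) \<longleftrightarrow> \<delta>
      = 0"
    unfolding \<delta>_def using energy_mass_condition[OF u2 ae[of 0] p1 cK K, of Q \<alpha>] bQ[of 0]
        unfolding init by simp
  interpret profile_dynamics \<alpha> K Q "(Q + K - \<alpha>) / 2" \<delta> "\<lambda>t. 1 - (cmod (p t))\<^sup>2"
    "\<lambda>t. Re (c t * cnj (p t) * cnj (b t))" "\<lambda>t. Im (c t * cnj (p t) * cnj (b t))"
    using profile_flow_dynamics[OF K flow p1 cK bQ] unfolding init \<delta>_def .
  have bounded: "\<forall>s\<ge>0. \<exists>C. \<forall>t. u t \<in> Hs_circle s \<and> Hs_norm s (u t) \<le> C"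
    if "e > 0" "\<And>t. e \<le> 1 - (cmod (p t))\<^sup>2" for e
    by (intro allI impI Hs_bounded_of_pole_distance[where b=b and c=c and p=p and K=K and Q=Q
        and e=e]
        u2 ae p1 cK bleQ that less_imp_le[OF K])
  show ?thesis
  proof (intro conjI impI)
    assume "\<alpha> < 0"
    then obtain e where "e > 0" "\<And>t. e \<le> 1 - (cmod (p t))\<^sup>2"
      using bounded_below_off_critical critical_bounded_below by metis
    then show "\<forall>s\<ge>0. \<exists>C. \<forall>t. u t \<in> Hs_circle s \<and> Hs_norm s (u t) \<le> C" by (rule bounded)
  next
    assume \<alpha>: "\<alpha> > 0"
    show "exponential_sobolev_growth u \<longleftrightarrow>
        szego_energy \<alpha> (u 0) = 1/4 * (szego_mass (u 0))\<^sup>2 + \<alpha> / 2 * szego_mass (u 0)"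
      unfolding condition
    proof
      assume growth: "exponential_sobolev_growth u"
      show "\<delta> = 0"
      proof (rule ccontr)
        assume "\<delta> \<noteq> 0"
        then obtain e where "e > 0" "\<And>t. e \<le> 1 - (cmod (p t))\<^sup>2"
          using bounded_below_off_critical by metis
        from bounded[OF this] obtain B where "\<And>t. Hs_norm 1 (u t) \<le> B" by (metis zero_le_one)
        then show False using bounded_not_exponential_growth growth by metis
      qed
    next
      assume "\<delta> = 0"
      from critical_growth[OF this \<alpha>] obtain k m M where "k > 0" "m > 0" "M > 0"
        "\<And>t. m * exp (k * \<bar>t\<bar>) \<le> 1 / (1 - (cmod (p t))\<^sup>2)"
            "\<And>t. 1 / (1 - (cmod (p t))\<^sup>2) \<le> M * exp (k * \<bar>t\<bar>)"
        by blast
      then show "exponential_sobolev_growth u"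
        by (rule Hs_growth_of_pole_distance[OF u2 ae p1 cK K bleQ])
    qed
  qed
qed

end
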